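(* Let $f:\mathbb{R}\to\mathbb{C}$ be a continuous $2\pi$-periodic function such that $f(0)=1$ and $|f(x)|^2+|f(x+\pi)|^2\le 1$ for all $x\in\mathbb{R}$, and let $\varepsilon>0$. Then there exists a compactly supported Parseval wavelet frame with a refinement mask $m_0$ (in the sense of the unitary extension principle, as defined in the context) such that $$\|f-m_0\|_{C}=\sup_{x\in\mathbb{R}}|f(x)-m_0(x)|<\varepsilon,$$ and such that the corresponding refinable function $\varphi$ has stable integer shifts.
   Context: Notation. $L_2$ denotes the space of $2\pi$-periodic measurable functions on $\mathbb{R}$ that are square-integrable over $\mathbb{T}=[-\pi,\pi)$. $C$ denotes the space of $2\pi$-periodic continuous functions, with the sup norm $\|\cdot\|_C$. The Fourier transform is normalized so that $\widehat{g}(\xi)=\int_{\mathbb{R}}g(x)e^{-i x\xi}\,dx$ for $g\in L_1(\mathbb{R})\cap L_2(\mathbb{R})$, extended to $L_2(\mathbb{R})$ as usual. For $\psi_r\in L_2(\mathbb{R})$ and $j,k\in\mathbb{Z}$ put $\psi_{r,j,k}(x)=2^{j/2}\psi_r(2^jx+k)$. Wavelet frame with refinement mask $m_0$ (unitary extension principle setting). A Parseval wavelet frame with refinement mask $m_0\in L_2$ and refinable function $\varphi\in L_2(\mathbb{R})$ consists of the following data: a refinable function $\varphi$ satisfying the refinement equation $$\widehat{\varphi}(2\xi)=m_0(\xi)\widehat{\varphi}(\xi),\qquad \lim_{\xi\to0}\widehat{\varphi}(\xi)=1;$$ an integer $q\ge 1$ and wavelet masks $m_1,\dots,m_q\in L_2$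 such that for a.e. $\xi\in\mathbb{T}$ $$\sum_{r=0}^{q}|m_r(\xi)|^2=1,\qquad \sum_{r=0}^{q}m_r(\xi)\overline{m_r(\xi+\pi)}=0;$$ and wavelet generators $\psi_1,\dots,\psi_q\in L_2(\mathbb{R})$ defined by $\widehat{\psi_r}(2\xi)=m_r(\xi)\widehat{\varphi}(\xi)$, $r=1,\dots,q$, such that the system $\{\psi_{r,j,k}\}_{j,k\in\mathbb{Z},\,r=1,\dots,q}$ is a Parseval frame for $L_2(\mathbb{R})$, i.e. $\sum_{r=1}^{q}\sum_{j,k\in\mathbb{Z}}|\langle g,\psi_{r,j,k}\rangle|^2=\|g\|_{L_2(\mathbb{R})}^2$ for every $g\in L_2(\mathbb{R})$. The wavelet frame is compactly supported if all the generators $\psi_1,\dots,\psi_q$ have compact support. Stable integer shifts. The integer shifts of $\varphi\in L_2(\mathbb{R})$ are stable if there are constants $0<A\le B<\infty$ such that for every finitely supported complex sequence $(c_k)_{k\in\mathbb{Z}}$ $$A\sum_{k}|c_k|^2\le\Big\|\sum_{k}c_k\varphi(\cdot+k)\Big\|_{L_2(\mathbb{R})}^2\le B\sum_{k}|c_k|^2 .$$ *)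

theory Defs
  imports "HOL-Analysis.Analysis"
begin

definition C_2pi :: "(real \<Rightarrow> complex) set" where
  "C_2pi = {f. continuous_on UNIV f \<and> (\<forall>x. f (x + 2 * pi) = f x)}"

definition L2_2pi :: "(real \<Rightarrow> complex) set" where
  "L2_2pi = {f. f \<in> borel_measurable lebesgue \<and> (\<forall>x. f (x + 2 * pi) = f x) \<and>
     set_integrable lebesgue {-pi..<pi} (\<lambda>x. (cmod (f x))\<^sup>2)}"

text \<open>Elements of the Lebesgue spaces are represented by functions, not by classes modulo
  null sets, so equations between such elements are stated almost everywhere.\<close>

definition L1_real :: "(real \<Rightarrow> complex) set" where
  "L1_real = {f. integrable lebesgue f}"

definition L2_real :: "(real \<Rightarrow> complex) set" where
  "L2_real = {f. f \<in> borel_measurable lebesgue \<and> integrable lebesgue (\<lambda>x. (cmod (f x))\<^sup>2)}"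

definition L2_norm :: "(real \<Rightarrow> complex) \<Rightarrow> real" where
  "L2_norm f = sqrt (\<integral>x. (cmod (f x))\<^sup>2 \<partial>lebesgue)"

definition L2_inner :: "(real \<Rightarrow> complex) \<Rightarrow> (real \<Rightarrow> complex) \<Rightarrow> complex" where
  "L2_inner f g = (\<integral>x. f x * cnj (g x) \<partial>lebesgue)"

definition L2_converges :: "(nat \<Rightarrow> real \<Rightarrow> complex) \<Rightarrow> (real \<Rightarrow> complex) \<Rightarrow> bool" where
  "L2_converges h g \<longleftrightarrow> (\<forall>n. h n \<in> L2_real) \<and> g \<in> L2_real \<and>
     (\<lambda>n. L2_norm (\<lambda>x. h n x - g x)) \<longlonglongrightarrow> 0"

definition fourier_L1 :: "(real \<Rightarrow> complex) \<Rightarrow> real \<Rightarrow> complex" where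
  "fourier_L1 g \<xi> = (\<integral>x. g x * exp (- (\<i> * of_real x * of_real \<xi>)) \<partial>lebesgue)"

text \<open>The Fourier transform on the square-integrable functions, as the extension by continuity of
  the integral transform. The second argument is determined only up to a null set, so this is a
  relation saying that \<open>G\<close> is a representative of the Fourier transform of \<open>g\<close>.\<close>

definition has_fourier_L2 :: "(real \<Rightarrow> complex) \<Rightarrow> (real \<Rightarrow> complex) \<Rightarrow> bool" where
  "has_fourier_L2 g G \<longleftrightarrow>
     (\<exists>h. (\<forall>n. h n \<in> L1_real) \<and> L2_converges h g \<and> L2_converges (\<lambda>n. fourier_L1 (h n)) G)"

definition dyadic :: "(real \<Rightarrow> complex) \<Rightarrow> int \<Rightarrow> int \<Rightarrow> real \<Rightarrow> complex" where
  "dyadic \<psi> j k x = of_real (2 powr (of_int j / 2)) * \<psi> (2 powi j * x + of_int k)"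

text \<open>The generators are \<open>\<psi> r\<close> for \<open>r = 1, \<dots>, q\<close>.\<close>

definition parseval_system :: "nat \<Rightarrow> (nat \<Rightarrow> real \<Rightarrow> complex) \<Rightarrow> bool" where
  "parseval_system q \<psi> \<longleftrightarrow>
     (\<forall>g\<in>L2_real.
        ((\<lambda>(r, j, k). (cmod (L2_inner g (dyadic (\<psi> r) j k)))\<^sup>2) has_sum (L2_norm g)\<^sup>2)
          ({1..q} \<times> (UNIV :: int set) \<times> (UNIV :: int set)))"

text \<open>The refinement mask is \<open>m 0\<close>, and \<open>m r\<close> for \<open>r = 1, \<dots>, q\<close> are the wavelet masks. The limit
  at the origin is that of some representative \<open>\<phi>h\<close> of the Fourier transform of \<open>\<phi>\<close>.\<close>

definition parseval_wavelet_frame ::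
    "nat \<Rightarrow> (nat \<Rightarrow> real \<Rightarrow> complex) \<Rightarrow> (real \<Rightarrow> complex) \<Rightarrow> (nat \<Rightarrow> real \<Rightarrow> complex) \<Rightarrow> bool" where
  "parseval_wavelet_frame q m \<phi> \<psi> \<longleftrightarrow>
     q \<ge> 1 \<and> \<phi> \<in> L2_real \<and>
     (\<forall>r\<in>{0..q}. m r \<in> L2_2pi) \<and>
     (\<forall>r\<in>{1..q}. \<psi> r \<in> L2_real) \<and>
     (AE \<xi> in lebesgue. \<xi> \<in> {-pi..<pi} \<longrightarrow>
        (\<Sum>r=0..q. (cmod (m r \<xi>))\<^sup>2) = 1 \<and>
        (\<Sum>r=0..q. m r \<xi> * cnj (m r (\<xi> + pi))) = 0) \<and>
     (\<exists>\<phi>h. has_fourier_L2 \<phi> \<phi>h \<and>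
        (AE \<xi> in lebesgue. \<phi>h (2 * \<xi>) = m 0 \<xi> * \<phi>h \<xi>) \<and>
        (\<phi>h \<longlongrightarrow> 1) (at 0) \<and>
        (\<forall>r\<in>{1..q}. \<exists>\<psi>h. has_fourier_L2 (\<psi> r) \<psi>h \<and>
           (AE \<xi> in lebesgue. \<psi>h (2 * \<xi>) = m r \<xi> * \<phi>h \<xi>))) \<and>
     parseval_system q \<psi>"

text \<open>Compactness of the essential support, which does not depend on the representative.\<close>

definition compactly_supported :: "(real \<Rightarrow> complex) \<Rightarrow> bool" where
  "compactly_supported g \<longleftrightarrow> (\<exists>K. compact K \<and> (AE x in lebesgue. x \<notin> K \<longrightarrow> g x = 0))"

definition stable_integer_shifts :: "(real \<Rightarrow> complex) \<Rightarrow> bool" where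
  "stable_integer_shifts \<phi> \<longleftrightarrow>
     (\<exists>A B :: real. 0 < A \<and> A \<le> B \<and>
        (\<forall>c :: int \<Rightarrow> complex. finite {k. c k \<noteq> 0} \<longrightarrow>
           A * (\<Sum>k | c k \<noteq> 0. (cmod (c k))\<^sup>2)
             \<le> (L2_norm (\<lambda>x. \<Sum>k | c k \<noteq> 0. c k * \<phi> (x + of_int k)))\<^sup>2 \<and>
           (L2_norm (\<lambda>x. \<Sum>k | c k \<noteq> 0. c k * \<phi> (x + of_int k)))\<^sup>2
             \<le> B * (\<Sum>k | c k \<noteq> 0. (cmod (c k))\<^sup>2)))"

end

theory Submission
  imports Defs "HOL-Computational_Algebra.Fundamental_Theorem_Algebra"
begin

text \<open>
  The frame is built from a trigonometric polynomial \<open>m\<^sub>0\<close> close to \<open>f\<close>, and everything about the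
  refinable function is done in the time domain, where \<open>m\<^sub>0 = \<Sum>k. a k * cis (k * x)\<close> acts by
  \<open>w \<mapsto> (\<lambda>x. 2 * (\<Sum>k. a k * w (2 * x + k)))\<close>.

  The mask (\<open>mask_approximation\<close>). Write \<open>c x = (1 + cos x) / 2\<close> and \<open>s x = (sin x)\<^sup>2\<close>. With
  \<open>m\<^sub>0 = c + s * t\<close> the values \<open>m\<^sub>0 0 = 1\<close> and \<open>m\<^sub>0 pi = 0\<close> are automatic, and the sub-unitarity of
  \<open>m\<^sub>0\<close> becomes an inequality for \<open>t\<close> that \<open>t = (f - c) / (s + \<sigma>)\<close> satisfies strictly. So \<open>t\<close> may be
  replaced by a nearby trigonometric polynomial, and then shifted by a small constant so that
  \<open>m\<^sub>0\<close> has no zero in \<open>[-pi/2, pi/2]\<close>.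

  The wavelet masks (\<open>uep_masks_exist\<close>). By the Fejer-Riesz theorem the defect
  \<open>1 - \<bar>m\<^sub>0 x\<bar>\<^sup>2 - \<bar>m\<^sub>0 (x + pi)\<bar>\<^sup>2\<close> is a squared modulus, so the polyphase vector of \<open>m\<^sub>0\<close> extends to a unit
  vector \<open>v\<close> of length three, and the rows of the projection \<open>1 - v v\<^sup>*\<close> are the polyphase components
  of three wavelet masks.

  The refinable function (\<open>refinable_function_exists\<close>). The refinement operator of \<open>m\<^sub>0\<close> preserves the
  integral, the support in \<open>[-N, N]\<close> and the contractivity of the synthesis map \<open>c \<mapsto> \<Sum>k. c k * w (x + k)\<close>,
  because the filter bank of all masks is an isometry. Averages of its iterates on the unit box are
  therefore almost fixed points. The almost fixed points with these three properties form nested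
  convex sets, so elements of nearly minimal norm form a Cauchy sequence by the parallelogram law, and
  their limit is a fixed point.

  The frame (\<open>wavelet_parseval\<close>). The isometry of the filter bank says that the energy of the
  coefficients of \<open>g\<close> at level \<open>j + 1\<close> is the energy at level \<open>j\<close> plus that of the wavelet
  coefficients at level \<open>j\<close>. The sum telescopes; the energies tend to \<open>\<parallel>g\<parallel>\<^sup>2\<close> at fine levels and to zero at
  coarse levels when \<open>g\<close> is continuous with compact support, and such \<open>g\<close> are dense.

  The Fourier transform enters only at the end. For a square integrable function with compact support
  the integral transform is square integrable with the Plancherel bound (\<open>fourier_L2_bound\<close>), by
  Bessel's inequality for exponentials on a period. This one-sided bound gives the lower stability
  estimate (\<open>shift_sum_lower_bound\<close>), since the transform of the refinable function does not vanish on
  \<open>[-pi, pi]\<close>: a zero could be halved repeatedly, down to the origin, where the transform is one. The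
  upper stability estimate is the contractivity of the synthesis map.
\<close>

section \<open>Trigonometric polynomials\<close>

definition trig_poly :: "(real \<Rightarrow> complex) \<Rightarrow> bool" where
  "trig_poly f \<longleftrightarrow> (\<exists>A a. finite A \<and> f = (\<lambda>x. \<Sum>k\<in>A. a k * cis (of_int k * x)))"

lemma trig_polyI:
  assumes "finite A" "\<And>x. f x = (\<Sum>k\<in>A. a k * cis (of_int k * x))"
  shows "trig_poly f"
  using assms by (auto simp: trig_poly_def fun_eq_iff)

lemma trig_poly_monomial: "trig_poly (\<lambda>x. c * cis (of_int k * x))"
  by (rule trig_polyI[of "{k}" _ "\<lambda>_. c"]) auto

lemma trig_poly_const: "trig_poly (\<lambda>x. c)"
  using trig_poly_monomial[of c 0] by simp

lemma trig_poly_add: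
  assumes "trig_poly f" "trig_poly g"
  shows "trig_poly (\<lambda>x. f x + g x)"
proof -
  obtain A a where A: "finite A" "f = (\<lambda>x. \<Sum>k\<in>A. a k * cis (of_int k * x))"
    using assms(1) unfolding trig_poly_def by blast
  obtain B b where B: "finite B" "g = (\<lambda>x. \<Sum>k\<in>B. b k * cis (of_int k * x))"
    using assms(2) unfolding trig_poly_def by blast
  show ?thesis
  proof (rule trig_polyI)
    show "finite (A \<union> B)" using A B by auto
    fix x
    have "f x = (\<Sum>k\<in>A \<union> B. (if k \<in> A then a k else 0) * cis (of_int k * x))"
      unfolding A by (rule sum.mono_neutral_cong_left) (use A B in auto)
    moreover have "g x = (\<Sum>k\<in>A \<union> B. (if k \<in> B then b k else 0) * cis (of_int k * x))"
      unfolding B by (rule sum.mono_neutral_cong_left) (use A B in auto)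
    ultimately show "f x + g x = (\<Sum>k\<in>A \<union> B. ((if k \<in> A then a k else 0)
        + (if k \<in> B then b k else 0)) * cis (of_int k * x))"
      by (simp only: distrib_right sum.distrib)
  qed
qed

lemma trig_poly_sum:
  assumes "\<And>i. i \<in> I \<Longrightarrow> trig_poly (f i)"
  shows "trig_poly (\<lambda>x. \<Sum>i\<in>I. f i x)"
  using assms
  by (induction I rule: infinite_finite_induct) (auto intro: trig_poly_const trig_poly_add)

text \<open>
  An operation that may be carried out term by term on exponential sums preserves trigonometric
  polynomials; conjugation and dilation are of this kind.
\<close>
lemma trig_poly_induct_op:
  assumes f: "trig_poly f"
    and op: "\<And>A a. finite A \<Longrightarrow> Op (\<lambda>x. \<Sum>k\<in>A. a k * cis (of_int k * x)) = (\<lambda>x. \<Sum>k\<in>A. G (a k) k x)"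
    and G: "\<And>c k. trig_poly (G c k)"
  shows "trig_poly (Op f)"
proof -
  obtain A a where A: "finite A" "f = (\<lambda>x. \<Sum>k\<in>A. a k * cis (of_int k * x))"
    using f unfolding trig_poly_def by blast
  show ?thesis unfolding A(2) op[OF A(1)] by (intro trig_poly_sum G)
qed

lemma trig_poly_mult:
  assumes "trig_poly f" "trig_poly g"
  shows "trig_poly (\<lambda>x. f x * g x)"
proof -
  obtain A a where A: "finite A" "f = (\<lambda>x. \<Sum>k\<in>A. a k * cis (of_int k * x))"
    using assms(1) unfolding trig_poly_def by blast
  obtain B b where B: "finite B" "g = (\<lambda>x. \<Sum>k\<in>B. b k * cis (of_int k * x))"
    using assms(2) unfolding trig_poly_def by blast
  have "(\<lambda>x. f x * g x) = (\<lambda>x. \<Sum>k\<in>A. \<Sum>l\<in>B. (a k * b l) * cis (of_int (k + l) * x))"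
    unfolding A B by (simp add: sum_product cis_mult[symmetric] algebra_simps)
  then show ?thesis by (simp only:) (intro trig_poly_sum trig_poly_monomial)
qed

lemma trig_poly_cnj:
  assumes "trig_poly f"
  shows "trig_poly (\<lambda>x. cnj (f x))"
proof (rule trig_poly_induct_op[OF assms, where Op = "\<lambda>f x. cnj (f x)"
        and G = "\<lambda>c k x. cnj c * cis (of_int (- k) * x)"])
  show "trig_poly (\<lambda>x. cnj c * cis (of_int (- k) * x))" for c k by (rule trig_poly_monomial)
qed (simp add: cis_cnj)

lemma trig_poly_dilate2:
  assumes "trig_poly f"
  shows "trig_poly (\<lambda>x. f (2 * x))"
proof (rule trig_poly_induct_op[OF assms, where Op = "\<lambda>f x. f (2 * x)"
        and G = "\<lambda>c k x. c * cis (of_int (2 * k) * x)"])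
  show "trig_poly (\<lambda>x. c * cis (of_int (2 * k) * x))" for c k by (rule trig_poly_monomial)
qed (simp add: mult_ac)

lemma trig_poly_cmult: "trig_poly f \<Longrightarrow> trig_poly (\<lambda>x. c * f x)"
  by (intro trig_poly_mult trig_poly_const)

lemma trig_poly_diff:
  assumes "trig_poly f" "trig_poly g" shows "trig_poly (\<lambda>x. f x - g x)"
  using trig_poly_add[OF assms(1) trig_poly_cmult[OF assms(2), of "-1"]] by simp

lemma trig_poly_cis: "trig_poly cis"
  using trig_poly_monomial[of 1 1] by simp

lemma trig_poly_cos: "trig_poly (\<lambda>x. of_real (cos x))"
proof -
  have "(\<lambda>x. of_real (cos x)) = (\<lambda>x. (1/2) * (cis x + cnj (cis x)))"
    by (auto simp: complex_eq_iff)
  then show ?thesis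
    by (simp only:) (intro trig_poly_cmult trig_poly_add trig_poly_cnj trig_poly_cis)
qed

lemma trig_poly_sin: "trig_poly (\<lambda>x. of_real (sin x))"
proof -
  have "(\<lambda>x. of_real (sin x)) = (\<lambda>x. (- \<i>/2) * (cis x - cnj (cis x)))"
    by (auto simp: complex_eq_iff)
  then show ?thesis
    by (simp only:) (intro trig_poly_cmult trig_poly_diff trig_poly_cnj trig_poly_cis)
qed

lemma trig_poly_periodic:
  assumes "trig_poly f" shows "f (x + 2 * pi) = f x"
proof -
  have "cis (of_int k * (x + 2 * pi)) = cis (of_int k * x)" for k
    using cis_multiple_2pi[of "of_int k"]
    by (simp add: distrib_left cis_mult[symmetric] mult_ac)
  then show ?thesis using assms by (auto simp: trig_poly_def)
qed

lemma cis_has_vector_derivative: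
  "((\<lambda>x. c * cis (r * x)) has_vector_derivative c * (\<i> * of_real r * cis (r * x))) (at x within A)"
proof -
  have "((\<lambda>z. c * exp (\<i> * of_real r * z)) has_field_derivative c * (\<i> * of_real r * exp (\<i> * of_real r * of_real x))) (at (of_real x))"
    by (auto intro!: derivative_eq_intros)
  from has_vector_derivative_real_field[OF this] show ?thesis
    by (simp add: cis_conv_exp mult_ac)
qed

lemma trig_poly_differentiable:
  assumes "trig_poly f" shows "f differentiable at x"
proof -
  obtain A a where A: "finite A" "f = (\<lambda>x. \<Sum>k\<in>A. a k * cis (of_int k * x))"
    using assms unfolding trig_poly_def by blast
  show ?thesis unfolding A(2)
    by (intro differentiable_sum A(1) ballI differentiableI_vector[OF cis_has_vector_derivative])
qed

lemma trig_poly_continuous: "trig_poly f \<Longrightarrow> continuous_on A f"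
  by (meson continuous_at_imp_continuous_on differentiable_imp_continuous_within trig_poly_differentiable)

lemma trig_poly_C_2pi: "trig_poly f \<Longrightarrow> f \<in> C_2pi"
  by (auto simp: C_2pi_def trig_poly_continuous trig_poly_periodic)

lemma C_2pi_int_period:
  assumes "f \<in> C_2pi" shows "f (x + 2 * pi * of_int n) = f x"
proof -
  have p: "f (y + 2 * pi) = f y" for y using assms by (auto simp: C_2pi_def)
  have nat: "f (y + 2 * pi * real m) = f y" for y m
    by (induction m) (simp_all add: distrib_left p flip: add.assoc, metis add.commute add.left_commute p)
  show ?thesis
  proof (cases "n \<ge> 0")
    case True then show ?thesis using nat[of x "nat n"] by simp
  next
    case False then show ?thesis using nat[of "x + 2 * pi * of_int n" "nat (-n)"] by simp
  qed
qed

text \<open>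
  This moves pointwise statements about periodic functions to a compact interval. Sine and cosine
  are carried along because they occur next to \<open>f\<close> where this is used.
\<close>
lemma C_2pi_reduce:
  assumes "f \<in> C_2pi"
  obtains y where "y \<in> {-pi..pi}" "f x = f y" "sin x = sin y" "cos x = cos y"
proof -
  define n where "n = \<lfloor>(x + pi) / (2 * pi)\<rfloor>"
  define y where "y = x + 2 * pi * of_int (- n)"
  have "of_int n \<le> (x + pi) / (2 * pi)" "(x + pi) / (2 * pi) < of_int n + 1"
    unfolding n_def by linarith+
  then have "y \<in> {-pi..pi}"
    by (auto simp: y_def field_simps)
  moreover have "f x = f y" unfolding y_def using C_2pi_int_period[OF assms] by metis
  moreover have "sin x = sin y" "cos x = cos y"
    using sin_int_2pin[of n] cos_int_2pin[of n] unfolding y_def by (auto simp: sin_diff cos_diff)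
  ultimately show ?thesis using that by blast
qed

text \<open>
  A continuous periodic function is a continuous function on the unit circle, where polynomials in
  the real and the imaginary part are trigonometric polynomials; so this is the Stone-Weierstrass
  theorem on the circle. The transported function is seen to be continuous by means of two branches
  of the argument, whose cuts are opposite half-lines.
\<close>
lemma trig_poly_dense:
  assumes "f \<in> C_2pi" "e > 0"
  obtains t where "trig_poly t" "\<And>x. cmod (f x - t x) < e"
proof -
  define S where "S = sphere (0::complex) 1"
  define g where "g z = f (Arg z)" for z
  have g_cis: "g (cis x) = f x" for x
  proof -
    obtain y where y: "y \<in> {-pi..pi}" "f x = f y" "sin x = sin y" "cos x = cos y"
      using C_2pi_reduce[OF assms(1)] by blast
    have c: "cis x = cis y" using y by (simp add: complex_eq_iff)
    show ?thesis
    proof (cases "y = -pi")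
      case True
      then have "f y = f pi" using assms(1) by (auto simp: C_2pi_def dest: spec[of _ "-pi"])
      moreover have "cis x = cis pi" using c True by (simp add: complex_eq_iff)
      then have "Arg (cis x) = pi" using Arg_cis[of pi] by simp
      ultimately show ?thesis using y by (simp add: g_def)
    next
      case False
      then have "Arg (cis y) = y" using y by (simp add: Arg_cis)
      then show ?thesis using c y by (simp add: g_def)
    qed
  qed
  have fc: "isCont f x" for x using assms(1) by (auto simp: C_2pi_def continuous_on_eq_continuous_at)
  have gc: "continuous_on S g"
  proof (rule continuous_at_imp_continuous_on, rule ballI)
    fix z assume z: "z \<in> S"
    show "isCont g z"
    proof (cases "z \<in> \<real>\<^sub>\<le>\<^sub>0")
      case False
      then show ?thesis unfolding g_def
        by (intro isCont_o2[OF continuous_at_Arg]) (auto simp: fc)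
    next
      case True
      then have z2: "z \<notin> \<real>\<^sub>\<ge>\<^sub>0" using z by (auto simp: S_def complex_nonpos_Reals_iff complex_nonneg_Reals_iff cmod_def)
      have "g = (\<lambda>z. f (Arg2pi z))"
      proof
        fix w :: complex
        show "g w = f (Arg2pi w)"
        proof (cases "w = 0")
          case True then show ?thesis by (simp add: g_def Arg2pi_def Arg_zero)
        next
          case False
          have "cis (Arg w) = cis (Arg2pi w)"
            using False Arg2pi_eq[of w] Arg_eq[of w] by (metis mult_cancel_left cis_conv_exp norm_eq_zero of_real_eq_0_iff)
          then have "g (cis (Arg w)) = g (cis (Arg2pi w))" by simp
          then show ?thesis unfolding g_cis by (simp add: g_def)
        qed
      qed
      then show ?thesis
        using isCont_o2[OF continuous_at_Arg2pi[OF z2], of f] fc by simp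
    qed
  qed
  have dense_real: "\<exists>p. trig_poly (\<lambda>x. of_real (p (cis x))) \<and> (\<forall>z\<in>S. \<bar>h z - p z\<bar> < e/2)"
    if h: "continuous_on S h" for h :: "complex \<Rightarrow> real"
  proof -
    have "\<exists>p. (trig_poly (\<lambda>x. of_real (p (cis x))) \<and> continuous_on UNIV p) \<and> (\<forall>z\<in>S. \<bar>h z - p z\<bar> < e/2)"
    proof (rule Stone_Weierstrass_HOL[OF _ _ _ _ _ _ h])
      show "compact S" by (simp add: S_def)
      show "e/2 > 0" using assms by simp
      fix z w :: complex assume "z \<in> S \<and> w \<in> S \<and> z \<noteq> w"
      then consider "Re z \<noteq> Re w" | "Im z \<noteq> Im w" by (auto simp: complex_eq_iff)
      then show "\<exists>f. (trig_poly (\<lambda>x. of_real (f (cis x))) \<and> continuous_on UNIV f) \<and> f z \<noteq> f w"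
      proof cases
        case 1 then show ?thesis using trig_poly_cos by (intro exI[of _ Re]) (auto intro: continuous_intros)
      next
        case 2 then show ?thesis using trig_poly_sin by (intro exI[of _ Im]) (auto intro: continuous_intros)
      qed
    qed (auto intro: trig_poly_const trig_poly_add trig_poly_mult continuous_intros intro: continuous_on_subset)
    then show ?thesis by blast
  qed
  obtain p where p: "trig_poly (\<lambda>x. of_real (p (cis x)))" "\<And>z. z \<in> S \<Longrightarrow> \<bar>Re (g z) - p z\<bar> < e/2"
    using dense_real[of "\<lambda>z. Re (g z)"] gc by (auto intro: continuous_intros)
  obtain q where q: "trig_poly (\<lambda>x. of_real (q (cis x)))" "\<And>z. z \<in> S \<Longrightarrow> \<bar>Im (g z) - q z\<bar> < e/2"
    using dense_real[of "\<lambda>z. Im (g z)"] gc by (auto intro: continuous_intros)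
  show ?thesis
  proof
    show "trig_poly (\<lambda>x. of_real (p (cis x)) + \<i> * of_real (q (cis x)))"
      by (intro trig_poly_add trig_poly_cmult p q)
    fix x
    have x: "cis x \<in> S" by (simp add: S_def)
    have "cmod (f x - (of_real (p (cis x)) + \<i> * of_real (q (cis x))))
        \<le> \<bar>Re (g (cis x)) - p (cis x)\<bar> + \<bar>Im (g (cis x)) - q (cis x)\<bar>"
      using cmod_le[of "f x - (of_real (p (cis x)) + \<i> * of_real (q (cis x)))"] by (simp add: g_cis)
    then show "cmod (f x - (of_real (p (cis x)) + \<i> * of_real (q (cis x)))) < e"
      using p(2)[OF x] q(2)[OF x] by linarith
  qed
qed

lemma integral_cis_int:
  "integral {-pi..pi} (\<lambda>x. cis (of_int k * x)) = (if k = 0 then 2 * pi else 0)"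
proof (cases "k = 0")
  case True then show ?thesis by (simp add: scaleR_conv_of_real)
next
  case False
  have "((\<lambda>x. cis (of_int k * x)) has_integral
      cis (of_int k * pi) / (\<i> * of_int k) - cis (of_int k * (- pi)) / (\<i> * of_int k)) {-pi..pi}"
  proof (rule fundamental_theorem_of_calculus)
    fix x :: real
    from cis_has_vector_derivative[of "1 / (\<i> * of_int k)" "of_int k"]
    show "((\<lambda>x. cis (of_int k * x) / (\<i> * of_int k)) has_vector_derivative cis (of_int k * x)) (at x within {-pi..pi})"
      using False by (simp add: mult_ac)
  qed simp
  moreover have "cis (of_int k * pi) = cis (of_int k * (- pi))"
    using sin_npi_int[of k] by (simp add: complex_eq_iff mult.commute)
  ultimately show ?thesis using False by (simp add: integral_unique)
qed


text \<open>
  By orthogonality, the Fourier coefficients of a product \<open>f * cnj g\<close> are the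
  correlations of the coefficient sequences.
\<close>
lemma integral_trig_mult_cnj:
  assumes K: "finite K" and b: "\<And>k. k \<notin> K \<Longrightarrow> b k = 0"
  shows "integral {-pi..pi} (\<lambda>x. (\<Sum>k\<in>K. a k * cis (of_int k * x)) * cnj (\<Sum>k\<in>K. b k * cis (of_int k * x)) * cis (of_int d * x))
    = 2 * pi * (\<Sum>k\<in>K. a k * cnj (b (k + d)))"
proof -
  have "integral {-pi..pi} (\<lambda>x. (\<Sum>k\<in>K. a k * cis (of_int k * x)) * cnj (\<Sum>k\<in>K. b k * cis (of_int k * x)) * cis (of_int d * x))
    = integral {-pi..pi} (\<lambda>x. \<Sum>k\<in>K. \<Sum>l\<in>K. (a k * cnj (b l)) * cis (of_int (k - l + d) * x))"
  proof -
    have "a k * cis (of_int k * x) * cnj (b l * cis (of_int l * x)) * cis (of_int d * x)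
      = a k * cnj (b l) * cis (of_int (k - l + d) * x)" for k l x
    proof -
      have "cis (of_int (k - l + d) * x) = cis (of_int k * x) * cis (- (of_int l * x)) * cis (of_int d * x)"
        by (simp add: cis_mult algebra_simps)
      then show ?thesis by (simp add: cis_cnj)
    qed
    then show ?thesis unfolding cnj_sum unfolding sum_product unfolding sum_distrib_right by (simp only:)
  qed
  also have "\<dots> = (\<Sum>k\<in>K. \<Sum>l\<in>K. a k * cnj (b l) * (if l = k + d then 2 * pi else 0))"
  proof (subst integral_sum)
    show "(\<lambda>x. \<Sum>l\<in>K. (a k * cnj (b l)) * cis (of_int (k - l + d) * x)) integrable_on {-pi..pi}" for k
      by (intro integrable_continuous_real continuous_intros)
    show "(\<Sum>k\<in>K. integral {-pi..pi} (\<lambda>x. \<Sum>l\<in>K. (a k * cnj (b l)) * cis (of_int (k - l + d) * x)))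
       = (\<Sum>k\<in>K. \<Sum>l\<in>K. a k * cnj (b l) * (if l = k + d then 2 * pi else 0))"
    proof (rule sum.cong[OF refl], subst integral_sum)
      fix k l assume "k \<in> K"
      show "(\<lambda>x. (a k * cnj (b l)) * cis (of_int (k - l + d) * x)) integrable_on {-pi..pi}"
        by (intro integrable_continuous_real continuous_intros)
    next
      fix k
      show "(\<Sum>l\<in>K. integral {- pi..pi} (\<lambda>x. a k * cnj (b l) * cis (of_int (k - l + d) * x)))
        = (\<Sum>l\<in>K. a k * cnj (b l) * (if l = k + d then 2 * pi else 0))"
        unfolding integral_mult_right integral_cis_int by (intro sum.cong refl) auto
    qed (use K in auto)
  qed (use K in auto)
  also have "\<dots> = (\<Sum>k\<in>K. 2 * pi * (a k * cnj (b (k + d))))"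
  proof (rule sum.cong[OF refl])
    fix k
    have "(\<Sum>l\<in>K. a k * cnj (b l) * (if l = k + d then 2 * pi else 0))
      = (\<Sum>l\<in>K. if l = k + d then a k * cnj (b (k + d)) * (2 * pi) else 0)"
      by (intro sum.cong) auto
    also have "\<dots> = a k * cnj (b (k + d)) * (2 * pi)"
      using K b[of "k + d"] by (auto simp: sum.delta)
    finally show "(\<Sum>l\<in>K. a k * cnj (b l) * (if l = k + d then 2 * pi else 0)) = 2 * pi * (a k * cnj (b (k + d)))"
      by simp
  qed
  finally show ?thesis by (simp add: sum_distrib_left)
qed

lemma integral_norm_trig_poly:
  assumes K: "finite K"
  shows "integral {-pi..pi} (\<lambda>x. (cmod (\<Sum>k\<in>K. c k * cis (of_int k * x)))\<^sup>2) = 2 * pi * (\<Sum>k\<in>K. (cmod (c k))\<^sup>2)"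
proof -
  define b where "b k = (if k \<in> K then c k else 0)" for k
  have "complex_of_real (integral {-pi..pi} (\<lambda>x. (cmod (\<Sum>k\<in>K. c k * cis (of_int k * x)))\<^sup>2))
     = integral {-pi..pi} (\<lambda>x. complex_of_real ((cmod (\<Sum>k\<in>K. c k * cis (of_int k * x)))\<^sup>2))"
    by (rule integral_linear[OF _ bounded_linear_of_real, unfolded o_def, symmetric])
       (intro integrable_continuous_real continuous_intros)
  also have "\<dots> = integral {-pi..pi} (\<lambda>x. (\<Sum>k\<in>K. b k * cis (of_int k * x)) * cnj (\<Sum>k\<in>K. b k * cis (of_int k * x)) * cis (of_int 0 * x))"
    by (intro integral_cong) (simp only: complex_norm_square, simp add: b_def cong: sum.cong)
  also have "\<dots> = of_real (2 * pi) * (\<Sum>k\<in>K. b k * cnj (b (k + 0)))"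
    by (subst integral_trig_mult_cnj[OF K]) (auto simp: b_def)
  also have "\<dots> = complex_of_real (2 * pi * (\<Sum>k\<in>K. (cmod (c k))\<^sup>2))"
    using complex_norm_square[symmetric] by (simp add: b_def cong: sum.cong)
  finally show ?thesis by (simp only: of_real_eq_iff)
qed

lemma trig_poly_coeffs:
  assumes "trig_poly f"
  obtains N0 :: int and a where "\<And>k. \<bar>k\<bar> > N0 \<Longrightarrow> a k = 0"
    "\<And>N x. N \<ge> N0 \<Longrightarrow> f x = (\<Sum>k\<in>{-N..N}. a k * cis (of_int k * x))"
proof -
  obtain A c where A: "finite A" "f = (\<lambda>x. \<Sum>k\<in>A. c k * cis (of_int k * x))"
    using assms unfolding trig_poly_def by blast
  define a where "a k = (if k \<in> A then c k else 0)" for k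
  define N0 where "N0 = Max (insert 0 (abs ` A))"
  have N0: "\<bar>k\<bar> \<le> N0" if "k \<in> A" for k
    unfolding N0_def using A(1) that by (intro Max_ge) auto
  show ?thesis
  proof (rule that[of N0 a])
    show "a k = 0" if "\<bar>k\<bar> > N0" for k using N0[of k] that by (auto simp: a_def)
    fix N :: int and x :: real assume "N \<ge> N0"
    then have "A \<subseteq> {-N..N}" using N0 by fastforce
    then show "f x = (\<Sum>k\<in>{-N..N}. a k * cis (of_int k * x))"
      unfolding A(2) by (intro sum.mono_neutral_cong_left) (auto simp: a_def)
  qed
qed

text \<open>
  Even frequencies go into \<open>E\<close> and odd ones into \<open>H\<close>; a shift by
  \<open>pi\<close> changes the sign of the odd part only.
\<close>
lemma trig_poly_polyphase:
  assumes "trig_poly f"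
  obtains E H where "trig_poly E" "trig_poly H"
    "\<And>x. f x = E (2 * x) + cis x * H (2 * x)"
    "\<And>x. f (x + pi) = E (2 * x) - cis x * H (2 * x)"
proof -
  obtain A c where A: "finite A" "f = (\<lambda>x. \<Sum>k\<in>A. c k * cis (of_int k * x))"
    using assms unfolding trig_poly_def by blast
  define E where "E x = (\<Sum>k\<in>{k\<in>A. even k}. c k * cis (of_int (k div 2) * x))" for x
  define H where "H x = (\<Sum>k\<in>{k\<in>A. odd k}. c k * cis (of_int (k div 2) * x))" for x
  have split: "f x = (\<Sum>k\<in>{k\<in>A. even k}. c k * cis (of_int k * x)) + (\<Sum>k\<in>{k\<in>A. odd k}. c k * cis (of_int k * x))" for x
    unfolding A(2) using A(1) by (subst sum.union_disjoint[symmetric]) (auto intro: sum.cong)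
  have ev: "(\<Sum>k\<in>{k\<in>A. even k}. c k * cis (of_int k * x)) = E (2 * x)" for x
    unfolding E_def by (intro sum.cong refl) (auto elim!: evenE simp: mult_ac)
  have od: "(\<Sum>k\<in>{k\<in>A. odd k}. c k * cis (of_int k * x)) = cis x * H (2 * x)" for x
    unfolding H_def sum_distrib_left
    by (intro sum.cong refl) (auto elim!: oddE simp: cis_mult algebra_simps)
  have E: "trig_poly E" "trig_poly H"
    unfolding E_def[abs_def] H_def[abs_def] by (intro trig_poly_sum trig_poly_monomial)+
  have sh: "E (2 * (x + pi)) = E (2 * x)" "H (2 * (x + pi)) = H (2 * x)" for x
    using trig_poly_periodic[OF E(1), of "2 * x"] trig_poly_periodic[OF E(2), of "2 * x"] by (auto simp: algebra_simps)
  have "cis (x + pi) = - cis x" for x by (simp add: complex_eq_iff)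
  then show ?thesis using that[OF E] split ev od sh by simp
qed

text \<open>
  The two pointwise identities of the unitary extension principle, read off in Fourier coefficients.
  The first gives the sum of the contributions of even and odd indices, the second their difference
  up to the sign \<open>(-1)\<^sup>d\<close>; hence both contributions are one half of the Kronecker
  delta.
\<close>
lemma uep_coefficients:
  fixes a :: "nat \<Rightarrow> int \<Rightarrow> complex" and N :: int
  defines "K \<equiv> {-N..N}"
  defines "m \<equiv> \<lambda>r x. \<Sum>k\<in>K. a r k * cis (of_int k * x)"
  assumes supp: "\<And>r k. r \<le> q \<Longrightarrow> k \<notin> K \<Longrightarrow> a r k = 0"
    and u1: "\<And>x. (\<Sum>r\<le>q. m r x * cnj (m r x)) = 1"
    and u2: "\<And>x. (\<Sum>r\<le>q. m r x * cnj (m r (x + pi))) = 0"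
  shows "2 * (\<Sum>r\<le>q. \<Sum>n\<in>{n\<in>K. even n = p}. a r n * cnj (a r (n + d))) = (if d = 0 then 1 else 0)"
proof -
  have K: "finite K" by (simp add: K_def)
  define Z where "Z P = (\<Sum>r\<le>q. \<Sum>n\<in>{n\<in>K. even n = P}. a r n * cnj (a r (n + d)))" for P
  have mK: "(\<Sum>k\<in>K. a r k * cis (of_int k * x)) = m r x" for r x by (simp add: m_def)
  have ip: "(\<lambda>x. m r x * cnj (\<Sum>k\<in>K. b k * cis (of_int k * x)) * cis (of_int d * x)) integrable_on {-pi..pi}" for r b
    unfolding m_def by (intro integrable_continuous_real continuous_intros)
  have split: "(\<Sum>n\<in>K. g n) = (\<Sum>n\<in>{n\<in>K. even n = True}. g n) + (\<Sum>n\<in>{n\<in>K. even n = False}. g n)" for g :: "int \<Rightarrow> complex"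
    using K by (subst sum.union_disjoint[symmetric]) (auto intro: sum.cong)
  have key: "2 * pi * (\<Sum>r\<le>q. \<Sum>n\<in>K. a r n * cnj (b r (n + d)))
      = integral {-pi..pi} (\<lambda>x. (\<Sum>r\<le>q. m r x * cnj (\<Sum>k\<in>K. b r k * cis (of_int k * x))) * cis (of_int d * x))"
    if "\<And>r k. r \<le> q \<Longrightarrow> k \<notin> K \<Longrightarrow> b r k = 0" for b
  proof -
    have "2 * pi * (\<Sum>r\<le>q. \<Sum>n\<in>K. a r n * cnj (b r (n + d)))
       = (\<Sum>r\<le>q. integral {-pi..pi} (\<lambda>x. m r x * cnj (\<Sum>k\<in>K. b r k * cis (of_int k * x)) * cis (of_int d * x)))"
      unfolding m_def sum_distrib_left
      by (intro sum.cong refl) (subst integral_trig_mult_cnj[OF K], use that in \<open>auto simp: sum_distrib_left\<close>)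
    also have "\<dots> = integral {-pi..pi} (\<lambda>x. \<Sum>r\<le>q. m r x * cnj (\<Sum>k\<in>K. b r k * cis (of_int k * x)) * cis (of_int d * x))"
      by (rule integral_sum[symmetric]) (use ip in auto)
    finally show ?thesis by (simp add: sum_distrib_right)
  qed
  have "2 * pi * (Z True + Z False) = integral {-pi..pi} (\<lambda>x. 1 * cis (of_int d * x))"
  proof -
    have "Z True + Z False = (\<Sum>r\<le>q. \<Sum>n\<in>K. a r n * cnj (a r (n + d)))"
      unfolding Z_def split sum.distrib ..
    moreover have "2 * pi * (\<Sum>r\<le>q. \<Sum>n\<in>K. a r n * cnj (a r (n + d)))
      = integral {-pi..pi} (\<lambda>x. (\<Sum>r\<le>q. m r x * cnj (\<Sum>k\<in>K. a r k * cis (of_int k * x))) * cis (of_int d * x))"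
      by (rule key) (rule supp)
    ultimately show ?thesis by (simp only: mK u1)
  qed
  then have 1: "Z True + Z False = (if d = 0 then 1 else 0)"
    by (simp only: mult_1 integral_cis_int) (auto split: if_splits)
  have mpi: "m r (x + pi) = (\<Sum>k\<in>K. (a r k * (if even k then 1 else -1)) * cis (of_int k * x))" for r x
  proof -
    have "cis (of_int k * pi) = (if even k then 1 else -1)" for k
      using cos_npi_int[of k] sin_npi_int[of k] by (cases "even k") (simp_all only: complex_eq_iff cis.simps mult.commute[of "of_int k" pi], simp_all)
    then have "cis (of_int k * (x + pi)) = (if even k then 1 else -1) * cis (of_int k * x)" for k
      by (simp add: distrib_left cis_mult[symmetric])
    then show ?thesis unfolding m_def by (simp add: mult_ac)
  qed
  have "2 * pi * (\<Sum>r\<le>q. \<Sum>n\<in>K. a r n * cnj (a r (n + d) * (if even (n + d) then 1 else -1))) = 0"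
    using key[of "\<lambda>r k. a r k * (if even k then 1 else -1)"] supp
    unfolding mpi[symmetric] u2 by simp
  then have "(\<Sum>r\<le>q. \<Sum>n\<in>K. a r n * cnj (a r (n + d) * (if even (n + d) then 1 else -1))) = 0"
    by simp
  moreover have "(\<Sum>n\<in>{n\<in>K. even n = P}. a r n * cnj (a r (n + d) * (if even (n + d) then 1 else -1)))
     = (if even d = P then 1 else -1) * (\<Sum>n\<in>{n\<in>K. even n = P}. a r n * cnj (a r (n + d)))" for r P
    unfolding sum_distrib_left by (intro sum.cong refl) auto
  ultimately have "(if even d then 1 else -1) * Z True + (if even d then -1 else 1) * Z False = 0"
    unfolding split Z_def sum.distrib sum_distrib_left by (auto split: if_splits)
  then have 2: "Z True = Z False"
    by (auto split: if_splits simp: add_eq_0_iff)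
  have "2 * Z p = (if d = 0 then 1 else 0)"
    using 1 2 by (cases p) auto
  then show ?thesis by (simp add: Z_def)
qed

section \<open>Approximation by trigonometric masks without small zeros\<close>

lemma cmod_add_real_sq: "(cmod (of_real c + z))\<^sup>2 = c\<^sup>2 + 2 * c * Re z + (cmod z)\<^sup>2"
  unfolding cmod_power2 by (simp add: power2_eq_square algebra_simps)

text \<open>
  For \<open>m = c + s * t\<close> with \<open>\<bar>c\<bar>\<^sup>2 + \<bar>c (x +
  pi)\<bar>\<^sup>2 = 1 - s / 2\<close> one has \<open>\<bar>m x\<bar>\<^sup>2 + \<bar>m (x +
  pi)\<bar>\<^sup>2 = 1 + s * \<Psi>\<close>, and the left-hand side of the conclusion is
  \<open>\<Psi>\<close> for \<open>t = v / (s + \<sigma>)\<close>, where \<open>v = f - c\<close>.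
  The regularization \<open>\<sigma>\<close> makes \<open>\<Psi>\<close> negative even at the zeros
  of \<open>s\<close>, where sub-unitarity of \<open>m\<close> itself gives no information about
  \<open>t\<close>.
\<close>
lemma mask_defect_strict:
  fixes c c' s \<sigma> :: real and v v' :: complex
  assumes s: "0 \<le> s" and \<sigma>: "0 < \<sigma>" and cc: "c\<^sup>2 + c'\<^sup>2 = 1 - s / 2"
    and le: "(cmod (of_real c + v))\<^sup>2 + (cmod (of_real c' + v'))\<^sup>2 \<le> 1"
  defines "D \<equiv> s + \<sigma>"
  shows "- (1/2) + 2 * (c * Re (v / of_real D) + c' * Re (v' / of_real D))
      + s * ((cmod (v / of_real D))\<^sup>2 + (cmod (v' / of_real D))\<^sup>2) \<le> - \<sigma> / (2 * D)"
proof -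
  have D: "D > 0" "s \<le> D" using s \<sigma> by (auto simp: D_def)
  define V where "V = (cmod v)\<^sup>2 + (cmod v')\<^sup>2"
  have V: "V \<ge> 0" by (simp add: V_def)
  define R where "R = 2 * (c * Re v + c' * Re v')"
  have RV: "R + V \<le> s / 2"
    using le cc unfolding cmod_add_real_sq R_def V_def by (simp add: algebra_simps)
  have "s * V \<le> D * V" using D V by (intro mult_right_mono) auto
  then have sV: "s * V / D \<le> V" using D by (simp add: divide_le_eq mult.commute)
  have "- (1/2) + 2 * (c * Re (v / of_real D) + c' * Re (v' / of_real D))
      + s * ((cmod (v / of_real D))\<^sup>2 + (cmod (v' / of_real D))\<^sup>2)
      = - (1/2) + R / D + s * V / D / D"
  proof -
    have "(cmod (w / of_real D))\<^sup>2 = (cmod w)\<^sup>2 / D / D" for w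
      by (simp add: norm_divide power_divide power2_eq_square)
    moreover have "Re (w / of_real D) = Re w / D" for w by simp
    ultimately show ?thesis unfolding R_def V_def
      by (simp add: add_divide_distrib distrib_left)
  qed
  also have "\<dots> \<le> - (1/2) + R / D + V / D"
    using divide_right_mono[OF sV, of D] D by simp
  also have "\<dots> = - (1/2) + (R + V) / D" by (simp add: add_divide_distrib)
  also have "\<dots> \<le> - (1/2) + (s / 2) / D"
    using divide_right_mono[OF RV, of D] D by simp
  also have "\<dots> = - \<sigma> / (2 * D)" using D by (simp add: D_def field_simps)
  finally show ?thesis .
qed

lemma norm_perturb_sq:
  fixes z d :: complex
  assumes "cmod z \<le> M" "cmod d \<le> \<delta>" "\<delta> \<le> 1"
  shows "(cmod (z + d))\<^sup>2 \<le> (cmod z)\<^sup>2 + (2 * M + 1) * \<delta>"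
proof -
  have d0: "0 \<le> \<delta>" using assms(2) norm_ge_zero order_trans by blast
  have "(cmod (z + d))\<^sup>2 \<le> (cmod z + \<delta>)\<^sup>2"
    using norm_triangle_ineq[of z d] assms(2) by (intro power_mono) auto
  also have "\<dots> = (cmod z)\<^sup>2 + 2 * (cmod z * \<delta>) + \<delta> * \<delta>" by (simp add: power2_eq_square algebra_simps)
  also have "\<dots> \<le> (cmod z)\<^sup>2 + 2 * (M * \<delta>) + 1 * \<delta>"
    using mult_right_mono[OF assms(1) d0] mult_right_mono[OF assms(3) d0] by linarith
  finally show ?thesis by (simp add: algebra_simps)
qed

text \<open>
  A differentiable curve in the plane is a null set, so it does not fill a disc.
\<close>
lemma avoid_curve:
  fixes g :: "real \<Rightarrow> complex"
  assumes "\<And>x. x \<in> S \<Longrightarrow> g differentiable at x" "\<delta> > 0"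
  obtains w where "cmod w < \<delta>" "w \<notin> g ` S"
proof -
  have "g differentiable_on S"
    using assms(1) by (auto simp: differentiable_on_def intro: differentiable_at_withinI)
  then have neg: "negligible (g ` S)" by (intro negligible_differentiable_image_lowdim) simp_all
  have "\<not> ball 0 \<delta> \<subseteq> g ` S"
  proof
    assume "ball 0 \<delta> \<subseteq> g ` S"
    then have "negligible (ball (0::complex) \<delta>)" using neg negligible_subset by blast
    then show False using assms(2) open_not_negligible[of "ball (0::complex) \<delta>"] by simp
  qed
  then show ?thesis using that by (auto simp: subset_iff)
qed

text \<open>
  In the ansatz \<open>m0 = c + s * t\<close> sub-unitarity is the condition \<open>\<Psi> t \<le>
  0\<close>, which holds with a uniform margin for \<open>t1 = (f - c) / (s + \<sigma>)\<close> and
  hence for every \<open>t\<close> that is uniformly close to \<open>t1\<close>. The choice of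
  \<open>t1\<close> is close to \<open>f\<close> because \<open>f - (c + s * t1) = \<sigma> * (f -
  c) / (s + \<sigma>)\<close> is small: where \<open>s\<close> is small, \<open>f\<close> and
  \<open>c\<close> are close to each other.
\<close>
lemma mask_approximation:
  fixes f :: "real \<Rightarrow> complex"
  assumes f: "f \<in> C_2pi" and f0: "f 0 = 1"
    and sub: "\<And>x. (cmod (f x))\<^sup>2 + (cmod (f (x + pi)))\<^sup>2 \<le> 1" and e: "\<epsilon> > 0"
  obtains m0 where "trig_poly m0" "m0 0 = 1"
    "\<And>x. (cmod (m0 x))\<^sup>2 + (cmod (m0 (x + pi)))\<^sup>2 \<le> 1"
    "\<And>x. x \<in> {-pi/2..pi/2} \<Longrightarrow> m0 x \<noteq> 0"
    "\<And>x. cmod (f x - m0 x) \<le> \<epsilon> / 2"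
proof -
  define c where "c x = (1 + cos x) / 2" for x :: real
  define s where "s x = (sin x)\<^sup>2" for x :: real
  have c01: "0 \<le> c x" "c x \<le> 1" for x by (simp_all add: c_def cos_ge_minus_one[THEN order_trans] add_increasing2)
     (use cos_ge_minus_one[of x] cos_le_one[of x] in linarith)+
  have s01: "0 \<le> s x" "s x \<le> 1" for x by (simp_all add: s_def abs_square_le_1)
  have s_pi: "s (x + pi) = s x" for x by (simp add: s_def)
  have cc: "(c x)\<^sup>2 + (c (x + pi))\<^sup>2 = 1 - s x / 2" for x
  proof -
    have "(c x)\<^sup>2 + (c (x + pi))\<^sup>2 = (1 + (cos x)\<^sup>2) / 2"
      by (simp add: c_def power_divide power2_eq_square field_simps)
    also have "(cos x)\<^sup>2 = 1 - s x" by (simp add: s_def cos_squared_eq)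
    finally show ?thesis by (simp add: field_simps)
  qed
  have fp: "f (x + 2 * pi) = f x" for x using f by (auto simp: C_2pi_def)
  have fcont: "continuous_on A f" for A
    using f continuous_on_subset[of UNIV f A] by (auto simp: C_2pi_def)
  have f1: "cmod (f x) \<le> 1" for x
  proof -
    have "(cmod (f x))\<^sup>2 \<le> 1\<^sup>2" using sub[of x] zero_le_power2[of "cmod (f (x + pi))"] unfolding power_one by linarith
    then show ?thesis by (rule power2_le_imp_le) simp
  qed
  have fpi: "f pi = 0" using sub[of 0] f0 by simp
  have fmpi: "f (- pi) = 0" using fp[of "- pi"] fpi by simp
  have cper: "(\<lambda>x. of_real (c x)) \<in> C_2pi"
    by (auto simp: C_2pi_def c_def intro!: continuous_intros)
  have diffC: "(\<lambda>x. f x - of_real (c x)) \<in> C_2pi"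
    using f cper by (auto simp: C_2pi_def intro!: continuous_intros)
  obtain s0 where s0: "s0 > 0" "\<And>x. s x \<le> s0 \<Longrightarrow> cmod (f x - of_real (c x)) < \<epsilon> / 8"
  proof -
    define K where "K = {x \<in> {-pi..pi}. \<epsilon> / 8 \<le> cmod (f x - of_real (c x))}"
    have "closed {x. \<epsilon> / 8 \<le> cmod (f x - of_real (c x))}"
      unfolding c_def by (intro closed_Collect_le continuous_intros fcont) simp
    then have "compact ({-pi..pi} \<inter> {x. \<epsilon> / 8 \<le> cmod (f x - of_real (c x))})"
      by (intro compact_Int_closed) simp
    moreover have "K = {-pi..pi} \<inter> {x. \<epsilon> / 8 \<le> cmod (f x - of_real (c x))}"
      by (auto simp: K_def)
    ultimately have K: "compact K" by simp
    have red: "\<exists>y\<in>K. s y = s x" if "\<epsilon> / 8 \<le> cmod (f x - of_real (c x))" for x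
    proof -
      obtain y where "y \<in> {-pi..pi}" "f x - of_real (c x) = f y - of_real (c y)" "sin x = sin y"
        using C_2pi_reduce[OF diffC] by blast
      then show ?thesis using that by (auto simp: K_def s_def intro!: bexI[of _ y])
    qed
    show ?thesis
    proof (cases "K = {}")
      case True
      then show ?thesis using red that[of 1] by (metis all_not_in_conv not_le zero_less_one)
    next
      case False
      have "continuous_on K s" by (auto simp: s_def intro!: continuous_intros)
      then obtain x1 where x1: "x1 \<in> K" "\<And>y. y \<in> K \<Longrightarrow> s x1 \<le> s y"
        using continuous_attains_inf[OF K False] by blast
      have "s x1 \<noteq> 0"
      proof
        assume "s x1 = 0"
        then have s0: "sin x1 = 0" by (simp add: s_def)
        have "x1 \<in> {-pi..pi}" using x1 by (simp add: K_def)
        then have b: "- pi \<le> x1" "x1 \<le> pi" by simp_all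
        have "x1 = 0 \<or> x1 = pi \<or> x1 = - pi"
        proof (rule ccontr)
          assume "\<not> (x1 = 0 \<or> x1 = pi \<or> x1 = - pi)"
          then consider "0 < x1" "x1 < pi" | "0 < - x1" "- x1 < pi" using b by fastforce
          then show False using sin_gt_zero[of x1] sin_gt_zero[of "- x1"] s0 by cases simp_all
        qed
        then have "f x1 = of_real (c x1)" using f0 fpi fmpi by (auto simp: c_def)
        then show False using x1(1) e by (simp add: K_def)
      qed
      then have "s x1 > 0" using s01(1)[of x1] by simp
      show ?thesis
      proof (rule that[of "s x1 / 2"])
        show "s x1 / 2 > 0" using \<open>s x1 > 0\<close> by simp
        fix x assume "s x \<le> s x1 / 2"
        then show "cmod (f x - of_real (c x)) < \<epsilon> / 8"
          using red[of x] x1(2) \<open>s x1 > 0\<close> by (force simp: not_le[symmetric])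
      qed
    qed
  qed
  (* Where s > s0, the error \<sigma> * (f - c) / (s + \<sigma>) is at most 2 * \<sigma> / s0 = \<epsilon> / 8. *)
  define \<sigma> where "\<sigma> = s0 * \<epsilon> / 16"
  have \<sigma>: "\<sigma> > 0" using s0 e by (simp add: \<sigma>_def)
  define D where "D x = s x + \<sigma>" for x
  have D: "D x \<ge> \<sigma>" "D x > 0" "D x \<le> 1 + \<sigma>" "D (x + pi) = D x" for x
    using s01[of x] \<sigma> by (auto simp: D_def s_pi)
  define v where "v x = f x - of_real (c x)" for x
  define t1 where "t1 x = v x / of_real (D x)" for x
  have v2: "cmod (v x) \<le> 2" for x
    using norm_triangle_ineq4[of "f x" "of_real (c x)"] f1[of x] c01[of x] by (simp add: v_def)
  have t1C: "t1 \<in> C_2pi"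
    using diffC D(2) by (auto simp: C_2pi_def t1_def v_def D_def s_def less_imp_neq[symmetric] intro!: continuous_intros)
       (metis D(2) D_def s_def less_irrefl of_real_0 of_real_eq_iff of_real_add of_real_power)
  define M where "M = 2 / \<sigma>"
  have t1M: "cmod (t1 x) \<le> M" for x
  proof -
    have "cmod (t1 x) = cmod (v x) / D x" using D(2)[of x] by (simp add: t1_def norm_divide)
    also have "\<dots> \<le> 2 / \<sigma>" using v2[of x] D(1)[of x] \<sigma> by (intro frac_le) auto
    finally show ?thesis by (simp add: M_def)
  qed
  have M: "M > 0" using \<sigma> by (simp add: M_def)
  define \<Psi> where "\<Psi> t x = - (1/2) + 2 * (c x * Re (t x) + c (x + pi) * Re (t (x + pi)))
      + s x * ((cmod (t x))\<^sup>2 + (cmod (t (x + pi)))\<^sup>2)" for t :: "real \<Rightarrow> complex" and x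
  define \<beta> where "\<beta> = \<sigma> / (2 * (1 + \<sigma>))"
  have \<beta>: "\<beta> > 0" using \<sigma> by (simp add: \<beta>_def)
  have \<Psi>1: "\<Psi> t1 x \<le> - \<beta>" for x
  proof -
    have "\<Psi> t1 x \<le> - \<sigma> / (2 * (s x + \<sigma>))"
      unfolding \<Psi>_def t1_def D(4) unfolding D_def
      by (rule mask_defect_strict[OF s01(1) \<sigma> cc]) (use sub in \<open>simp add: v_def\<close>)
    also have "\<dots> \<le> - \<beta>"
      using D[of x] \<sigma> by (simp add: \<beta>_def D_def frac_le)
    finally show ?thesis .
  qed
  (* A change of t1 by at most \<delta> changes \<Psi> by at most 4 * \<delta> + 2 * (2 * M + 1) * \<delta> \<le> \<beta>. *)
  define \<delta> where "\<delta> = min 1 (min (\<epsilon> / 8) (\<beta> / (6 + 4 * M)))"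
  have \<delta>: "\<delta> > 0" "\<delta> \<le> 1" "\<delta> \<le> \<epsilon> / 8" "\<delta> * (6 + 4 * M) \<le> \<beta>"
  proof -
    show "\<delta> > 0" using e \<beta> M by (simp add: \<delta>_def)
    show "\<delta> \<le> 1" by (simp add: \<delta>_def)
    show "\<delta> \<le> \<epsilon> / 8" unfolding \<delta>_def by (rule min.coboundedI2[OF min.cobounded1])
    have "\<delta> \<le> \<beta> / (6 + 4 * M)" by (simp add: \<delta>_def)
    then show "\<delta> * (6 + 4 * M) \<le> \<beta>" using M by (simp add: pos_le_divide_eq)
  qed
  have \<Psi>_neg: "\<Psi> t x \<le> 0" if t: "\<And>y. cmod (t y - t1 y) \<le> \<delta>" for t x
  proof -
    have re: "c y * Re (t y) \<le> c y * Re (t1 y) + \<delta>" for y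
    proof -
      have "Re (t y) - Re (t1 y) \<le> \<delta>" using complex_Re_le_cmod[of "t y - t1 y"] t[of y] by simp
      then have "c y * (Re (t y) - Re (t1 y)) \<le> c y * \<delta>" using c01 by (intro mult_left_mono) auto
      also have "\<dots> \<le> 1 * \<delta>" using c01 \<delta> by (intro mult_right_mono) auto
      finally show ?thesis by (simp add: algebra_simps)
    qed
    have sq: "(cmod (t y))\<^sup>2 \<le> (cmod (t1 y))\<^sup>2 + (2 * M + 1) * \<delta>" for y
      using norm_perturb_sq[OF t1M[of y] t[of y] \<delta>(2)] by simp
    have "s x * ((cmod (t x))\<^sup>2 + (cmod (t (x + pi)))\<^sup>2)
        \<le> s x * (((cmod (t1 x))\<^sup>2 + (cmod (t1 (x + pi)))\<^sup>2) + 2 * ((2 * M + 1) * \<delta>))"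
      using sq[of x] sq[of "x + pi"] s01 by (intro mult_left_mono) auto
    also have "\<dots> = s x * ((cmod (t1 x))\<^sup>2 + (cmod (t1 (x + pi)))\<^sup>2) + s x * (2 * ((2 * M + 1) * \<delta>))"
      by (rule distrib_left)
    also have "s x * (2 * ((2 * M + 1) * \<delta>)) \<le> 1 * (2 * ((2 * M + 1) * \<delta>))"
      using s01 M \<delta>(1) by (intro mult_right_mono) auto
    finally have sx: "s x * ((cmod (t x))\<^sup>2 + (cmod (t (x + pi)))\<^sup>2)
        \<le> s x * ((cmod (t1 x))\<^sup>2 + (cmod (t1 (x + pi)))\<^sup>2) + 2 * ((2 * M + 1) * \<delta>)" by simp
    have "2 * ((2 * M + 1) * \<delta>) + 4 * \<delta> = \<delta> * (6 + 4 * M)" by (simp add: algebra_simps)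
    define A A1 where "A = c x * Re (t x) + c (x + pi) * Re (t (x + pi))"
      and "A1 = c x * Re (t1 x) + c (x + pi) * Re (t1 (x + pi))"
    define S S1 where "S = s x * ((cmod (t x))\<^sup>2 + (cmod (t (x + pi)))\<^sup>2)"
      and "S1 = s x * ((cmod (t1 x))\<^sup>2 + (cmod (t1 (x + pi)))\<^sup>2)"
    have "A \<le> A1 + 2 * \<delta>" using re[of x] re[of "x + pi"] unfolding A_def A1_def by linarith
    moreover have "S \<le> S1 + 2 * ((2 * M + 1) * \<delta>)" using sx unfolding S_def S1_def .
    moreover have "- (1/2) + 2 * A1 + S1 \<le> - \<beta>" using \<Psi>1[of x] unfolding \<Psi>_def A1_def S1_def .
    moreover have "\<Psi> t x = - (1/2) + 2 * A + S" unfolding \<Psi>_def A_def S_def ..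
    ultimately show ?thesis using \<delta>(4) \<open>2 * ((2 * M + 1) * \<delta>) + 4 * \<delta> = \<delta> * (6 + 4 * M)\<close> by linarith
  qed
  obtain t0 where t0: "trig_poly t0" "\<And>x. cmod (t1 x - t0 x) < \<delta> / 2"
    using trig_poly_dense[OF t1C, of "\<delta> / 2"] \<delta>(1) by auto
  have tc: "trig_poly (\<lambda>x. of_real (c x))"
  proof -
    have "trig_poly (\<lambda>x. (1/2) * (1 + of_real (cos x)))"
      by (intro trig_poly_cmult trig_poly_add trig_poly_const trig_poly_cos)
    then show ?thesis by (simp add: c_def)
  qed
  have ts: "trig_poly (\<lambda>x. of_real (s x))"
    using trig_poly_mult[OF trig_poly_sin trig_poly_sin] by (simp add: s_def power2_eq_square)
  define m where "m x = of_real (c x) + of_real (s x) * t0 x" for x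
  have tm: "trig_poly m" unfolding m_def[abs_def] by (intro trig_poly_add trig_poly_mult tc ts t0)
  (* Away from the zeros of s, a zero of m - s * w is a point where m / s takes the value w. *)
  obtain w where w: "cmod w < \<delta> / 2" "w \<notin> (\<lambda>x. m x / of_real (s x)) ` {x. s x \<noteq> 0}"
  proof (rule avoid_curve)
    show "\<delta> / 2 > 0" using \<delta> by simp
    show "(\<lambda>x. m x / of_real (s x)) differentiable at x" if "x \<in> {x. s x \<noteq> 0}" for x
      using that by (intro differentiable_divide trig_poly_differentiable[OF tm] trig_poly_differentiable[OF ts]) simp
  qed blast
  define t where "t x = t0 x - w" for x
  have t\<delta>: "cmod (t y - t1 y) \<le> \<delta>" for y
  proof -
    have "cmod (t y - t1 y) = cmod ((t1 y - t0 y) + w)" by (simp add: t_def norm_minus_commute algebra_simps)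
    also have "\<dots> \<le> cmod (t1 y - t0 y) + cmod w" by (rule norm_triangle_ineq)
    finally show ?thesis using t0(2)[of y] w(1) by linarith
  qed
  define m0 where "m0 x = of_real (c x) + of_real (s x) * t x" for x
  show ?thesis
  proof (rule that[of m0])
    show "trig_poly m0" unfolding m0_def[abs_def] t_def[abs_def]
      by (intro trig_poly_add trig_poly_mult trig_poly_diff trig_poly_const tc ts t0)
    show "m0 0 = 1" by (simp add: m0_def c_def s_def)
    fix x
    show "(cmod (m0 x))\<^sup>2 + (cmod (m0 (x + pi)))\<^sup>2 \<le> 1"
    proof -
      have "(cmod (m0 x))\<^sup>2 + (cmod (m0 (x + pi)))\<^sup>2 = ((c x)\<^sup>2 + (c (x + pi))\<^sup>2)
          + 2 * s x * (c x * Re (t x) + c (x + pi) * Re (t (x + pi)))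
          + s x * s x * ((cmod (t x))\<^sup>2 + (cmod (t (x + pi)))\<^sup>2)"
        unfolding m0_def cmod_add_real_sq s_pi
        by (simp add: norm_mult power_mult_distrib s01 power2_eq_square distrib_left)
      also have "\<dots> = 1 + s x * \<Psi> t x" unfolding cc \<Psi>_def by (simp add: algebra_simps)
      also have "\<dots> \<le> 1" using \<Psi>_neg[OF t\<delta>, of x] s01(1)[of x] by (simp add: mult_nonneg_nonpos)
      finally show ?thesis .
    qed
    show "cmod (f x - m0 x) \<le> \<epsilon> / 2"
    proof -
      have "f x - m0 x = v x - of_real (s x) * t1 x - of_real (s x) * (t x - t1 x)"
        by (simp add: v_def m0_def algebra_simps)
      also have "v x - of_real (s x) * t1 x = of_real (\<sigma> / D x) * v x"
      proof -
        have "v x = of_real (D x) * t1 x" using D(2)[of x] by (simp add: t1_def)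
        then have "v x - of_real (s x) * t1 x = of_real \<sigma> * t1 x" by (simp add: D_def algebra_simps)
        then show ?thesis by (simp add: t1_def)
      qed
      finally have "cmod (f x - m0 x) \<le> cmod (of_real (\<sigma> / D x) * v x) + cmod (of_real (s x) * (t x - t1 x))"
        by (simp only: norm_triangle_ineq4)
      moreover have "cmod (of_real (s x) * (t x - t1 x)) \<le> \<epsilon> / 8"
      proof -
        have "s x * cmod (t x - t1 x) \<le> 1 * \<delta>" using s01[of x] t\<delta>[of x] by (intro mult_mono) auto
        then show ?thesis using \<delta>(3) s01(1)[of x] by (simp add: norm_mult)
      qed
      moreover have "cmod (of_real (\<sigma> / D x) * v x) \<le> \<epsilon> / 8"
      proof -
        have eq: "cmod (of_real (\<sigma> / D x) * v x) = \<sigma> / D x * cmod (v x)"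
          using \<sigma> D(2)[of x] by (simp add: norm_mult norm_divide)
        show ?thesis
        proof (cases "s x \<le> s0")
          case True
          have "\<sigma> / D x \<le> 1" using D[of x] by simp
          then have "\<sigma> / D x * cmod (v x) \<le> 1 * cmod (v x)" by (intro mult_right_mono) auto
          then show ?thesis using s0(2)[OF True] unfolding eq v_def[symmetric] by linarith
        next
          case False
          then have "\<sigma> / D x \<le> \<sigma> / s0" using s0(1) \<sigma> by (intro divide_left_mono) (auto simp: D_def)
          also have "\<dots> = \<epsilon> / 16" using s0(1) by (simp add: \<sigma>_def)
          finally have "\<sigma> / D x * cmod (v x) \<le> \<epsilon> / 16 * 2" using v2[of x] e by (intro mult_mono) auto
          then show ?thesis using eq by simp
        qed
      qed
      ultimately show ?thesis using e by linarith
    qed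
    assume x: "x \<in> {-pi/2..pi/2}"
    show "m0 x \<noteq> 0"
    proof (cases "x = 0")
      case True then show ?thesis by (simp add: m0_def c_def s_def)
    next
      case False
      have "sin x \<noteq> 0"
      proof (cases "x > 0")
        case True then show ?thesis using x sin_gt_zero[of x] pi_gt_zero by (simp add: less_imp_neq)
      next
        case F: False
        then show ?thesis using x False sin_gt_zero[of "- x"] pi_gt_zero by (simp add: less_imp_neq)
      qed
      then have s: "s x \<noteq> 0" by (simp add: s_def)
      have eq: "m0 x = m x - of_real (s x) * w" by (simp add: m0_def m_def t_def algebra_simps)
      show ?thesis
      proof
        assume "m0 x = 0"
        then have "w = m x / of_real (s x)" using s eq by (simp add: field_simps)
        then show False using w(2) s by blast
      qed
    qed
  qed
qed

section \<open>The Fejer-Riesz theorem and the wavelet masks\<close>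

text \<open>
  If \<open>p z / z\<^sup>n\<close> is real on the unit circle, then \<open>p\<close> agrees there
  with the polynomial \<open>z\<^sup>2\<^sup>n * cnj (p (1 / cnj z))\<close>, whose coefficients are
  the conjugates of those of \<open>p\<close> in reverse order. Agreement on the infinite circle is
  equality.
\<close>
lemma poly_reflect_circle:
  fixes p :: "complex poly"
  assumes deg: "degree p \<le> 2 * n"
    and real: "\<And>z. cmod z = 1 \<Longrightarrow> poly p z / z ^ n \<in> \<real>\<^sub>\<ge>\<^sub>0"
  shows "w \<noteq> 0 \<Longrightarrow> poly p w = w ^ (2 * n) * cnj (poly p (1 / cnj w))"
    and "coeff p (2 * n) = cnj (coeff p 0)"
proof -
  define p' where "p' = (\<Sum>k\<le>2*n. monom (cnj (coeff p (2 * n - k))) k)"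
  have pw: "poly p z = (\<Sum>k\<le>2*n. coeff p k * z ^ k)" for z
    unfolding poly_altdef using deg
    by (intro sum.mono_neutral_left) (auto simp: coeff_eq_0)
  have p'w: "poly p' w = w ^ (2 * n) * cnj (poly p (1 / cnj w))" if "w \<noteq> 0" for w
  proof -
    have "poly p' w = (\<Sum>k\<le>2*n. cnj (coeff p (2 * n - k)) * w ^ k)"
      by (simp add: p'_def poly_sum poly_monom)
    also have "\<dots> = (\<Sum>k\<le>2*n. cnj (coeff p k) * w ^ (2 * n - k))"
      by (rule sum.reindex_bij_witness[of _ "\<lambda>k. 2 * n - k" "\<lambda>k. 2 * n - k"]) auto
    also have "\<dots> = w ^ (2 * n) * (\<Sum>k\<le>2*n. cnj (coeff p k * (1 / cnj w) ^ k))"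
      unfolding sum_distrib_left
      using that by (intro sum.cong refl) (auto simp: power_diff power_divide)
    finally show ?thesis by (simp add: pw)
  qed
  have "p = p'"
  proof (rule ccontr)
    assume "p \<noteq> p'"
    then have "finite {z. poly (p - p') z = 0}" by (intro poly_roots_finite) simp
    moreover have "sphere 0 1 \<subseteq> {z. poly (p - p') z = 0}"
    proof
      fix z :: complex assume "z \<in> sphere 0 1"
      then have z: "cmod z = 1" "z \<noteq> 0" by auto
      then have zz: "z * cnj z = 1" by (simp add: complex_norm_square[symmetric])
      then have inv: "1 / cnj z = z" using z by (simp add: field_simps)
      obtain r :: real where r: "poly p z / z ^ n = of_real r"
        using real[OF z(1)] by (auto elim!: nonneg_Reals_cases)
      then have pr: "poly p z = of_real r * z ^ n" using z by (simp add: field_simps)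
      have "poly p' z = z ^ (2 * n) * cnj (of_real r * z ^ n)"
        using p'w[OF z(2)] inv pr by simp
      also have "\<dots> = of_real r * z ^ n * (z * cnj z) ^ n"
        unfolding mult_2 power_add power_mult_distrib by simp
      finally show "z \<in> {z. poly (p - p') z = 0}" using zz pr by simp
    qed
    moreover have "infinite (sphere (0::complex) 1)"
    proof
      assume "finite (sphere (0::complex) 1)"
      then have "finite (cis ` {0..1})" by (rule finite_subset[rotated]) auto
      moreover have "inj_on cis {0..1}"
        by (rule inj_on_inverseI[where g = Arg]) (use pi_gt3 in \<open>auto intro: Arg_cis\<close>)
      ultimately show False by (metis finite_imageD infinite_Icc zero_less_one)
    qed
    ultimately show False by (auto dest: finite_subset)
  qed
  then show "w \<noteq> 0 \<Longrightarrow> poly p w = w ^ (2 * n) * cnj (poly p (1 / cnj w))" using p'w by metis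
  have "coeff p' (2 * n) = cnj (coeff p 0)"
    by (simp add: p'_def coeff_sum)
  then show "coeff p (2 * n) = cnj (coeff p 0)" using \<open>p = p'\<close> by simp
qed

text \<open>
  As a function of the angle, \<open>p z / z\<^sup>n\<close> is nonnegative and vanishes at the
  angle of \<open>z0\<close>, so its derivative vanishes there, and this derivative is a nonzero
  multiple of \<open>s z0\<close>.
\<close>
lemma circle_root_double:
  fixes s :: "complex poly"
  assumes z0: "cmod z0 = 1"
    and nonneg: "\<And>z. cmod z = 1 \<Longrightarrow> (z - z0) * poly s z / z ^ n \<in> \<real>\<^sub>\<ge>\<^sub>0"
  shows "poly s z0 = 0"
proof -
  obtain t0 where t0: "z0 = cis t0"
    using z0 by (metis complex_norm_eq_1_exp_eq cis_conv_exp)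
  define \<Phi> where "\<Phi> w = exp (- \<i> * of_nat n * w) * ((exp (\<i> * w) - z0) * poly s (exp (\<i> * w)))" for w
  define D where "D = exp (- \<i> * of_nat n * of_real t0) * (\<i> * exp (\<i> * of_real t0) * poly s (exp (\<i> * of_real t0)))"
  have "(\<Phi> has_field_derivative D) (at (of_real t0))"
    unfolding \<Phi>_def[abs_def] D_def
    by (auto intro!: derivative_eq_intros DERIV_chain2[OF poly_DERIV] simp: t0 cis_conv_exp)
  then have vd: "((\<lambda>t. \<Phi> (of_real t)) has_vector_derivative D) (at t0)"
    by (rule has_vector_derivative_real_field)
  have \<Phi>: "\<Phi> (of_real t) \<in> \<real>\<^sub>\<ge>\<^sub>0" for t
  proof -
    have "exp (- \<i> * of_nat n * of_real t) = 1 / cis t ^ n"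
      by (simp add: Complex.DeMoivre cis_conv_exp exp_minus field_simps flip: exp_of_nat_mult)
    then have "\<Phi> (of_real t) = (cis t - z0) * poly s (cis t) / cis t ^ n"
      by (simp add: \<Phi>_def cis_conv_exp)
    then show ?thesis using nonneg[of "cis t"] by simp
  qed
  have \<Phi>0: "\<Phi> (of_real t0) = 0" by (simp add: \<Phi>_def t0 cis_conv_exp)
  have re: "((\<lambda>t. Re (\<Phi> (of_real t))) has_real_derivative Re D) (at t0)"
    using bounded_linear.has_vector_derivative[OF bounded_linear_Re vd]
    by (simp add: has_real_derivative_iff_has_vector_derivative)
  have im: "((\<lambda>t. Im (\<Phi> (of_real t))) has_real_derivative Im D) (at t0)"
    using bounded_linear.has_vector_derivative[OF bounded_linear_Im vd]
    by (simp add: has_real_derivative_iff_has_vector_derivative)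
  have "Re D = 0"
    by (rule DERIV_local_min[OF re, of 1]) (use \<Phi> \<Phi>0 in \<open>auto simp: complex_nonneg_Reals_iff\<close>)
  moreover have "Im (\<Phi> (of_real t)) = 0" for t using \<Phi>[of t] by (auto simp: complex_nonneg_Reals_iff)
  then have "((\<lambda>t. 0) has_real_derivative Im D) (at t0)" using im by simp
  then have "Im D = 0" using DERIV_unique DERIV_const by blast
  ultimately have "D = 0" by (simp add: complex_eq_iff)
  then show ?thesis by (auto simp: D_def t0 cis_conv_exp)
qed

text \<open>
  A pair of roots that are symmetric with respect to the circle contributes a monomial times a
  squared modulus.
\<close>
lemma circle_factor:
  assumes "cmod z = 1" "z0 \<noteq> 0"
  shows "(z - z0) * (z - 1 / cnj z0) = - (z / cnj z0) * of_real ((cmod (z - z0))\<^sup>2)"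
proof -
  have zz: "z * cnj z = 1" using assms by (simp add: complex_norm_square[symmetric])
  have "- (z / cnj z0) * ((z - z0) * cnj (z - z0)) = (z - z0) * (z - (z * cnj z) / cnj z0)"
    using assms(2) by (simp add: field_simps)
  then show ?thesis by (simp only: zz complex_norm_square)
qed

text \<open>
  By induction on \<open>n\<close>. If \<open>p 0 = 0\<close>, then by symmetry the top coefficient
  vanishes too and one factor \<open>z\<close> splits off. Otherwise \<open>p\<close> has degree
  \<open>2 * n\<close>, and any root \<open>z0\<close> comes with the root \<open>1 / cnj
  z0\<close>, which is a second copy of \<open>z0\<close> if \<open>z0\<close> lies on the circle;
  the pair splits off by \<open>circle_factor\<close>. At a root on the circle, nonnegativity of the
  quotient follows by continuity.
\<close>
lemma fejer_riesz_poly: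
  fixes p :: "complex poly"
  assumes "degree p \<le> 2 * n"
    and "\<And>z. cmod z = 1 \<Longrightarrow> poly p z / z ^ n \<in> \<real>\<^sub>\<ge>\<^sub>0"
  shows "\<exists>q. \<forall>z. cmod z = 1 \<longrightarrow> poly p z = z ^ n * of_real ((cmod (poly q z))\<^sup>2)"
  using assms
proof (induction n arbitrary: p)
  case 0
  then obtain c where c: "p = [:c:]" by (auto elim: degree_eq_zeroE)
  then have "c \<in> \<real>\<^sub>\<ge>\<^sub>0" using 0(2)[of 1] by simp
  then obtain r where "r \<ge> 0" "c = of_real r" by (auto elim!: nonneg_Reals_cases)
  then show ?case using c by (intro exI[of _ "[:of_real (sqrt r):]"]) simp
next
  case (Suc n p)
  note refl = poly_reflect_circle[OF Suc.prems]
  show ?case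
  proof (cases "coeff p 0 = 0")
    case True
    then obtain p1 where p1: "p = pCons 0 p1" by (metis coeff_pCons_0 pCons_cases)
    have "coeff p (2 * Suc n) = 0" using refl(2) True by simp
    then have "degree p1 \<le> 2 * n"
    proof (cases "p1 = 0")
      case False
      then have "degree p1 \<le> Suc (2 * n)" using Suc.prems(1) p1 by simp
      moreover have "coeff p1 (degree p1) \<noteq> 0" using False by (simp only: leading_coeff_0_iff) simp
      moreover have "coeff p1 (Suc (2 * n)) = 0" using \<open>coeff p (2 * Suc n) = 0\<close> p1 by simp
      ultimately have "degree p1 \<le> Suc (2 * n)" "degree p1 \<noteq> Suc (2 * n)" by metis+
      then show ?thesis by simp
    qed simp
    moreover have "poly p1 z / z ^ n \<in> \<real>\<^sub>\<ge>\<^sub>0" if "cmod z = 1" for z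
      using Suc.prems(2)[OF that] p1 that by (cases "z = 0") auto
    ultimately have "\<exists>q. \<forall>z. cmod z = 1 \<longrightarrow> poly p1 z = z ^ n * of_real ((cmod (poly q z))\<^sup>2)"
      by (intro Suc.IH)
    then obtain q where "\<forall>z. cmod z = 1 \<longrightarrow> poly p1 z = z ^ n * of_real ((cmod (poly q z))\<^sup>2)"
      by (elim exE)
    then show ?thesis using p1 by (intro exI[of _ q]) (simp add: mult_ac)
  next
    case False
    then have "coeff p (2 * Suc n) \<noteq> 0" using refl(2) by simp
    then have deg: "degree p = 2 * Suc n" using Suc.prems(1) le_degree[of p "2 * Suc n"] by simp
    then have "\<not> constant (poly p)" by (simp add: constant_degree)
    then obtain z0 where z0: "poly p z0 = 0" using fundamental_theorem_of_algebra by blast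
    have z0n: "z0 \<noteq> 0" using z0 False by (auto simp: poly_0_coeff_0)
    define w0 where "w0 = 1 / cnj z0"
    obtain s where s: "p = [:- z0, 1:] * s" using z0 by (auto simp: poly_eq_0_iff_dvd elim: dvdE)
    have "poly s w0 = 0"
    proof (cases "cmod z0 = 1")
      case True
      then have "z0 * cnj z0 = 1" by (simp add: complex_norm_square[symmetric])
      then have "w0 = z0" using z0n by (simp add: w0_def field_simps)
      moreover have "poly s z0 = 0"
      proof (rule circle_root_double[OF True, of _ "Suc n"])
        fix z :: complex assume "cmod z = 1"
        then show "(z - z0) * poly s z / z ^ Suc n \<in> \<real>\<^sub>\<ge>\<^sub>0"
          using Suc.prems(2)[of z] unfolding s poly_mult by simp
      qed
      ultimately show ?thesis by simp
    next
      case False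
      have "poly p w0 = 0" using refl(1)[of w0] z0 z0n by (simp add: w0_def)
      moreover have "w0 \<noteq> z0"
      proof
        assume "w0 = z0"
        then have "z0 * cnj z0 = 1" using z0n by (simp add: w0_def field_simps)
        then have "complex_of_real ((cmod z0)\<^sup>2) = 1" by (simp only: complex_norm_square)
        then have "(cmod z0)\<^sup>2 = 1" by (simp only: of_real_eq_1_iff)
        then show False using False norm_ge_zero[of z0] unfolding power2_eq_1_iff by linarith
      qed
      ultimately show ?thesis using s by simp
    qed
    then obtain p1 where p1: "s = [:- w0, 1:] * p1" by (auto simp: poly_eq_0_iff_dvd elim: dvdE)
    have p1n: "p1 \<noteq> 0" using deg s p1 by auto
    have "degree p = degree [:- z0, 1:] + degree ([:- w0, 1:] * p1)"
      unfolding s p1 by (rule degree_mult_eq) (use p1n in \<open>auto simp del: mult_pCons_left\<close>)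
    also have "degree ([:- w0, 1:] * p1) = degree [:- w0, 1:] + degree p1"
      by (rule degree_mult_eq) (use p1n in auto)
    finally have degp1: "degree p1 = 2 * n" using deg by simp
    define p2 where "p2 = smult (- 1 / cnj z0) p1"
    have fac: "poly p z = z * of_real ((cmod (z - z0))\<^sup>2) * poly p2 z" if "cmod z = 1" for z
    proof -
      have "poly p z = (z - z0) * (z - 1 / cnj z0) * poly p1 z" unfolding s p1 poly_mult w0_def by simp
      then show ?thesis unfolding circle_factor[OF that z0n] p2_def by simp
    qed
    have p2_off: "poly p2 z / z ^ n \<in> \<real>\<^sub>\<ge>\<^sub>0" if "cmod z = 1" "z \<noteq> z0" for z
    proof -
      have "poly p z / z ^ Suc n = of_real ((cmod (z - z0))\<^sup>2) * (poly p2 z / z ^ n)"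
        using fac[OF that(1)] that(1) by (cases "z = 0") auto
      then have "poly p2 z / z ^ n = of_real (1 / (cmod (z - z0))\<^sup>2) * (poly p z / z ^ Suc n)"
        using that(2) by simp
      then show ?thesis using Suc.prems(2)[OF that(1)]
        by (simp only:) (intro nonneg_Reals_mult_I, simp_all)
    qed
    have "poly p2 z / z ^ n \<in> \<real>\<^sub>\<ge>\<^sub>0" if z: "cmod z = 1" for z
    proof (cases "z = z0")
      case True
      (* Points of the circle different from z0 that converge to z0. *)
      define u where "u k = z0 * cis (inverse (real (Suc k)))" for k
      have u_ne: "u k \<noteq> z0" for k
      proof -
        have "cos (inverse (real (Suc k))) < cos 0"
        proof (rule cos_monotone_0_pi)
          have "inverse (real (Suc k)) \<le> 1" using le_imp_inverse_le[of 1 "real (Suc k)"] by (simp only: inverse_1)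
          then show "inverse (real (Suc k)) \<le> pi" using pi_gt3 by linarith
        qed auto
        then have "cis (inverse (real (Suc k))) \<noteq> 1" by (metis cis.sel(1) cos_zero less_irrefl one_complex.sel(1))
        then show ?thesis using z0n by (simp add: u_def)
      qed
      have "(\<lambda>k. cis (inverse (real (Suc k)))) \<longlonglongrightarrow> cis 0"
        by (intro tendsto_cis LIMSEQ_inverse_real_of_nat)
      then have lim: "u \<longlonglongrightarrow> z0" unfolding u_def using tendsto_mult[OF tendsto_const, of _ _ _ z0] by fastforce
      have lim2: "(\<lambda>k. poly p2 (u k) / u k ^ n) \<longlonglongrightarrow> poly p2 z0 / z0 ^ n"
        by (intro tendsto_intros lim) (use z0n in auto)
      have mem: "poly p2 (u k) / u k ^ n \<in> \<real>\<^sub>\<ge>\<^sub>0" for k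
        using u_ne[of k] z True by (intro p2_off) (auto simp: u_def norm_mult)
      show ?thesis unfolding True
        by (rule closed_sequentially[OF closed_nonneg_Reals_complex mem lim2])
    qed (use p2_off z in auto)
    moreover have "degree p2 \<le> 2 * n" using degp1 by (simp add: p2_def)
    ultimately have "\<exists>q. \<forall>z. cmod z = 1 \<longrightarrow> poly p2 z = z ^ n * of_real ((cmod (poly q z))\<^sup>2)"
      by (intro Suc.IH)
    then obtain q where q: "\<And>z. cmod z = 1 \<Longrightarrow> poly p2 z = z ^ n * of_real ((cmod (poly q z))\<^sup>2)"
      by (elim exE) blast
    have shuffle: "a * b * (c * d) = a * c * (b * d)" for a b c d :: complex
      by (simp add: mult_ac)
    show ?thesis
    proof (intro exI[of _ "[:- z0, 1:] * q"] allI impI)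
      fix z :: complex assume z: "cmod z = 1"
      have pq: "poly ([:- z0, 1:] * q) z = (z - z0) * poly q z" unfolding poly_mult by simp
      show "poly p z = z ^ Suc n * of_real ((cmod (poly ([:- z0, 1:] * q) z))\<^sup>2)"
        unfolding fac[OF z] q[OF z] pq norm_mult power_mult_distrib of_real_mult power_Suc
        by (rule shuffle)
    qed
  qed
qed

theorem fejer_riesz:
  assumes P: "trig_poly P" and nonneg: "\<And>x. P x \<in> \<real>\<^sub>\<ge>\<^sub>0"
  obtains H where "trig_poly H" "\<And>x. P x = of_real ((cmod (H x))\<^sup>2)"
proof -
  obtain N0 :: int and a where a: "\<And>N x. N \<ge> N0 \<Longrightarrow> P x = (\<Sum>k\<in>{-N..N}. a k * cis (of_int k * x))"
    using trig_poly_coeffs[OF P] by metis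
  define n where "n = nat (max 0 N0)"
  define p where "p = (\<Sum>j\<le>2*n. monom (a (int j - int n)) j)"
  have pc: "poly p (cis x) = cis x ^ n * P x" for x
  proof -
    have "P x = (\<Sum>k\<in>{- int n..int n}. a k * cis (of_int k * x))" by (rule a) (simp add: n_def)
    also have "\<dots> = (\<Sum>j\<le>2*n. a (int j - int n) * cis (of_int (int j - int n) * x))"
      by (rule sum.reindex_bij_witness[of _ "\<lambda>j. int j - int n" "\<lambda>k. nat (k + int n)"]) auto
    also have "cis x ^ n * \<dots> = (\<Sum>j\<le>2*n. a (int j - int n) * cis x ^ j)"
      unfolding sum_distrib_left
    proof (intro sum.cong refl)
      fix j
      have "cis x ^ n * cis (of_int (int j - int n) * x) = cis x ^ j"
        unfolding Complex.DeMoivre cis_mult of_int_diff of_int_of_nat_eq left_diff_distrib by simp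
      then show "cis x ^ n * (a (int j - int n) * cis (of_int (int j - int n) * x)) = a (int j - int n) * cis x ^ j"
        by (metis mult.left_commute)
    qed
    finally have "cis x ^ n * P x = (\<Sum>j\<le>2*n. a (int j - int n) * cis x ^ j)" .
    then show ?thesis by (simp add: p_def poly_sum poly_monom)
  qed
  have "degree p \<le> 2 * n" unfolding p_def
    by (intro degree_sum_le) (auto intro: order_trans[OF degree_monom_le])
  moreover have "poly p z / z ^ n \<in> \<real>\<^sub>\<ge>\<^sub>0" if "cmod z = 1" for z
  proof -
    obtain x where x: "z = cis x" using \<open>cmod z = 1\<close> by (metis complex_norm_eq_1_exp_eq cis_conv_exp)
    show ?thesis using nonneg[of x] by (simp add: x pc)
  qed
  ultimately obtain q where q: "\<And>z. cmod z = 1 \<Longrightarrow> poly p z = z ^ n * of_real ((cmod (poly q z))\<^sup>2)"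
    using fejer_riesz_poly by blast
  show ?thesis
  proof
    show "trig_poly (\<lambda>x. poly q (cis x))"
    proof -
      have "trig_poly (\<lambda>x. \<Sum>i\<le>degree q. coeff q i * cis (of_int (int i) * x))"
        by (intro trig_poly_sum trig_poly_monomial)
      then show ?thesis by (simp add: poly_altdef Complex.DeMoivre)
    qed
    show "P x = of_real ((cmod (poly q (cis x)))\<^sup>2)" for x
      using q[of "cis x"] pc[of x] by simp
  qed
qed

text \<open>
  The entries of \<open>1 - v v\<^sup>*\<close> for the unit vector \<open>v = (2 u e, 2 u g,
  h)\<close> combined with the modulation \<open>z\<close>. Taking \<open>w = cnj z\<close> gives
  the first identity of the extension principle and \<open>w = - cnj z\<close> the second.
\<close>
lemma uep_mask_identity:
  fixes u :: complex
  assumes u: "2 * (u * u) = 1" and h: "h * h' = 1 - 2 * (e * e') - 2 * (g * g')"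
    and a: "a = e + z * g" and b: "b = e' + w * g'"
  shows "a * b + (u - a * (2 * u * e')) * (u - b * (2 * u * e))
    + (u * z - a * (2 * u * g')) * (u * w - b * (2 * u * g)) + a * h' * (b * h) = u * u * (1 + z * w)"
proof -
  have prod: "(u * y - p * (2 * u * q)) * (u * w - p' * (2 * u * q')) = u * u * y * w - p' * q' * y - p * q * w + 2 * (p * q * p' * q')"
    for y w p q p' q' :: complex
  proof -
    have "(u * y - p * (2 * u * q)) * (u * w - p' * (2 * u * q'))
       = u * u * y * w - 2 * (u * u) * (p' * q' * y) - 2 * (u * u) * (p * q * w) + 2 * (2 * (u * u)) * (p * q * p' * q')"
      by (simp add: algebra_simps)
    then show ?thesis unfolding u by simp
  qed
  have hh: "a * h' * (b * h) = a * b * (1 - 2 * (e * e') - 2 * (g * g'))"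
    unfolding h[symmetric] by (simp only: mult_ac)
  have p1: "(u - a * (2 * u * e')) * (u - b * (2 * u * e)) = u * u - b * e - a * e' + 2 * (a * e' * b * e)"
    using prod[of 1 a e' 1 b e] by (simp only: mult_1_right)
  have "a * b + (u - a * (2 * u * e')) * (u - b * (2 * u * e))
    + (u * z - a * (2 * u * g')) * (u * w - b * (2 * u * g)) + a * h' * (b * h)
    = u * u * (1 + z * w) + 2 * (a * b) - b * (e + z * g) - a * (e' + w * g')"
    unfolding hh p1 prod by (simp add: algebra_simps)
  then show ?thesis unfolding a[symmetric] b[symmetric] by (simp add: mult_ac)
qed

text \<open>
  The Fejer-Riesz theorem is applied to \<open>P = 1 - 2 \<bar>E\<bar>\<^sup>2 - 2
  \<bar>G\<bar>\<^sup>2\<close>, which is the defect of \<open>m0\<close> at the doubled frequency.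
  The factor \<open>H\<close> completes the polyphase vector to a unit vector.
\<close>
lemma uep_masks_exist:
  assumes m0: "trig_poly m0" and sub: "\<And>x. (cmod (m0 x))\<^sup>2 + (cmod (m0 (x + pi)))\<^sup>2 \<le> 1"
  obtains m :: "nat \<Rightarrow> real \<Rightarrow> complex" where "m 0 = m0" "\<And>r. r \<le> 3 \<Longrightarrow> trig_poly (m r)"
    "\<And>x. (\<Sum>r\<le>3. m r x * cnj (m r x)) = 1"
    "\<And>x. (\<Sum>r\<le>3. m r x * cnj (m r (x + pi))) = 0"
proof -
  obtain E G where EG: "trig_poly E" "trig_poly G"
    and e1: "\<And>x. m0 x = E (2 * x) + cis x * G (2 * x)"
    and e2: "\<And>x. m0 (x + pi) = E (2 * x) - cis x * G (2 * x)"
    using trig_poly_polyphase[OF m0] by blast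
  define P where "P y = 1 - 2 * (E y * cnj (E y)) - 2 * (G y * cnj (G y))" for y
  have tP: "trig_poly P" unfolding P_def[abs_def]
    by (intro trig_poly_diff trig_poly_cmult trig_poly_mult trig_poly_cnj trig_poly_const EG)
  have zz: "cis x * cnj (cis x) = 1" for x by (simp add: complex_norm_square[symmetric])
  have P2: "P (2 * x) = of_real (1 - (cmod (m0 x))\<^sup>2 - (cmod (m0 (x + pi)))\<^sup>2)" for x
  proof -
    have "m0 x * cnj (m0 x) + m0 (x + pi) * cnj (m0 (x + pi))
       = 2 * (E (2*x) * cnj (E (2*x))) + 2 * (cis x * cnj (cis x)) * (G (2*x) * cnj (G (2*x)))"
      unfolding e2 e1[of x] by (simp add: algebra_simps)
    moreover have "complex_of_real (1 - (cmod (m0 x))\<^sup>2 - (cmod (m0 (x + pi)))\<^sup>2)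
       = 1 - (m0 x * cnj (m0 x) + m0 (x + pi) * cnj (m0 (x + pi)))"
      unfolding of_real_diff complex_norm_square by simp
    ultimately show ?thesis unfolding zz P_def by simp
  qed
  have "P y \<in> \<real>\<^sub>\<ge>\<^sub>0" for y
  proof -
    have "2 * (y / 2) = y" by simp
    then have "P y = of_real (1 - (cmod (m0 (y / 2)))\<^sup>2 - (cmod (m0 (y / 2 + pi)))\<^sup>2)"
      using P2[of "y / 2"] by (simp only:)
    moreover have "0 \<le> 1 - (cmod (m0 (y / 2)))\<^sup>2 - (cmod (m0 (y / 2 + pi)))\<^sup>2"
      using sub[of "y / 2"] by linarith
    ultimately show ?thesis by (simp only: nonneg_Reals_of_real_iff)
  qed
  then obtain H where H: "trig_poly H" "\<And>y. P y = of_real ((cmod (H y))\<^sup>2)"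
    using fejer_riesz[OF tP] by metis
  define u where "u = complex_of_real (sqrt 2 / 2)"
  have "sqrt 2 / 2 * (sqrt 2 / 2) = (1 / 2 :: real)" by simp
  then have "u * u = 1 / 2" unfolding u_def of_real_mult[symmetric] by simp
  then have uu1: "2 * (u * u) = 1" by (simp only: nonzero_mult_div_cancel_left) simp
  have uu: "cnj u = u" by (simp add: u_def)
  define m where "m r = (if r = (0::nat) then m0
      else if r = 1 then (\<lambda>x. u - m0 x * (2 * u * cnj (E (2 * x))))
      else if r = 2 then (\<lambda>x. u * cis x - m0 x * (2 * u * cnj (G (2 * x))))
      else (\<lambda>x. m0 x * cnj (H (2 * x))))" for r
  have HH: "2 * (E (2*x) * cnj (E (2*x))) + 2 * (G (2*x) * cnj (G (2*x))) + H (2*x) * cnj (H (2*x)) = 1" for x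
  proof -
    have "1 - (2 * (E (2*x) * cnj (E (2*x))) + 2 * (G (2*x) * cnj (G (2*x)))) = H (2*x) * cnj (H (2*x))"
      using H(2)[of "2*x"] unfolding P_def complex_norm_square diff_diff_add .
    then show ?thesis by (metis add.commute diff_add_cancel)
  qed
  have sum4: "(\<Sum>r\<le>3. g r) = g 0 + g 1 + g 2 + g 3" for g :: "nat \<Rightarrow> complex"
    by (simp add: eval_nat_numeral)
  have per: "E (2 * x + 2 * pi) = E (2 * x)" "G (2 * x + 2 * pi) = G (2 * x)" "H (2 * x + 2 * pi) = H (2 * x)" for x
    by (intro trig_poly_periodic EG H)+
  have cpi: "cis (x + pi) = - cis x" for x by (simp add: complex_eq_iff)
  have t1: "trig_poly (\<lambda>x. u - m0 x * (2 * u * cnj (E (2 * x))))"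
    and t2: "trig_poly (\<lambda>x. u * cis x - m0 x * (2 * u * cnj (G (2 * x))))"
    and t3: "trig_poly (\<lambda>x. m0 x * cnj (H (2 * x)))"
    by (intro trig_poly_diff trig_poly_cmult trig_poly_mult trig_poly_const trig_poly_cis
          trig_poly_cnj trig_poly_dilate2[OF EG(1)] trig_poly_dilate2[OF EG(2)] trig_poly_dilate2[OF H(1)] m0)+
  show ?thesis
  proof (rule that[of m])
    show "m 0 = m0" by (simp add: m_def)
    show "trig_poly (m r)" for r using m0 t1 t2 t3 by (auto simp only: m_def split: if_split)
    fix x
    define e g h z where "e = E (2 * x)" and "g = G (2 * x)" and "h = H (2 * x)" and "z = cis x"
    define e' g' h' z' where "e' = cnj e" and "g' = cnj g" and "h' = cnj h" and "z' = cnj z"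
    have z1: "z * z' = 1" using zz[of x] by (simp add: z_def z'_def)
    have u2: "2 * (u * u) = 1" by (rule uu1)
    have bk: "cnj e' = e" "cnj g' = g" "cnj h' = h" "cnj z' = z"
      by (simp_all add: e'_def g'_def h'_def z'_def)
    note d = e_def[symmetric] g_def[symmetric] h_def[symmetric] z_def[symmetric]
      e'_def[symmetric] g'_def[symmetric] h'_def[symmetric] z'_def[symmetric] bk
    have h1: "h * h' = 1 - 2 * (e * e') - 2 * (g * g')"
    proof -
      have "2 * (e * e') + 2 * (g * g') + h * h' = 1" using HH[of x] by (simp only: d)
      then have "1 - (2 * (e * e') + 2 * (g * g')) = h * h'" by (metis add_diff_cancel_left')
      then show ?thesis by (simp only: diff_diff_add)
    qed
    define a b b' where "a = e + z * g" and "b = e' + z' * g'" and "b' = e' + (- z') * g'"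
    have m0x: "m0 x = a" "cnj a = b" "cnj (m0 (x + pi)) = b'"
      unfolding e1[of x] e2[of x] a_def b_def b'_def d by (simp_all add: d)
    have mv: "m 0 y = m0 y" "m 1 y = u - m0 y * (2 * u * cnj (E (2 * y)))"
      "m 2 y = u * cis y - m0 y * (2 * u * cnj (G (2 * y)))" "m 3 y = m0 y * cnj (H (2 * y))" for y
      by (simp_all add: m_def)
    have cd: "cnj (p - q) = cnj p - cnj q" "cnj (p * q) = cnj p * cnj q" "cnj 2 = 2" "cnj (- p) = - cnj p" for p q by simp_all
    have "(\<Sum>r\<le>3. m r x * cnj (m r x)) = a * b + (u - a * (2 * u * e')) * (u - b * (2 * u * e))
       + (u * z - a * (2 * u * g')) * (u * z' - b * (2 * u * g)) + a * h' * (b * h)"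
      unfolding sum4 mv by (simp only: m0x d uu cd)
    also have "\<dots> = u * u * (1 + z * z')" by (rule uep_mask_identity[OF u2 h1 a_def b_def])
    also have "\<dots> = 1" unfolding z1 using u2 by (simp only: one_add_one mult.commute[of "u * u"])
    finally show "(\<Sum>r\<le>3. m r x * cnj (m r x)) = 1" .
    have "(\<Sum>r\<le>3. m r x * cnj (m r (x + pi))) = a * b' + (u - a * (2 * u * e')) * (u - b' * (2 * u * e))
       + (u * z - a * (2 * u * g')) * (u * (- z') - b' * (2 * u * g)) + a * h' * (b' * h)"
      unfolding sum4 mv by (simp only: m0x d uu cd distrib_left[of 2] per cpi mult_minus_right)
    also have "\<dots> = u * u * (1 + z * (- z'))" by (rule uep_mask_identity[OF u2 h1 a_def b'_def])
    also have "\<dots> = 0" unfolding mult_minus_right z1 by simp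
    finally show "(\<Sum>r\<le>3. m r x * cnj (m r (x + pi))) = 0" .
  qed
qed

section \<open>Square integrable functions\<close>

lemma L2_realD:
  assumes "f \<in> L2_real"
  shows "f \<in> borel_measurable lebesgue" "integrable lebesgue (\<lambda>x. (cmod (f x))\<^sup>2)"
  using assms by (auto simp: L2_real_def)

lemma L2_real_bound:
  assumes "f \<in> borel_measurable lebesgue" "integrable lebesgue h" "\<And>x. (cmod (f x))\<^sup>2 \<le> h x"
  shows "f \<in> L2_real"
  unfolding L2_real_def
proof (intro CollectI conjI assms(1))
  have m [measurable]: "f \<in> borel_measurable lebesgue" by fact
  show "integrable lebesgue (\<lambda>x. (cmod (f x))\<^sup>2)"
    by (rule Bochner_Integration.integrable_bound[OF assms(2)])
       (use assms(3) in \<open>auto intro!: AE_I2 order_trans[OF assms(3)]\<close>)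
qed

lemma norm_add_sq_le: "(cmod (a + b))\<^sup>2 \<le> 2 * (cmod a)\<^sup>2 + 2 * (cmod b)\<^sup>2"
proof -
  have "(cmod (a + b))\<^sup>2 \<le> (cmod a + cmod b)\<^sup>2"
    by (intro power_mono norm_triangle_ineq) auto
  also have "\<dots> \<le> 2 * (cmod a)\<^sup>2 + 2 * (cmod b)\<^sup>2"
    using zero_le_power2[of "cmod a - cmod b"] unfolding power2_sum power2_diff by linarith
  finally show ?thesis .
qed

lemma L2_real_add:
  assumes "f \<in> L2_real" "g \<in> L2_real" shows "(\<lambda>x. f x + g x) \<in> L2_real"
proof (rule L2_real_bound)
  show "integrable lebesgue (\<lambda>x. 2 * (cmod (f x))\<^sup>2 + 2 * (cmod (g x))\<^sup>2)"
    using assms by (auto simp: L2_real_def)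
  show "(\<lambda>x. f x + g x) \<in> borel_measurable lebesgue"
    using assms by (auto simp: L2_real_def)
qed (rule norm_add_sq_le)

lemma L2_real_cmult:
  assumes "f \<in> L2_real" shows "(\<lambda>x. c * f x) \<in> L2_real"
proof (rule L2_real_bound)
  show "integrable lebesgue (\<lambda>x. (cmod c)\<^sup>2 * (cmod (f x))\<^sup>2)"
    using assms by (auto simp: L2_real_def)
  show "(\<lambda>x. c * f x) \<in> borel_measurable lebesgue"
    using assms by (auto simp: L2_real_def)
qed (simp add: norm_mult power_mult_distrib)

lemma L2_real_zero: "(\<lambda>x. 0) \<in> L2_real" by (simp add: L2_real_def)

lemma L2_real_diff:
  assumes "f \<in> L2_real" "g \<in> L2_real" shows "(\<lambda>x. f x - g x) \<in> L2_real"
  using L2_real_add[OF assms(1) L2_real_cmult[OF assms(2), of "-1"]] by simp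

lemma L2_real_sum:
  assumes "\<And>i. i \<in> I \<Longrightarrow> f i \<in> L2_real" shows "(\<lambda>x. \<Sum>i\<in>I. f i x) \<in> L2_real"
  using assms by (induction I rule: infinite_finite_induct) (auto intro: L2_real_zero L2_real_add)

lemma L2_mult_integrable:
  assumes "f \<in> L2_real" "g \<in> L2_real" shows "integrable lebesgue (\<lambda>x. f x * cnj (g x))"
proof (rule Bochner_Integration.integrable_bound)
  have [measurable]: "f \<in> borel_measurable lebesgue" "g \<in> borel_measurable lebesgue"
    using assms by (auto simp: L2_real_def)
  have "(\<lambda>x. cnj (g x)) \<in> borel_measurable lebesgue"
    by (rule borel_measurable_continuous_on[OF continuous_on_cnj[OF continuous_on_id]]) simp
  then show "(\<lambda>x. f x * cnj (g x)) \<in> borel_measurable lebesgue" by simp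
  show "integrable lebesgue (\<lambda>x. (cmod (f x))\<^sup>2 + (cmod (g x))\<^sup>2)"
    using assms by (auto simp: L2_real_def)
  show "AE x in lebesgue. norm (f x * cnj (g x)) \<le> norm ((cmod (f x))\<^sup>2 + (cmod (g x))\<^sup>2)"
  proof (rule AE_I2)
    fix x
    have "2 * (cmod (f x) * cmod (g x)) \<le> (cmod (f x))\<^sup>2 + (cmod (g x))\<^sup>2"
      using sum_squares_bound[of "cmod (f x)" "cmod (g x)"] by simp
    moreover have "0 \<le> cmod (f x) * cmod (g x)" by simp
    ultimately have "cmod (f x) * cmod (g x) \<le> (cmod (f x))\<^sup>2 + (cmod (g x))\<^sup>2" by linarith
    then show "norm (f x * cnj (g x)) \<le> norm ((cmod (f x))\<^sup>2 + (cmod (g x))\<^sup>2)"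
      by (simp add: norm_mult)
  qed
qed

lemma L2_inner_add_left:
  assumes "f \<in> L2_real" "g \<in> L2_real" "h \<in> L2_real"
  shows "L2_inner (\<lambda>x. f x + g x) h = L2_inner f h + L2_inner g h"
  unfolding L2_inner_def distrib_right
  by (rule Bochner_Integration.integral_add) (intro L2_mult_integrable assms)+

lemma L2_inner_cmult_left: "L2_inner (\<lambda>x. c * f x) h = c * L2_inner f h"
  unfolding L2_inner_def mult.assoc by (rule integral_mult_right_zero)

lemma L2_inner_sum_left:
  assumes "\<And>i. i \<in> I \<Longrightarrow> f i \<in> L2_real" "h \<in> L2_real"
  shows "L2_inner (\<lambda>x. \<Sum>i\<in>I. f i x) h = (\<Sum>i\<in>I. L2_inner (f i) h)"
  unfolding L2_inner_def sum_distrib_right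
  by (rule Bochner_Integration.integral_sum) (intro L2_mult_integrable assms)

lemma L2_inner_cnj: "L2_inner g f = cnj (L2_inner f g)"
  unfolding L2_inner_def
  by (subst Bochner_Integration.integral_cnj[symmetric]) (simp add: mult.commute[of "g _"])

lemma L2_inner_cmult_right: "L2_inner f (\<lambda>x. c * h x) = cnj c * L2_inner f h"
  by (subst (1 2) L2_inner_cnj) (simp add: L2_inner_cmult_left)

lemma L2_inner_add_right:
  assumes "f \<in> L2_real" "g \<in> L2_real" "h \<in> L2_real"
  shows "L2_inner h (\<lambda>x. f x + g x) = L2_inner h f + L2_inner h g"
  by (subst (1 2 3) L2_inner_cnj) (simp add: L2_inner_add_left assms)

lemma L2_inner_sum_right:
  assumes "\<And>i. i \<in> I \<Longrightarrow> f i \<in> L2_real" "h \<in> L2_real"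
  shows "L2_inner h (\<lambda>x. \<Sum>i\<in>I. f i x) = (\<Sum>i\<in>I. L2_inner h (f i))"
  by (subst L2_inner_cnj) (simp add: L2_inner_sum_left assms flip: L2_inner_cnj)

lemma L2_norm_sq: "(L2_norm f)\<^sup>2 = (\<integral>x. (cmod (f x))\<^sup>2 \<partial>lebesgue)"
  by (simp add: L2_norm_def)

lemma L2_norm_nonneg: "L2_norm f \<ge> 0" by (simp add: L2_norm_def)

lemma L2_inner_self: "L2_inner f f = of_real ((L2_norm f)\<^sup>2)"
  unfolding L2_norm_sq L2_inner_def integral_complex_of_real[symmetric]
  by (simp only: complex_norm_square)

lemma L2_norm_cmult: "L2_norm (\<lambda>x. c * f x) = cmod c * L2_norm f"
  unfolding L2_norm_def norm_mult power_mult_distrib integral_mult_right_zero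
  by (simp add: real_sqrt_mult)

lemma L2_norm_diff_commute: "L2_norm (\<lambda>x. f x - g x) = L2_norm (\<lambda>x. g x - f x)"
  by (simp add: L2_norm_def norm_minus_commute)

lemma L2_norm_add_sq:
  assumes "f \<in> L2_real" "g \<in> L2_real"
  shows "(L2_norm (\<lambda>x. f x + g x))\<^sup>2 = (L2_norm f)\<^sup>2 + 2 * Re (L2_inner f g) + (L2_norm g)\<^sup>2"
proof -
  have "complex_of_real ((L2_norm (\<lambda>x. f x + g x))\<^sup>2)
      = L2_inner f f + L2_inner f g + cnj (L2_inner f g) + L2_inner g g"
    unfolding L2_inner_self[symmetric]
    by (simp add: L2_inner_add_left L2_inner_add_right L2_real_add assms flip: L2_inner_cnj)
  then have "Re (complex_of_real ((L2_norm (\<lambda>x. f x + g x))\<^sup>2))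
      = Re (L2_inner f f + L2_inner f g + cnj (L2_inner f g) + L2_inner g g)" by (rule arg_cong)
  then show ?thesis by (simp add: L2_inner_self)
qed

text \<open>
  The usual discriminant argument; the two choices of \<open>t\<close> treat a vanishing and a
  nonvanishing norm of \<open>g\<close>.
\<close>
lemma L2_Cauchy_Schwarz:
  assumes f: "f \<in> L2_real" and g: "g \<in> L2_real"
  shows "cmod (L2_inner f g) \<le> L2_norm f * L2_norm g"
proof -
  define z where "z = L2_inner f g"
  have ineq: "0 \<le> (L2_norm f)\<^sup>2 + 2 * t * (cmod z)\<^sup>2 + t\<^sup>2 * (cmod z)\<^sup>2 * (L2_norm g)\<^sup>2" for t :: real
  proof -
    have "0 \<le> (L2_norm (\<lambda>x. f x + (of_real t * z) * g x))\<^sup>2" by simp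
    also have "\<dots> = (L2_norm f)\<^sup>2 + 2 * Re (cnj (of_real t * z) * z) + (cmod (of_real t * z) * L2_norm g)\<^sup>2"
      by (subst L2_norm_add_sq) (auto simp: L2_inner_cmult_right L2_norm_cmult z_def f L2_real_cmult g)
    also have "cnj (of_real t * z) * z = of_real (t * (cmod z)\<^sup>2)"
      using complex_norm_square[of z] by (simp add: mult_ac)
    finally show ?thesis by (simp add: norm_mult power_mult_distrib algebra_simps)
  qed
  show ?thesis
  proof (cases "L2_norm g = 0")
    case True
    have "cmod z = 0"
    proof (rule ccontr)
      assume "cmod z \<noteq> 0"
      then have "(cmod z)\<^sup>2 > 0" by simp
      then show False using ineq[of "- ((L2_norm f)\<^sup>2 + 1) / (2 * (cmod z)\<^sup>2)"] True by (simp add: field_simps)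
    qed
    then show ?thesis using True by (simp add: z_def)
  next
    case False
    define G where "G = (L2_norm g)\<^sup>2"
    have g0: "G > 0" using False by (simp add: G_def)
    have "(- 1 / G)\<^sup>2 * (cmod z)\<^sup>2 * G = (cmod z)\<^sup>2 / G"
      using g0 by (simp add: power2_eq_square)
    then have "0 \<le> (L2_norm f)\<^sup>2 - (cmod z)\<^sup>2 / G"
      using ineq[of "- 1 / G", folded G_def] by simp
    then have "(cmod z)\<^sup>2 \<le> (L2_norm f * L2_norm g)\<^sup>2"
      using g0 by (simp add: field_simps power_mult_distrib flip: G_def)
    then show ?thesis unfolding z_def
      by (rule power2_le_imp_le) (simp add: L2_norm_nonneg)
  qed
qed

lemma L2_norm_triangle:
  assumes f: "f \<in> L2_real" and g: "g \<in> L2_real"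
  shows "L2_norm (\<lambda>x. f x + g x) \<le> L2_norm f + L2_norm g"
proof (rule power2_le_imp_le)
  have "Re (L2_inner f g) \<le> L2_norm f * L2_norm g"
    using L2_Cauchy_Schwarz[OF f g] complex_Re_le_cmod[of "L2_inner f g"] by linarith
  then show "(L2_norm (\<lambda>x. f x + g x))\<^sup>2 \<le> (L2_norm f + L2_norm g)\<^sup>2"
    unfolding L2_norm_add_sq[OF f g] power2_sum by simp
qed (simp add: L2_norm_nonneg)

lemma L2_norm_triangle_diff:
  assumes f: "f \<in> L2_real" and g: "g \<in> L2_real"
  shows "L2_norm f \<le> L2_norm g + L2_norm (\<lambda>x. f x - g x)"
  using L2_norm_triangle[OF g L2_real_diff[OF f g]] by simp

lemma L2_parallelogram:
  assumes f: "f \<in> L2_real" and g: "g \<in> L2_real"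
  shows "(L2_norm (\<lambda>x. f x - g x))\<^sup>2 = 2 * (L2_norm f)\<^sup>2 + 2 * (L2_norm g)\<^sup>2 - 4 * (L2_norm (\<lambda>x. (f x + g x) / 2))\<^sup>2"
proof -
  have m: "L2_norm (\<lambda>x. (f x + g x) / 2) = (1/2) * L2_norm (\<lambda>x. f x + g x)"
    using L2_norm_cmult[of "1/2" "\<lambda>x. f x + g x"] by simp
  have d: "(L2_norm (\<lambda>x. f x - g x))\<^sup>2 = (L2_norm f)\<^sup>2 - 2 * Re (L2_inner f g) + (L2_norm g)\<^sup>2"
    using L2_norm_add_sq[OF f L2_real_cmult[OF g, of "-1"]]
      L2_inner_cmult_right[of f "-1" g] L2_norm_cmult[of "-1" g] by simp
  show ?thesis unfolding m d power_mult_distrib L2_norm_add_sq[OF f g] by (simp add: power_divide field_simps)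
qed

lemma L2_Bessel:
  assumes I: "finite I" and e: "\<And>i. i \<in> I \<Longrightarrow> e i \<in> L2_real"
    and orth: "\<And>i j. i \<in> I \<Longrightarrow> j \<in> I \<Longrightarrow> L2_inner (e i) (e j) = (if i = j then 1 else 0)"
    and f: "f \<in> L2_real"
  shows "(\<Sum>i\<in>I. (cmod (L2_inner f (e i)))\<^sup>2) \<le> (L2_norm f)\<^sup>2"
proof -
  define c where "c i = L2_inner f (e i)" for i
  define s where "s = (\<lambda>x. \<Sum>i\<in>I. c i * e i x)"
  define S where "S = (\<Sum>i\<in>I. (cmod (c i))\<^sup>2)"
  have s: "s \<in> L2_real" unfolding s_def by (intro L2_real_sum L2_real_cmult e)
  have cc: "complex_of_real S = (\<Sum>i\<in>I. c i * cnj (c i))"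
    unfolding S_def of_real_sum complex_norm_square ..
  have fs: "L2_inner f s = of_real S"
    unfolding s_def cc
    by (subst L2_inner_sum_right) (auto simp: f e L2_real_cmult L2_inner_cmult_right c_def[symmetric] intro!: sum.cong mult.commute)
  have "L2_inner s s = (\<Sum>i\<in>I. c i * L2_inner (e i) s)"
    by (subst s_def, subst L2_inner_sum_left) (auto simp: s e L2_real_cmult L2_inner_cmult_left)
  also have "\<dots> = (\<Sum>i\<in>I. c i * cnj (c i))"
  proof (intro sum.cong refl arg_cong2[where f = "(*)"])
    fix i assume i: "i \<in> I"
    have "L2_inner (e i) s = (\<Sum>j\<in>I. cnj (c j) * L2_inner (e i) (e j))"
      unfolding s_def by (subst L2_inner_sum_right) (auto simp: i e L2_real_cmult L2_inner_cmult_right)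
    also have "\<dots> = (\<Sum>j\<in>I. if i = j then cnj (c j) else 0)"
      by (intro sum.cong refl) (auto simp: orth i)
    also have "\<dots> = cnj (c i)" using i I by simp
    finally show "L2_inner (e i) s = cnj (c i)" .
  qed
  finally have ss: "L2_inner s s = of_real S" by (simp add: cc)
  have "0 \<le> (L2_norm (\<lambda>x. f x + (-1) * s x))\<^sup>2" by simp
  also have "\<dots> = (L2_norm f)\<^sup>2 + 2 * Re (- of_real S) + (L2_norm s)\<^sup>2"
    by (subst L2_norm_add_sq[OF f L2_real_cmult[OF s]], subst L2_inner_cmult_right, subst L2_norm_cmult) (simp add: fs)
  also have "(L2_norm s)\<^sup>2 = S"
    using ss unfolding L2_inner_self by (simp only: of_real_eq_iff)
  finally show ?thesis by (simp add: S_def c_def)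
qed

lemma L2_real_affine:
  assumes f: "f \<in> L2_real" and c: "c \<noteq> 0"
  shows "(\<lambda>x. f (c * x + t)) \<in> L2_real"
proof -
  have "(\<lambda>x. t + c * x) \<in> lebesgue \<rightarrow>\<^sub>M lebesgue"
    using lebesgue_affine_measurable[where c= "\<lambda>x::real. c"] c by simp
  then have "(\<lambda>x. f (t + c * x)) \<in> borel_measurable lebesgue"
    using L2_realD(1)[OF f] by (rule measurable_compose[where f="\<lambda>x. t + c * x" and g=f])
  moreover have "integrable lebesgue (\<lambda>x. (cmod (f (t + c * x)))\<^sup>2)"
    by (rule iffD2[OF lebesgue_integrable_real_affine_iff[OF c, of "\<lambda>x. (cmod (f x))\<^sup>2" t] L2_realD(2)[OF f]])
  ultimately have "(\<lambda>x. f (t + c * x)) \<in> L2_real" unfolding L2_real_def by blast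
  then show ?thesis by (simp only: add.commute[of t])
qed

lemma L2_norm_affine:
  assumes c: "c \<noteq> 0"
  shows "(L2_norm (\<lambda>x. f (c * x + t)))\<^sup>2 = (L2_norm f)\<^sup>2 / \<bar>c\<bar>"
proof -
  have "(L2_norm f)\<^sup>2 = \<bar>c\<bar> * (L2_norm (\<lambda>x. f (t + c * x)))\<^sup>2"
    unfolding L2_norm_sq using lebesgue_integral_real_affine[OF c, of "\<lambda>x. (cmod (f x))\<^sup>2" t]
    by (simp only: real_scaleR_def)
  then show ?thesis using c by (simp only: add.commute[of t]) simp
qed

lemma L2_norm_zero_AE:
  assumes "f \<in> L2_real" "L2_norm f = 0" shows "AE x in lebesgue. f x = 0"
proof -
  have "(\<integral>x. (cmod (f x))\<^sup>2 \<partial>lebesgue) = 0" using assms(2) L2_norm_sq[of f] by simp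
  then have "AE x in lebesgue. (cmod (f x))\<^sup>2 = 0"
    using integral_nonneg_eq_0_iff_AE[OF L2_realD(2)[OF assms(1)]] by simp
  then show ?thesis by simp
qed

section \<open>Completeness, dense subsets and the Parseval identity\<close>

lemma nn_integral_L2:
  assumes "f \<in> L2_real"
  shows "(\<integral>\<^sup>+x. ennreal ((cmod (f x))\<^sup>2) \<partial>lebesgue) = ennreal ((L2_norm f)\<^sup>2)"
  unfolding L2_norm_sq by (rule nn_integral_eq_integral) (use assms in \<open>auto simp: L2_real_def\<close>)

lemma L2_real_nn_integral:
  assumes m: "f \<in> borel_measurable lebesgue"
    and le: "(\<integral>\<^sup>+x. ennreal ((cmod (f x))\<^sup>2) \<partial>lebesgue) \<le> ennreal C" and C: "C \<ge> 0"
  shows "f \<in> L2_real" "(L2_norm f)\<^sup>2 \<le> C"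
proof -
  have "integrable lebesgue (\<lambda>x. (cmod (f x))\<^sup>2)"
    using m by (intro integrableI_nonneg) (auto intro: le_less_trans[OF le])
  then show f: "f \<in> L2_real" using m by (simp add: L2_real_def)
  show "(L2_norm f)\<^sup>2 \<le> C" using le C unfolding nn_integral_L2[OF f] by simp
qed

lemma L2_norm_sum_le:
  assumes "\<And>i. i \<in> I \<Longrightarrow> f i \<in> L2_real"
  shows "L2_norm (\<lambda>x. \<Sum>i\<in>I. f i x) \<le> (\<Sum>i\<in>I. L2_norm (f i))"
  using assms
proof (induction I rule: infinite_finite_induct)
  case (insert i I)
  have "L2_norm (\<lambda>x. \<Sum>j\<in>insert i I. f j x) \<le> L2_norm (f i) + L2_norm (\<lambda>x. \<Sum>j\<in>I. f j x)"
    using L2_norm_triangle[OF _ L2_real_sum, of "f i" I f] insert by simp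
  then show ?case using insert by fastforce
qed (auto simp: L2_norm_def)

lemma L2_norm_abs: "L2_norm (\<lambda>x. of_real (cmod (f x))) = L2_norm f"
  by (simp add: L2_norm_def)

lemma L2_real_abs: "f \<in> L2_real \<Longrightarrow> (\<lambda>x. of_real (cmod (f x))) \<in> L2_real"
  by (auto simp: L2_real_def)

text \<open>
  The partial sums of the moduli of the increments have norm at most two, so by monotone convergence
  the series of increments converges absolutely almost everywhere.
\<close>
lemma L2_fast_Cauchy_AE_convergent:
  assumes w: "\<And>n. w n \<in> L2_real"
    and fast: "\<And>n. L2_norm (\<lambda>x. w (Suc n) x - w n x) \<le> (1/2)^n"
  shows "AE x in lebesgue. convergent (\<lambda>n. w n x)"
proof -
  define h where "h k x = cmod (w (Suc k) x - w k x)" for k x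
  define S where "S n x = (\<Sum>k<n. h k x)" for n x
  have dL: "(\<lambda>x. w (Suc k) x - w k x) \<in> L2_real" for k by (intro L2_real_diff w)
  have SL: "(\<lambda>x. complex_of_real (S n x)) \<in> L2_real" for n
    unfolding S_def h_def of_real_sum by (intro L2_real_sum L2_real_abs dL)
  have SN: "L2_norm (\<lambda>x. complex_of_real (S n x)) \<le> 2" for n
  proof -
    have "L2_norm (\<lambda>x. complex_of_real (S n x)) \<le> (\<Sum>k<n. L2_norm (\<lambda>x. complex_of_real (h k x)))"
      unfolding S_def of_real_sum h_def by (intro L2_norm_sum_le L2_real_abs dL)
    also have "\<dots> \<le> (\<Sum>k<n. (1/2)^k)"
      unfolding h_def L2_norm_abs by (intro sum_mono fast)
    also have "(\<Sum>k<n. (1/2)^k) = 2 - 2 * (1/2::real)^n" by (induction n) auto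
    also have "\<dots> \<le> 2" by simp
    finally show ?thesis .
  qed
  have Spos: "S n x \<ge> 0" for n x by (auto simp: S_def h_def intro: sum_nonneg)
  have mono: "S n x \<le> S (Suc n) x" for n x by (simp add: S_def h_def)
  have meas: "(\<lambda>x. (S n x)\<^sup>2) \<in> borel_measurable lebesgue" for n
  proof -
    have "(\<lambda>x. cmod (w (Suc k) x - w k x)) \<in> borel_measurable lebesgue" for k
      using L2_realD(1)[OF dL[of k]] by simp
    then have "S n \<in> borel_measurable lebesgue" unfolding S_def[abs_def] h_def by (intro borel_measurable_sum)
    then show "(\<lambda>x. (S n x)\<^sup>2) \<in> borel_measurable lebesgue" by (rule borel_measurable_power)
  qed
  have "(\<integral>\<^sup>+x. (SUP n. ennreal ((S n x)\<^sup>2)) \<partial>lebesgue) = (SUP n. \<integral>\<^sup>+x. ennreal ((S n x)\<^sup>2) \<partial>lebesgue)"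
    by (rule nn_integral_monotone_convergence_SUP)
       (auto intro!: incseq_SucI le_funI ennreal_leI power_mono mono Spos meas)
  also have "\<dots> \<le> ennreal 4"
  proof (rule SUP_least)
    fix n
    have "(\<integral>\<^sup>+x. ennreal ((S n x)\<^sup>2) \<partial>lebesgue) = ennreal ((L2_norm (\<lambda>x. complex_of_real (S n x)))\<^sup>2)"
      using nn_integral_L2[OF SL[of n]] by simp
    also have "\<dots> \<le> ennreal (2\<^sup>2)" by (intro ennreal_leI power_mono SN L2_norm_nonneg)
    finally show "(\<integral>\<^sup>+x. ennreal ((S n x)\<^sup>2) \<partial>lebesgue) \<le> ennreal 4" by simp
  qed
  finally have "(\<integral>\<^sup>+x. (SUP n. ennreal ((S n x)\<^sup>2)) \<partial>lebesgue) \<noteq> \<infinity>"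
    using neq_top_trans[of "ennreal 4"] by (simp add: top_unique)
  then have "AE x in lebesgue. (SUP n. ennreal ((S n x)\<^sup>2)) \<noteq> \<infinity>"
    by (intro nn_integral_PInf_AE) (auto intro!: borel_measurable_SUP meas)
  then show ?thesis
  proof (rule AE_mp, intro AE_I2 impI)
    fix x assume fin: "(SUP n. ennreal ((S n x)\<^sup>2)) \<noteq> \<infinity>"
    define C where "C = enn2real (SUP n. ennreal ((S n x)\<^sup>2))"
    have C: "ennreal C = (SUP n. ennreal ((S n x)\<^sup>2))" unfolding C_def
      by (rule ennreal_enn2real) (use fin in \<open>simp only: infinity_ennreal_def less_top\<close>)
    have SC: "(S n x)\<^sup>2 \<le> C" for n
    proof -
      have "ennreal ((S n x)\<^sup>2) \<le> ennreal C" unfolding C by (rule SUP_upper) simp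
      moreover have "C \<ge> 0" by (simp add: C_def)
      ultimately show ?thesis by simp
    qed
    have "S n x \<le> sqrt C" for n using SC[of n] by (rule real_le_rsqrt)
    then have "summable (\<lambda>k. h k x)"
      by (intro summableI_nonneg_bounded[of _ "sqrt C"]) (auto simp: S_def h_def)
    then have "summable (\<lambda>k. w (Suc k) x - w k x)" unfolding h_def by (rule summable_norm_cancel)
    then have "(\<lambda>n. \<Sum>k<n. w (Suc k) x - w k x) \<longlonglongrightarrow> (\<Sum>k. w (Suc k) x - w k x)" by (rule summable_LIMSEQ)
    then have "(\<lambda>n. w n x - w 0 x) \<longlonglongrightarrow> (\<Sum>k. w (Suc k) x - w k x)" by (simp only: sum_lessThan_telescope[of "\<lambda>n. w n x"])
    then have "(\<lambda>n. (w n x - w 0 x) + w 0 x) \<longlonglongrightarrow> (\<Sum>k. w (Suc k) x - w k x) + w 0 x"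
      by (intro tendsto_add tendsto_const)
    then show "convergent (\<lambda>n. w n x)" by (auto simp: convergent_def)
  qed
qed

text \<open>
  The theorem of Riesz and Fischer: the limit is the pointwise limit of a rapidly converging
  subsequence, and Fatou's lemma bounds its distance to the sequence. A pointwise limit inherits the
  common support everywhere and not only almost everywhere, so that supports remain statements about
  all points below.
\<close>
lemma L2_complete:
  assumes w: "\<And>n. w n \<in> L2_real"
    and Cauchy: "\<And>e. e > 0 \<Longrightarrow> \<exists>N. \<forall>m\<ge>N. \<forall>n\<ge>N. L2_norm (\<lambda>x. w m x - w n x) \<le> e"
    and supp: "\<And>n x. x \<notin> K \<Longrightarrow> w n x = 0"
  obtains u where "u \<in> L2_real" "(\<lambda>n. L2_norm (\<lambda>x. w n x - u x)) \<longlonglongrightarrow> 0" "\<And>x. x \<notin> K \<Longrightarrow> u x = 0"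
proof -
  have "\<forall>k. \<exists>N. \<forall>m\<ge>N. \<forall>n\<ge>N. L2_norm (\<lambda>x. w m x - w n x) \<le> (1/2)^k"
    by (intro allI Cauchy) simp
  then obtain N where N: "\<And>k m n. m \<ge> N k \<Longrightarrow> n \<ge> N k \<Longrightarrow> L2_norm (\<lambda>x. w m x - w n x) \<le> (1/2)^k"
    by metis
  (* The sum exceeds each N i with i \<le> k; the summand k makes R tend to infinity. *)
  define R where "R k = (\<Sum>i\<le>k. N i) + k" for k
  have RN: "R k \<ge> N k" for k unfolding R_def by (intro trans_le_add1 member_le_sum) auto
  have RS: "R (Suc k) \<ge> N k" for k using RN[of k] by (simp add: R_def)
  have Rk: "R k \<ge> k" for k by (simp add: R_def)
  define v where "v k = w (R k)" for k
  have v: "v k \<in> L2_real" for k by (simp add: v_def w)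
  have conv: "AE x in lebesgue. convergent (\<lambda>n. v n x)"
    by (rule L2_fast_Cauchy_AE_convergent[OF v]) (unfold v_def, intro N RN RS)
  define u where "u x = lim (\<lambda>n. v n x)" for x
  have um: "u \<in> borel_measurable lebesgue"
    unfolding u_def[abs_def] by (rule borel_measurable_lim_metric) (use v in \<open>auto simp: L2_real_def\<close>)
  have lim: "AE x in lebesgue. (\<lambda>n. v n x) \<longlonglongrightarrow> u x"
    using conv by (rule AE_mp) (auto simp: u_def convergent_LIMSEQ_iff)
  have est: "(\<lambda>x. u x - w n x) \<in> L2_real \<and> (L2_norm (\<lambda>x. u x - w n x))\<^sup>2 \<le> e\<^sup>2"
    if M: "\<forall>m\<ge>M. \<forall>n\<ge>M. L2_norm (\<lambda>x. w m x - w n x) \<le> e" and n: "n \<ge> M" and e: "e > 0" for e M n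
  proof -
    have dL: "(\<lambda>x. v k x - w n x) \<in> L2_real" for k by (intro L2_real_diff v w)
    have "(\<integral>\<^sup>+x. ennreal ((cmod (u x - w n x))\<^sup>2) \<partial>lebesgue)
        = (\<integral>\<^sup>+x. liminf (\<lambda>k. ennreal ((cmod (v k x - w n x))\<^sup>2)) \<partial>lebesgue)"
    proof (rule nn_integral_cong_AE, rule AE_mp[OF lim], intro AE_I2 impI)
      fix x assume "(\<lambda>n. v n x) \<longlonglongrightarrow> u x"
      then have "(\<lambda>k. ennreal ((cmod (v k x - w n x))\<^sup>2)) \<longlonglongrightarrow> ennreal ((cmod (u x - w n x))\<^sup>2)"
        by (intro tendsto_ennrealI tendsto_intros)
      then show "ennreal ((cmod (u x - w n x))\<^sup>2) = liminf (\<lambda>k. ennreal ((cmod (v k x - w n x))\<^sup>2))"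
        by (intro lim_imp_Liminf[symmetric]) auto
    qed
    also have "\<dots> \<le> liminf (\<lambda>k. \<integral>\<^sup>+x. ennreal ((cmod (v k x - w n x))\<^sup>2) \<partial>lebesgue)"
      by (rule nn_integral_liminf) (use L2_realD(1)[OF dL] in simp)
    also have "\<dots> \<le> liminf (\<lambda>k::nat. ennreal (e\<^sup>2))"
    proof (rule Liminf_mono, rule eventually_sequentiallyI[of M])
      fix k assume k: "k \<ge> M"
      have "L2_norm (\<lambda>x. v k x - w n x) \<le> e"
        unfolding v_def using M n k Rk[of k] by auto
      then show "(\<integral>\<^sup>+x. ennreal ((cmod (v k x - w n x))\<^sup>2) \<partial>lebesgue) \<le> ennreal (e\<^sup>2)"
        unfolding nn_integral_L2[OF dL] by (intro ennreal_leI power_mono L2_norm_nonneg)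
    qed
    also have "\<dots> = ennreal (e\<^sup>2)" by (simp add: Liminf_const)
    finally have le: "(\<integral>\<^sup>+x. ennreal ((cmod (u x - w n x))\<^sup>2) \<partial>lebesgue) \<le> ennreal (e\<^sup>2)" .
    have "(\<lambda>x. u x - w n x) \<in> borel_measurable lebesgue" using um L2_realD(1)[OF w] by simp
    from L2_real_nn_integral[OF this le] show ?thesis by simp
  qed
  have uL: "u \<in> L2_real"
  proof -
    obtain M where "\<forall>m\<ge>M. \<forall>n\<ge>M. L2_norm (\<lambda>x. w m x - w n x) \<le> 1" using Cauchy[of 1] by auto
    then have "(\<lambda>x. u x - w M x) \<in> L2_real" using est[of M 1 M] by simp
    then show ?thesis using L2_real_add[OF _ w[of M], of "\<lambda>x. u x - w M x"] by simp
  qed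
  have "(\<lambda>n. L2_norm (\<lambda>x. w n x - u x)) \<longlonglongrightarrow> 0"
  proof (rule LIMSEQ_I)
    fix r :: real assume r: "r > 0"
    obtain M where M: "\<forall>m\<ge>M. \<forall>n\<ge>M. L2_norm (\<lambda>x. w m x - w n x) \<le> r / 2" using Cauchy[of "r / 2"] r by auto
    have "L2_norm (\<lambda>x. w n x - u x) < r" if "n \<ge> M" for n
    proof -
      have "(L2_norm (\<lambda>x. u x - w n x))\<^sup>2 \<le> (r / 2)\<^sup>2" using est[OF M that] r by simp
      then have "L2_norm (\<lambda>x. u x - w n x) \<le> r / 2" by (rule power2_le_imp_le) (use r in simp)
      then show ?thesis unfolding L2_norm_diff_commute[of "w n"] using r by linarith
    qed
    then show "\<exists>no. \<forall>n\<ge>no. norm (L2_norm (\<lambda>x. w n x - u x) - 0) < r"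
      by (intro exI[of _ M]) (auto simp: L2_norm_nonneg)
  qed
  moreover have "u x = 0" if "x \<notin> K" for x
    using supp[OF that] by (simp add: u_def v_def)
  ultimately show ?thesis using that uL by blast
qed

lemma L2_norm_tendsto_dominated:
  assumes m: "\<And>n. d n \<in> borel_measurable lebesgue" "g \<in> borel_measurable lebesgue"
    and lim: "AE x in lebesgue. (\<lambda>n. d n x) \<longlonglongrightarrow> g x"
    and dom: "integrable lebesgue h" "\<And>n x. (cmod (d n x - g x))\<^sup>2 \<le> h x"
  shows "(\<lambda>n. L2_norm (\<lambda>x. d n x - g x)) \<longlonglongrightarrow> 0"
proof -
  have "(\<lambda>n. \<integral>x. (cmod (d n x - g x))\<^sup>2 \<partial>lebesgue) \<longlonglongrightarrow> (\<integral>x. 0 \<partial>(lebesgue :: real measure))"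
  proof (rule Bochner_Integration.integral_dominated_convergence[where w = h and f = "\<lambda>x. 0" and s = "\<lambda>n x. (cmod (d n x - g x))\<^sup>2"])
    show "integrable lebesgue h" by (rule dom(1))
    show "AE x in lebesgue. (\<lambda>n. (cmod (d n x - g x))\<^sup>2) \<longlonglongrightarrow> 0"
      using lim
    proof (rule AE_mp, intro AE_I2 impI)
      fix x assume "(\<lambda>n. d n x) \<longlonglongrightarrow> g x"
      then have "(\<lambda>n. (cmod (d n x - g x))\<^sup>2) \<longlonglongrightarrow> (cmod (g x - g x))\<^sup>2" by (intro tendsto_intros)
      then show "(\<lambda>n. (cmod (d n x - g x))\<^sup>2) \<longlonglongrightarrow> 0" by simp
    qed
    show "(\<lambda>x. (cmod (d n x - g x))\<^sup>2) \<in> borel_measurable lebesgue" for n using m by simp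
    show "AE x in lebesgue. norm ((cmod (d n x - g x))\<^sup>2) \<le> h x" for n using dom(2) by simp
  qed simp
  then have "(\<lambda>n. sqrt (\<integral>x. (cmod (d n x - g x))\<^sup>2 \<partial>lebesgue)) \<longlonglongrightarrow> sqrt 0"
    by (intro tendsto_real_sqrt) simp
  then show ?thesis by (simp add: L2_norm_def)
qed

lemma continuous_borel_measurable_lebesgue:
  fixes d :: "real \<Rightarrow> complex"
  assumes "continuous_on UNIV d" shows "d \<in> borel_measurable lebesgue"
  by (rule measurable_completion) (use borel_measurable_continuous_onI[OF assms] in simp)

lemma integrable_indicator_Icc: "integrable lebesgue (indicator {a..b::real} :: real \<Rightarrow> real)"
proof (rule integrable_real_indicator)
  have "{a..b} \<in> lmeasurable" using lmeasurable_cbox[of a b] by (simp only: cbox_interval)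
  then show "{a..b} \<in> sets lebesgue" "emeasure lebesgue {a..b} < \<infinity>"
    by (auto simp: fmeasurable_def)
qed

lemma continuous_compact_support_L2:
  assumes "continuous_on UNIV d" "\<And>x. \<bar>x\<bar> > R \<Longrightarrow> d x = (0::complex)"
  shows "d \<in> L2_real"
proof -
  have d: "d \<in> borel_measurable lebesgue" by (rule continuous_borel_measurable_lebesgue[OF assms(1)])
  have "bounded (d ` {-R..R})"
    by (intro compact_imp_bounded compact_continuous_image continuous_on_subset[OF assms(1)]) auto
  then obtain B where "\<forall>y\<in>d ` {-R..R}. cmod y \<le> B" unfolding bounded_iff by blast
  then have B: "\<And>x. x \<in> {-R..R} \<Longrightarrow> cmod (d x) \<le> B" by blast
  show ?thesis
  proof (rule L2_real_bound[OF d])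
    show "integrable lebesgue (\<lambda>x. B\<^sup>2 * indicator {-R..R} x)" by (intro integrable_mult_right integrable_indicator_Icc)
    fix x
    show "(cmod (d x))\<^sup>2 \<le> B\<^sup>2 * indicator {-R..R} x"
    proof (cases "x \<in> {-R..R}")
      case True
      then show ?thesis using power_mono[OF B[OF True]] by simp
    next
      case False
      then have "\<bar>x\<bar> > R" by auto
      then show ?thesis using assms(2) False by simp
    qed
  qed
qed

lemma L2_dense_bounded_support:
  assumes g: "g \<in> L2_real" and e: "e > 0"
  obtains n :: nat and g' where "g' \<in> borel_measurable lebesgue" "\<And>x. cmod (g' x) \<le> real n"
    "\<And>x. \<bar>x\<bar> > real n \<Longrightarrow> g' x = 0" "L2_norm (\<lambda>x. g' x - g x) < e"
proof -
  have [measurable]: "g \<in> borel_measurable lebesgue" using g by (simp add: L2_real_def)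
  define t where "t n x = (if \<bar>x\<bar> \<le> real n \<and> cmod (g x) \<le> real n then g x else 0)" for n x
  have tm: "t n \<in> borel_measurable lebesgue" for n
  proof -
    have [measurable]: "(\<lambda>x::real. x) \<in> borel_measurable lebesgue" by (rule measurable_completion) simp
    have [measurable]: "(\<lambda>x. cmod (g x)) \<in> borel_measurable lebesgue" by simp
    have "{x \<in> space lebesgue. \<bar>x\<bar> \<le> real n} \<in> sets lebesgue" by (rule borel_measurable_le) simp_all
    moreover have "{x \<in> space lebesgue. cmod (g x) \<le> real n} \<in> sets lebesgue" by (rule borel_measurable_le) simp_all
    ultimately have "{x \<in> space lebesgue. \<bar>x\<bar> \<le> real n} \<inter> {x \<in> space lebesgue. cmod (g x) \<le> real n} \<in> sets lebesgue"
      by (rule sets.Int)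
    moreover have "{x \<in> space lebesgue. \<bar>x\<bar> \<le> real n} \<inter> {x \<in> space lebesgue. cmod (g x) \<le> real n}
        = {x \<in> space lebesgue. \<bar>x\<bar> \<le> real n \<and> cmod (g x) \<le> real n}" by auto
    ultimately have "{x \<in> space lebesgue. \<bar>x\<bar> \<le> real n \<and> cmod (g x) \<le> real n} \<in> sets lebesgue" by (simp only:)
    then show ?thesis unfolding t_def[abs_def] by (intro measurable_If) simp_all
  qed
  have "(\<lambda>n. L2_norm (\<lambda>x. t n x - g x)) \<longlonglongrightarrow> 0"
  proof (rule L2_norm_tendsto_dominated[OF tm _ _ L2_realD(2)[OF g]])
    show "AE x in lebesgue. (\<lambda>n. t n x) \<longlonglongrightarrow> g x"
    proof (rule AE_I2)
      fix x
      obtain N :: nat where N: "max \<bar>x\<bar> (cmod (g x)) \<le> real N" using real_arch_simple by blast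
      have "eventually (\<lambda>n. t n x = g x) sequentially"
        by (rule eventually_sequentiallyI[of N]) (use N in \<open>auto simp: t_def\<close>)
      then show "(\<lambda>n. t n x) \<longlonglongrightarrow> g x" by (rule tendsto_eventually)
    qed
    show "(cmod (t n x - g x))\<^sup>2 \<le> (cmod (g x))\<^sup>2" for n x by (simp add: t_def)
  qed simp
  from order_tendstoD(2)[OF this e] obtain n where n: "L2_norm (\<lambda>x. t n x - g x) < e"
    by (auto simp: eventually_sequentially)
  show ?thesis by (rule that[of "t n" n]) (use tm n in \<open>auto simp: t_def\<close>)
qed

text \<open>
  After truncation the function is bounded with bounded support. It is an almost everywhere limit of
  continuous functions, which are made dominated by clamping their values and by a cut-off; neither
  changes the limit.
\<close>
lemma L2_dense_continuous:
  assumes g: "g \<in> L2_real" and e: "e > 0"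
  obtains R d where "continuous_on UNIV d" "\<And>x. \<bar>x\<bar> > R \<Longrightarrow> d x = 0" "L2_norm (\<lambda>x. g x - d x) < e"
proof -
  obtain g' and n :: nat where g': "g' \<in> borel_measurable lebesgue" "\<And>x. cmod (g' x) \<le> real n"
    "\<And>x. \<bar>x\<bar> > real n \<Longrightarrow> g' x = 0" "L2_norm (\<lambda>x. g' x - g x) < e / 2"
    by (rule L2_dense_bounded_support[OF g half_gt_zero[OF e]]) blast
  have "g' measurable_on UNIV" using lebesgue_measurable_imp_measurable_on[OF g'(1)] by simp
  then obtain N h where h: "negligible N" "\<And>k::nat. continuous_on UNIV (h k)"
    "\<And>x. x \<notin> N \<Longrightarrow> (\<lambda>k. h k x) \<longlonglongrightarrow> g' x"
    unfolding measurable_on_def by auto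
  (* T clamps the modulus at n + 1 and cut is a continuous cut-off; both fix g'. *)
  define T where "T z = z / of_real (max 1 (cmod z / (real n + 1)))" for z :: complex
  define cut where "cut x = max 0 (min 1 (real n + 1 - \<bar>x\<bar>))" for x :: real
  define d where "d k x = of_real (cut x) * T (h k x)" for k x
  have Tc: "continuous_on UNIV T" unfolding T_def
    by (intro continuous_intros) (auto simp: max_def)
  have Tb: "cmod (T z) \<le> real n + 1" for z
  proof -
    have "cmod z \<le> (real n + 1) * max 1 (cmod z / (real n + 1))"
      by (cases "cmod z / (real n + 1) \<le> 1") (auto simp: max_def field_simps)
    then show ?thesis by (simp add: T_def norm_divide divide_le_eq)
  qed
  have Tid: "T (g' x) = g' x" for x
  proof -
    have "cmod (g' x) / (real n + 1) \<le> 1" using g'(2)[of x] by (simp add: divide_le_eq)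
    then show ?thesis by (simp add: T_def max_def)
  qed
  have cut01: "0 \<le> cut x" "cut x \<le> 1" for x by (auto simp: cut_def)
  have dc: "continuous_on UNIV (d k)" for k
    unfolding d_def[abs_def] cut_def
    by (intro continuous_intros continuous_on_compose2[OF Tc h(2)]) auto
  have d0: "d k x = 0" if "\<bar>x\<bar> > real n + 1" for k x using that by (simp add: d_def cut_def)
  have dm: "d k \<in> borel_measurable lebesgue" for k
    by (rule continuous_borel_measurable_lebesgue[OF dc])
  have "(\<lambda>k. L2_norm (\<lambda>x. d k x - g' x)) \<longlonglongrightarrow> 0"
  proof (rule L2_norm_tendsto_dominated[OF dm g'(1)])
    have "AE x in lebesgue. x \<notin> N" using h(1) unfolding negligible_iff_null_sets by (rule AE_not_in)
    then show "AE x in lebesgue. (\<lambda>k. d k x) \<longlonglongrightarrow> g' x"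
    proof (rule AE_mp, intro AE_I2 impI)
      fix x assume "x \<notin> N"
      then have "(\<lambda>k. T (h k x)) \<longlonglongrightarrow> T (g' x)"
        using Tc h(3) by (intro isCont_tendsto_compose[of _ T]) (simp_all add: continuous_on_eq_continuous_at)
      then have "(\<lambda>k. d k x) \<longlonglongrightarrow> of_real (cut x) * T (g' x)"
        unfolding d_def by (intro tendsto_intros)
      moreover have "of_real (cut x) * T (g' x) = g' x"
        using g'(3)[of x] Tid[of x] by (cases "\<bar>x\<bar> > real n") (auto simp: cut_def)
      ultimately show "(\<lambda>k. d k x) \<longlonglongrightarrow> g' x" by simp
    qed
    show "integrable lebesgue (\<lambda>x. (2 * real n + 1)\<^sup>2 * indicator {-(real n + 1)..real n + 1} x)"
      by (intro integrable_mult_right integrable_indicator_Icc)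
    fix k x
    show "(cmod (d k x - g' x))\<^sup>2 \<le> (2 * real n + 1)\<^sup>2 * indicator {-(real n + 1)..real n + 1} x"
    proof (cases "x \<in> {-(real n + 1)..real n + 1}")
      case True
      have "cmod (d k x) = cut x * cmod (T (h k x))" using cut01(1)[of x] by (simp add: d_def norm_mult)
      also have "\<dots> \<le> 1 * (real n + 1)" using cut01[of x] Tb[of "h k x"] by (intro mult_mono) auto
      finally have "cmod (d k x - g' x) \<le> 2 * real n + 1"
        by (intro order_trans[OF norm_triangle_ineq4 order_trans[OF add_mono[OF _ g'(2)]]]) simp_all
      then show ?thesis using True by (simp add: power_mono)
    next
      case False
      then have "\<bar>x\<bar> > real n + 1" by auto
      then show ?thesis using d0[of x k] g'(3)[of x] False by simp
    qed
  qed
  from order_tendstoD(2)[OF this, of "e / 2"] e obtain k where k: "L2_norm (\<lambda>x. d k x - g' x) < e / 2"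
    by (auto simp: eventually_sequentially)
  have dL: "d k \<in> L2_real" by (rule continuous_compact_support_L2[OF dc d0])
  have "(\<lambda>x. g' x - g x) \<in> L2_real"
  proof -
    have "g' \<in> L2_real"
    proof (rule L2_real_bound[OF g'(1)])
      show "integrable lebesgue (\<lambda>x. (real n)\<^sup>2 * indicator {-real n..real n} x)" by (intro integrable_mult_right integrable_indicator_Icc)
      show "(cmod (g' x))\<^sup>2 \<le> (real n)\<^sup>2 * indicator {-real n..real n} x" for x
        using power_mono[OF g'(2)[of x]] g'(3)[of x] by (cases "x \<in> {-real n..real n}") auto
    qed
    then show ?thesis by (intro L2_real_diff g)
  qed
  moreover have "(\<lambda>x. d k x - g' x) \<in> L2_real"
    using L2_real_diff[OF L2_real_diff[OF dL g] calculation] by simp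
  ultimately have "L2_norm (\<lambda>x. (d k x - g' x) + (g' x - g x)) \<le> L2_norm (\<lambda>x. d k x - g' x) + L2_norm (\<lambda>x. g' x - g x)"
    by (intro L2_norm_triangle)
  then have "L2_norm (\<lambda>x. d k x - g x) < e" using k g'(4) by simp
  then have "L2_norm (\<lambda>x. g x - d k x) < e" by (simp only: L2_norm_diff_commute)
  then show ?thesis using that[OF dc d0] by blast
qed

lemma sqrt_sum_inner_triangle:
  assumes "finite F" "f \<in> L2_real" "g \<in> L2_real" "\<And>i. i \<in> F \<Longrightarrow> e i \<in> L2_real"
  shows "sqrt (\<Sum>i\<in>F. (cmod (L2_inner f (e i)))\<^sup>2) \<le> sqrt (\<Sum>i\<in>F. (cmod (L2_inner g (e i)))\<^sup>2)
     + sqrt (\<Sum>i\<in>F. (cmod (L2_inner (\<lambda>x. f x - g x) (e i)))\<^sup>2)"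
proof -
  have split: "L2_inner f (e i) = L2_inner g (e i) + L2_inner (\<lambda>x. f x - g x) (e i)" if "i \<in> F" for i
    using L2_inner_add_left[OF assms(3) L2_real_diff[OF assms(2,3)] assms(4)[OF that]] by simp
  have "sqrt (\<Sum>i\<in>F. (cmod (L2_inner f (e i)))\<^sup>2)
     \<le> sqrt (\<Sum>i\<in>F. (cmod (L2_inner g (e i)) + cmod (L2_inner (\<lambda>x. f x - g x) (e i)))\<^sup>2)"
    by (intro real_sqrt_le_mono sum_mono power_mono) (auto simp: split norm_triangle_ineq)
  also have "\<dots> \<le> sqrt (\<Sum>i\<in>F. (cmod (L2_inner g (e i)))\<^sup>2) + sqrt (\<Sum>i\<in>F. (cmod (L2_inner (\<lambda>x. f x - g x) (e i)))\<^sup>2)"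
    using L2_set_triangle_ineq[of "\<lambda>i. cmod (L2_inner g (e i))" "\<lambda>i. cmod (L2_inner (\<lambda>x. f x - g x) (e i))" F]
    by (simp add: L2_set_def)
  finally show ?thesis .
qed

lemma sum_inner_le:
  assumes "g \<in> L2_real" "\<And>i. i \<in> F \<Longrightarrow> e i \<in> L2_real"
  shows "sqrt (\<Sum>i\<in>F. (cmod (L2_inner g (e i)))\<^sup>2) \<le> sqrt (\<Sum>i\<in>F. (L2_norm (e i))\<^sup>2) * L2_norm g"
proof -
  have "(\<Sum>i\<in>F. (cmod (L2_inner g (e i)))\<^sup>2) \<le> (\<Sum>i\<in>F. (L2_norm g * L2_norm (e i))\<^sup>2)"
    by (intro sum_mono power_mono L2_Cauchy_Schwarz assms) auto
  also have "\<dots> = (\<Sum>i\<in>F. (L2_norm (e i))\<^sup>2) * (L2_norm g)\<^sup>2"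
    by (simp add: power_mult_distrib sum_distrib_left mult.commute)
  finally have "sqrt (\<Sum>i\<in>F. (cmod (L2_inner g (e i)))\<^sup>2) \<le> sqrt ((\<Sum>i\<in>F. (L2_norm (e i))\<^sup>2) * (L2_norm g)\<^sup>2)"
    by (rule real_sqrt_le_mono)
  then show ?thesis by (simp add: real_sqrt_mult L2_norm_nonneg)
qed

text \<open>
  For nonnegative terms it suffices to bound all finite sums from above and to come arbitrarily
  close to the bound with one of them.
\<close>
lemma has_sum_nonnegI:
  fixes f :: "'a \<Rightarrow> real"
  assumes nonneg: "\<And>i. i \<in> I \<Longrightarrow> 0 \<le> f i"
    and upper: "\<And>F. finite F \<Longrightarrow> F \<subseteq> I \<Longrightarrow> sum f F \<le> S"
    and lower: "\<And>e. e > 0 \<Longrightarrow> \<exists>F. finite F \<and> F \<subseteq> I \<and> S - e \<le> sum f F"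
  shows "(f has_sum S) I"
  unfolding has_sum_def
proof (rule tendstoI)
  fix e :: real assume e: "e > 0"
  obtain F0 where F0: "finite F0" "F0 \<subseteq> I" "S - e / 2 \<le> sum f F0" using lower[of "e/2"] e by auto
  show "eventually (\<lambda>F. dist (sum f F) S < e) (finite_subsets_at_top I)"
    unfolding eventually_finite_subsets_at_top
  proof (intro exI conjI allI impI)
    show "finite F0" "F0 \<subseteq> I" by fact+
    fix F assume F: "finite F \<and> F0 \<subseteq> F \<and> F \<subseteq> I"
    then have "sum f F0 \<le> sum f F" by (intro sum_mono2) (use nonneg in auto)
    then show "dist (sum f F) S < e" using upper[of F] F F0(3) e by (auto simp: dist_real_def)
  qed
qed

text \<open>
  The roots of the finite coefficient sums are seminorms. On the dense set they are at most the
  norm, hence everywhere by continuity; so the error made by replacing \<open>g\<close> by a close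
  element of \<open>D\<close> is controlled uniformly in the finite set.
\<close>
lemma Parseval_extend:
  assumes e: "\<And>i. i \<in> I \<Longrightarrow> e i \<in> L2_real"
    and dense: "\<And>g \<epsilon>. g \<in> L2_real \<Longrightarrow> \<epsilon> > 0 \<Longrightarrow> \<exists>d\<in>D. L2_norm (\<lambda>x. g x - d x) < \<epsilon>"
    and D: "\<And>d. d \<in> D \<Longrightarrow> d \<in> L2_real"
    and Pars: "\<And>d. d \<in> D \<Longrightarrow> ((\<lambda>i. (cmod (L2_inner d (e i)))\<^sup>2) has_sum (L2_norm d)\<^sup>2) I"
    and g: "g \<in> L2_real"
  shows "((\<lambda>i. (cmod (L2_inner g (e i)))\<^sup>2) has_sum (L2_norm g)\<^sup>2) I"
proof -
  define N where "N F g = sqrt (\<Sum>i\<in>F. (cmod (L2_inner g (e i)))\<^sup>2)" for F g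
  have N0: "N F g \<ge> 0" for F g by (simp add: N_def sum_nonneg)
  have N2: "(\<Sum>i\<in>F. (cmod (L2_inner g (e i)))\<^sup>2) = (N F g)\<^sup>2" for F g
    by (simp add: N_def sum_nonneg)
  have ND: "N F d \<le> L2_norm d" if "finite F" "F \<subseteq> I" "d \<in> D" for F d
  proof -
    have "(\<Sum>i\<in>F. (cmod (L2_inner d (e i)))\<^sup>2) \<le> (L2_norm d)\<^sup>2"
      by (rule has_sum_mono_neutral[OF has_sum_finite[OF that(1)] Pars[OF that(3)]]) (use that(2) in auto)
    then show ?thesis unfolding N_def by (intro real_le_lsqrt) (auto simp: L2_norm_nonneg sum_nonneg)
  qed
  have NL: "N F g \<le> L2_norm g" if F: "finite F" "F \<subseteq> I" and g: "g \<in> L2_real" for F g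
  proof (rule field_le_epsilon)
    fix \<epsilon> :: real assume \<epsilon>: "\<epsilon> > 0"
    define C where "C = sqrt (\<Sum>i\<in>F. (L2_norm (e i))\<^sup>2)"
    have C: "C \<ge> 0" by (simp add: C_def sum_nonneg)
    have "\<epsilon> / (C + 1) > 0" using \<epsilon> C by simp
    then obtain d where d: "d \<in> D" "L2_norm (\<lambda>x. g x - d x) < \<epsilon> / (C + 1)" using dense[OF g] by blast
    have gd: "(\<lambda>x. g x - d x) \<in> L2_real" by (intro L2_real_diff g D d)
    have eF: "e i \<in> L2_real" if "i \<in> F" for i using e F that by auto
    have "N F g \<le> N F d + N F (\<lambda>x. g x - d x)"
      unfolding N_def by (rule sqrt_sum_inner_triangle[OF F(1) g D[OF d(1)] eF])
    also have "N F (\<lambda>x. g x - d x) \<le> C * L2_norm (\<lambda>x. g x - d x)"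
      unfolding N_def C_def by (rule sum_inner_le[OF gd eF])
    also have "N F d \<le> L2_norm g + L2_norm (\<lambda>x. g x - d x)"
      using ND[OF F d(1)] L2_norm_triangle_diff[OF D[OF d(1)] g] unfolding L2_norm_diff_commute[of d] by linarith
    finally have "N F g \<le> L2_norm g + (C + 1) * L2_norm (\<lambda>x. g x - d x)" by (simp add: algebra_simps)
    also have "(C + 1) * L2_norm (\<lambda>x. g x - d x) \<le> \<epsilon>"
      using d(2) C by (simp add: less_divide_eq mult.commute)
    finally show "N F g \<le> L2_norm g + \<epsilon>" by simp
  qed
  show ?thesis
  proof (rule has_sum_nonnegI)
    fix F assume F: "finite F" "F \<subseteq> I"
    show "(\<Sum>i\<in>F. (cmod (L2_inner g (e i)))\<^sup>2) \<le> (L2_norm g)\<^sup>2"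
      unfolding N2 by (intro power_mono NL F g N0)
  next
    fix \<epsilon> :: real assume \<epsilon>: "\<epsilon> > 0"
    define G where "G = L2_norm g"
    have G: "G \<ge> 0" by (simp add: G_def L2_norm_nonneg)
    define \<eta> where "\<eta> = \<epsilon> / (6 * (G + 1))"
    have \<eta>: "\<eta> > 0" using \<epsilon> G by (simp add: \<eta>_def)
    obtain d where d: "d \<in> D" "L2_norm (\<lambda>x. g x - d x) < \<eta>" using dense[OF g \<eta>] by blast
    have dL: "d \<in> L2_real" by (rule D[OF d(1)])
    obtain F where F: "finite F" "F \<subseteq> I" "(L2_norm d - \<eta>) \<le> N F d"
    proof (cases "L2_norm d \<le> \<eta>")
      case True then show ?thesis using that[of "{}"] by (simp add: N_def)
    next
      case False
      then have "(L2_norm d - \<eta>)\<^sup>2 < (L2_norm d)\<^sup>2" using \<eta> by (intro power_strict_mono) auto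
      then have "eventually (\<lambda>F. (L2_norm d - \<eta>)\<^sup>2 < (\<Sum>i\<in>F. (cmod (L2_inner d (e i)))\<^sup>2)) (finite_subsets_at_top I)"
        using Pars[OF d(1)] unfolding has_sum_def by (rule order_tendstoD(1)[rotated])
      then obtain F where "finite F" "F \<subseteq> I" "(L2_norm d - \<eta>)\<^sup>2 < (\<Sum>i\<in>F. (cmod (L2_inner d (e i)))\<^sup>2)"
        unfolding eventually_finite_subsets_at_top by blast
      moreover from this have "L2_norm d - \<eta> \<le> N F d"
        unfolding N_def by (intro real_le_rsqrt) simp
      ultimately show ?thesis using that by blast
    qed
    have "N F d \<le> N F g + N F (\<lambda>x. d x - g x)"
      unfolding N_def by (rule sqrt_sum_inner_triangle) (use F dL g e in auto)
    moreover have "N F (\<lambda>x. d x - g x) \<le> \<eta>"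
      using NL[OF F(1,2) L2_real_diff[OF dL g]] d(2) unfolding L2_norm_diff_commute[of d] by linarith
    moreover have "G \<le> L2_norm d + \<eta>"
      using L2_norm_triangle_diff[OF g dL] d(2) by (simp add: G_def)
    ultimately have NG: "G - 3 * \<eta> \<le> N F g" using F(3) by linarith
    have "G\<^sup>2 - \<epsilon> \<le> (N F g)\<^sup>2"
    proof -
      have "N F g \<le> G" unfolding G_def by (rule NL[OF F(1,2) g])
      then have "(G - N F g) * (G + N F g) \<le> (3 * \<eta>) * (2 * G)"
        using NG N0[of F g] G by (intro mult_mono) auto
      also have "\<dots> \<le> 6 * \<eta> * (G + 1)" using \<eta> by (simp add: algebra_simps)
      also have "\<dots> = \<epsilon>" using G by (simp add: \<eta>_def field_simps)
      finally show ?thesis by (simp add: power2_eq_square algebra_simps)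
    qed
    then show "\<exists>F. finite F \<and> F \<subseteq> I \<and> (L2_norm g)\<^sup>2 - \<epsilon> \<le> (\<Sum>i\<in>F. (cmod (L2_inner g (e i)))\<^sup>2)"
      using F unfolding N2 G_def by blast
  qed simp
qed

section \<open>Refinement operators and the refinable function\<close>

text \<open>
  On the Fourier side this is multiplication by the mask with coefficients \<open>a\<close>,
  followed by dilation; see \<open>fourier_L1_refine\<close>.
\<close>
definition refine :: "int \<Rightarrow> (int \<Rightarrow> complex) \<Rightarrow> (real \<Rightarrow> complex) \<Rightarrow> real \<Rightarrow> complex" where
  "refine N a w x = 2 * (\<Sum>k\<in>{-N..N}. a k * w (2 * x + of_int k))"

text \<open>
  The synthesis map of the integer shifts is a contraction on finite sequences. The constant is one
  because refinement by a filter bank preserves exactly this bound, and as a family of norm bounds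
  the property is convex and closed.
\<close>
definition shift_contractive :: "(real \<Rightarrow> complex) \<Rightarrow> bool" where
  "shift_contractive w \<longleftrightarrow> (\<forall>F c. finite F \<longrightarrow>
     (L2_norm (\<lambda>x. \<Sum>k\<in>F. c k * w (x + of_int k)))\<^sup>2 \<le> (\<Sum>k\<in>F. (cmod (c k))\<^sup>2))"

lemma L2_real_shift: "w \<in> L2_real \<Longrightarrow> (\<lambda>x. w (x + t)) \<in> L2_real"
  using L2_real_affine[of w 1 t] by simp

lemma L2_norm_shift: "L2_norm (\<lambda>x. w (x + t)) = L2_norm w"
proof -
  have "(L2_norm (\<lambda>x. w (x + t)))\<^sup>2 = (L2_norm w)\<^sup>2" using L2_norm_affine[of 1 w t] by simp
  then show ?thesis by (simp add: L2_norm_nonneg)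
qed

lemma L2_real_refine: "w \<in> L2_real \<Longrightarrow> refine N a w \<in> L2_real"
  unfolding refine_def[abs_def] by (intro L2_real_cmult L2_real_sum L2_real_affine) simp_all

lemma refine_sum:
  assumes "finite I"
  shows "refine N a (\<lambda>x. \<Sum>i\<in>I. p i * w i x) x = (\<Sum>i\<in>I. p i * refine N a (w i) x)"
proof -
  have "(\<Sum>k\<in>{-N..N}. a k * (\<Sum>i\<in>I. p i * w i (2 * x + of_int k)))
      = (\<Sum>i\<in>I. p i * (\<Sum>k\<in>{-N..N}. a k * w i (2 * x + of_int k)))"
    unfolding sum_distrib_left by (subst sum.swap) (simp add: mult_ac)
  then show ?thesis by (simp add: refine_def sum_distrib_left mult_ac)
qed

lemma refine_diff: "refine N a (\<lambda>x. u x - v x) x = refine N a u x - refine N a v x"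
  by (simp add: refine_def right_diff_distrib sum_subtractf)

lemma L2_norm_refine_le:
  assumes "w \<in> L2_real"
  shows "L2_norm (refine N a w) \<le> (2 * (\<Sum>k\<in>{-N..N}. cmod (a k))) * L2_norm w"
proof -
  have half: "L2_norm (\<lambda>x. w (2 * x + t)) \<le> L2_norm w" for t
  proof (rule power2_le_imp_le)
    show "(L2_norm (\<lambda>x. w (2 * x + t)))\<^sup>2 \<le> (L2_norm w)\<^sup>2" using L2_norm_affine[of 2 w t] zero_le_power2[of "L2_norm w"]
      by (simp only: abs_numeral)
  qed (rule L2_norm_nonneg)
  have "L2_norm (refine N a w) = 2 * L2_norm (\<lambda>x. \<Sum>k\<in>{-N..N}. a k * w (2 * x + of_int k))"
    unfolding refine_def[abs_def] by (subst L2_norm_cmult) simp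
  also have "\<dots> \<le> 2 * (\<Sum>k\<in>{-N..N}. L2_norm (\<lambda>x. a k * w (2 * x + of_int k)))"
    by (intro mult_left_mono L2_norm_sum_le L2_real_cmult L2_real_affine assms) simp_all
  also have "\<dots> \<le> 2 * (\<Sum>k\<in>{-N..N}. cmod (a k) * L2_norm w)"
    unfolding L2_norm_cmult by (intro mult_left_mono sum_mono half) simp_all
  finally show ?thesis by (simp add: sum_distrib_left mult_ac)
qed

text \<open>
  From \<open>\<bar>w\<bar> \<le> 1 + \<bar>w\<bar>\<^sup>2\<close> on the support.
\<close>
lemma L2_compact_support_integrable:
  assumes w: "w \<in> L2_real" and s: "\<And>x. \<bar>x\<bar> > R \<Longrightarrow> w x = 0"
  shows "integrable lebesgue w"
proof (rule Bochner_Integration.integrable_bound)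
  show "integrable lebesgue (\<lambda>x. indicator {-R..R} x + (cmod (w x))\<^sup>2 :: real)"
    by (intro Bochner_Integration.integrable_add integrable_indicator_Icc L2_realD w)
  show "w \<in> borel_measurable lebesgue" by (rule L2_realD(1)[OF w])
  have "cmod (w x) \<le> indicator {-R..R} x + (cmod (w x))\<^sup>2" for x
  proof (cases "x \<in> {-R..R}")
    case True
    have "0 \<le> (cmod (w x) - 1/2)\<^sup>2" by simp
    then have "cmod (w x) \<le> 1 + (cmod (w x))\<^sup>2" by (simp add: power2_diff power_divide)
    then show ?thesis using True by simp
  next
    case False
    then have "\<bar>x\<bar> > R" by auto
    then show ?thesis using s by simp
  qed
  then show "AE x in lebesgue. norm (w x) \<le> norm (indicator {-R..R} x + (cmod (w x))\<^sup>2 :: real)"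
    by (intro AE_I2) (auto intro: order_trans[OF _ abs_ge_self])
qed

lemma L2_real_indicator:
  assumes "integrable lebesgue (indicator S :: real \<Rightarrow> real)"
  shows "(\<lambda>x. complex_of_real (indicator S x)) \<in> L2_real"
proof (rule L2_real_bound[OF _ assms])
  show "(\<lambda>x. complex_of_real (indicator S x)) \<in> borel_measurable lebesgue"
    by (rule borel_measurable_continuous_on[of complex_of_real, OF continuous_on_of_real[OF continuous_on_id]
          borel_measurable_integrable[OF assms]])
qed (simp add: indicator_def)

lemma integral_norm_le_L2:
  assumes w: "w \<in> L2_real" and s: "\<And>x. \<bar>x\<bar> > R \<Longrightarrow> w x = 0" and R: "R \<ge> 0"
  shows "cmod (\<integral>x. w x \<partial>lebesgue) \<le> sqrt (2 * R) * L2_norm w"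
proof -
  define b where "b x = complex_of_real (indicator {-R..R} x)" for x
  have bsq: "(cmod (b x))\<^sup>2 = indicator {-R..R} x" for x by (simp add: b_def indicator_def)
  have bL: "b \<in> L2_real" unfolding b_def[abs_def] by (rule L2_real_indicator[OF integrable_indicator_Icc])
  have "(L2_norm b)\<^sup>2 = 2 * R"
    unfolding L2_norm_sq bsq using R by simp
  then have bn: "L2_norm b = sqrt (2 * R)" using L2_norm_nonneg[of b] by (metis real_sqrt_unique)
  have "w x * cnj (b x) = w x" for x
    using s[of x] by (cases "x \<in> {-R..R}") (auto simp: b_def)
  then have "(\<integral>x. w x \<partial>lebesgue) = L2_inner w b" by (simp only: L2_inner_def)
  then show ?thesis using L2_Cauchy_Schwarz[OF w bL] bn by (simp add: mult.commute)
qed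

lemma shift_contractive_norm_le:
  assumes "shift_contractive w" shows "L2_norm w \<le> 1"
proof -
  have "(L2_norm w)\<^sup>2 \<le> 1\<^sup>2"
    using assms[unfolded shift_contractive_def, rule_format, of "{0}" "\<lambda>_. 1"] by simp
  then show ?thesis by (rule power2_le_imp_le) simp
qed

lemma shift_contractive_convex:
  assumes I: "finite I" and p: "\<And>i. i \<in> I \<Longrightarrow> 0 \<le> p i" "(\<Sum>i\<in>I. p i) = 1"
    and w: "\<And>i. i \<in> I \<Longrightarrow> w i \<in> L2_real" "\<And>i. i \<in> I \<Longrightarrow> shift_contractive (w i)"
  shows "shift_contractive (\<lambda>x. \<Sum>i\<in>I. of_real (p i) * w i x)"
  unfolding shift_contractive_def
proof (intro allI impI)
  fix F :: "int set" and c :: "int \<Rightarrow> complex" assume F: "finite F"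
  define C where "C = (\<Sum>k\<in>F. (cmod (c k))\<^sup>2)"
  have C: "C \<ge> 0" by (simp add: C_def sum_nonneg)
  have L: "(\<lambda>x. \<Sum>k\<in>F. c k * w i (x + of_int k)) \<in> L2_real" if "i \<in> I" for i
    by (intro L2_real_sum L2_real_cmult L2_real_shift w that)
  have le: "L2_norm (\<lambda>x. \<Sum>k\<in>F. c k * w i (x + of_int k)) \<le> sqrt C" if "i \<in> I" for i
    by (rule real_le_rsqrt) (use w(2)[OF that] F in \<open>simp add: shift_contractive_def C_def\<close>)
  have "(\<lambda>x. \<Sum>k\<in>F. c k * (\<Sum>i\<in>I. of_real (p i) * w i (x + of_int k)))
      = (\<lambda>x. \<Sum>i\<in>I. of_real (p i) * (\<Sum>k\<in>F. c k * w i (x + of_int k)))"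
    unfolding sum_distrib_left by (subst sum.swap) (simp add: mult_ac)
  then have "L2_norm (\<lambda>x. \<Sum>k\<in>F. c k * (\<Sum>i\<in>I. of_real (p i) * w i (x + of_int k)))
      \<le> (\<Sum>i\<in>I. L2_norm (\<lambda>x. of_real (p i) * (\<Sum>k\<in>F. c k * w i (x + of_int k))))"
    by (simp only:) (intro L2_norm_sum_le L2_real_cmult L)
  also have "\<dots> \<le> (\<Sum>i\<in>I. p i * sqrt C)"
    unfolding L2_norm_cmult using p by (intro sum_mono) (auto intro!: mult_left_mono le)
  also have "\<dots> = sqrt C" unfolding sum_distrib_right[symmetric] p by simp
  finally have "(L2_norm (\<lambda>x. \<Sum>k\<in>F. c k * (\<Sum>i\<in>I. of_real (p i) * w i (x + of_int k))))\<^sup>2 \<le> (sqrt C)\<^sup>2"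
    by (rule power_mono) (rule L2_norm_nonneg)
  then show "(L2_norm (\<lambda>x. \<Sum>k\<in>F. c k * (\<Sum>i\<in>I. of_real (p i) * w i (x + of_int k))))\<^sup>2
      \<le> (\<Sum>k\<in>F. (cmod (c k))\<^sup>2)" using C by (simp add: C_def)
qed

lemma shift_contractive_limit:
  assumes w: "\<And>n. w n \<in> L2_real" "\<And>n. shift_contractive (w n)" and u: "u \<in> L2_real"
    and lim: "(\<lambda>n. L2_norm (\<lambda>x. w n x - u x)) \<longlonglongrightarrow> 0"
  shows "shift_contractive u"
  unfolding shift_contractive_def
proof (intro allI impI)
  fix F :: "int set" and c :: "int \<Rightarrow> complex" assume F: "finite F"
  define C where "C = (\<Sum>k\<in>F. (cmod (c k))\<^sup>2)"
  have C: "C \<ge> 0" by (simp add: C_def sum_nonneg)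
  define U where "U = (\<lambda>x. \<Sum>k\<in>F. c k * u (x + of_int k))"
  define W where "W n = (\<lambda>x. \<Sum>k\<in>F. c k * w n (x + of_int k))" for n
  have UL: "U \<in> L2_real" unfolding U_def by (intro L2_real_sum L2_real_cmult L2_real_shift u)
  have WL: "W n \<in> L2_real" for n unfolding W_def by (intro L2_real_sum L2_real_cmult L2_real_shift w)
  have Wn: "L2_norm (W n) \<le> sqrt C" for n
    by (rule real_le_rsqrt) (use w(2)[of n] F in \<open>simp add: shift_contractive_def C_def W_def\<close>)
  have diff: "L2_norm (\<lambda>x. U x - W n x) \<le> (\<Sum>k\<in>F. cmod (c k)) * L2_norm (\<lambda>x. w n x - u x)" for n
  proof -
    have "(\<lambda>x. U x - W n x) = (\<lambda>x. \<Sum>k\<in>F. c k * (u (x + of_int k) - w n (x + of_int k)))"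
      by (simp add: U_def W_def right_diff_distrib sum_subtractf)
    then have "L2_norm (\<lambda>x. U x - W n x) \<le> (\<Sum>k\<in>F. L2_norm (\<lambda>x. c k * (u (x + of_int k) - w n (x + of_int k))))"
      by (simp only:) (intro L2_norm_sum_le L2_real_cmult L2_real_diff L2_real_shift u w)
    also have "\<dots> = (\<Sum>k\<in>F. cmod (c k) * L2_norm (\<lambda>x. w n x - u x))"
      unfolding L2_norm_cmult L2_norm_diff_commute[of "\<lambda>x. u (x + _)"]
      using L2_norm_shift[of "\<lambda>x. w n x - u x"] by simp
    finally show ?thesis by (simp add: sum_distrib_right)
  qed
  have "L2_norm U \<le> sqrt C"
  proof (rule LIMSEQ_le[OF tendsto_const])
    show "(\<lambda>n. sqrt C + (\<Sum>k\<in>F. cmod (c k)) * L2_norm (\<lambda>x. w n x - u x)) \<longlonglongrightarrow> sqrt C"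
      using tendsto_add[OF tendsto_const tendsto_mult[OF tendsto_const lim], of "sqrt C" "\<Sum>k\<in>F. cmod (c k)"] by simp
    show "\<exists>M. \<forall>n\<ge>M. L2_norm U \<le> sqrt C + (\<Sum>k\<in>F. cmod (c k)) * L2_norm (\<lambda>x. w n x - u x)"
    proof (intro exI allI impI)
      fix n
      show "L2_norm U \<le> sqrt C + (\<Sum>k\<in>F. cmod (c k)) * L2_norm (\<lambda>x. w n x - u x)"
        using L2_norm_triangle_diff[OF UL WL[of n]] Wn[of n] diff[of n] by linarith
    qed
  qed
  then have "(L2_norm U)\<^sup>2 \<le> (sqrt C)\<^sup>2" by (rule power_mono) (rule L2_norm_nonneg)
  then show "(L2_norm (\<lambda>x. \<Sum>k\<in>F. c k * u (x + of_int k)))\<^sup>2 \<le> (\<Sum>k\<in>F. (cmod (c k))\<^sup>2)"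
    using C by (simp add: C_def U_def)
qed

definition unit_box :: "real \<Rightarrow> complex" where "unit_box x = of_real (indicator {0..<1} x)"

lemma sum_swap3: "(\<Sum>r\<in>R. \<Sum>l\<in>L. \<Sum>m\<in>G. f r l m) = (\<Sum>m\<in>G. \<Sum>r\<in>R. \<Sum>l\<in>L. f r l m)"
proof -
  have "(\<Sum>r\<in>R. \<Sum>l\<in>L. \<Sum>m\<in>G. f r l m) = (\<Sum>r\<in>R. \<Sum>m\<in>G. \<Sum>l\<in>L. f r l m)"
    by (intro sum.cong refl sum.swap)
  then show ?thesis using sum.swap[of "\<lambda>r m. \<Sum>l\<in>L. f r l m" G R] by simp
qed

lemma unit_box_sq: "(cmod (unit_box x))\<^sup>2 = indicator {0..<1} x"
  by (simp add: unit_box_def indicator_def)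

lemma integrable_indicator_Ico: "integrable lebesgue (indicator {a..<b::real} :: real \<Rightarrow> real)"
proof (rule Bochner_Integration.integrable_bound[OF integrable_indicator_Icc[of a b]])
  show "(indicator {a..<b} :: real \<Rightarrow> real) \<in> borel_measurable lebesgue"
    by (rule borel_measurable_indicator) simp
qed (auto simp: indicator_def)

lemma integral_unit_box: "(\<integral>x. indicator {0..<1::real} x \<partial>lebesgue) = (1::real)"
  by simp

lemma unit_box_L2: "unit_box \<in> L2_real"
  unfolding unit_box_def[abs_def] by (rule L2_real_indicator[OF integrable_indicator_Ico])

text \<open>
  At each point exactly one integer shift of the unit box is nonzero.
\<close>
lemma unit_box_shift_sum_norm:
  assumes F: "finite F"
  shows "(L2_norm (\<lambda>x. \<Sum>k\<in>F. c k * unit_box (x + of_int k)))\<^sup>2 = (\<Sum>k\<in>F. (cmod (c k))\<^sup>2)"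
proof -
  have one: "(cmod (\<Sum>k\<in>F. c k * unit_box (x + of_int k)))\<^sup>2
      = (\<Sum>k\<in>F. (cmod (c k))\<^sup>2 * (cmod (unit_box (x + of_int k)))\<^sup>2)" for x
  proof -
    define k0 where "k0 = - \<lfloor>x\<rfloor>"
    have ub: "unit_box (x + of_int k) = (if k = k0 then 1 else 0)" for k
    proof -
      have "(0 \<le> x + of_int k \<and> x + of_int k < 1) = (k = k0)"
      proof -
        have "(k = k0) = (\<lfloor>x\<rfloor> = - k)" unfolding k0_def by auto
        then show ?thesis unfolding floor_eq_iff by auto
      qed
      then show ?thesis by (auto simp: unit_box_def indicator_def)
    qed
    show ?thesis unfolding ub using F by (cases "k0 \<in> F") (simp_all add: if_distrib[of "(*) _"] sum.delta if_distrib[of cmod] if_distrib[of "\<lambda>x. x\<^sup>2"] cong: if_cong)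
  qed
  have "(L2_norm (\<lambda>x. \<Sum>k\<in>F. c k * unit_box (x + of_int k)))\<^sup>2
     = (\<Sum>k\<in>F. (cmod (c k))\<^sup>2 * (L2_norm (\<lambda>x. unit_box (x + of_int k)))\<^sup>2)"
    unfolding L2_norm_sq one
    by (subst Bochner_Integration.integral_sum) (use L2_realD(2)[OF L2_real_shift[OF unit_box_L2]] in auto)
  moreover have "(L2_norm (\<lambda>x. unit_box (x + t)))\<^sup>2 = 1" for t
    unfolding L2_norm_shift unfolding L2_norm_sq unit_box_sq by (rule integral_unit_box)
  ultimately show ?thesis by simp
qed

lemma unit_box_shift_contractive: "shift_contractive unit_box"
  by (simp add: shift_contractive_def unit_box_shift_sum_norm)

text \<open>
  Coefficients of masks that satisfy the unitary extension principle, in the form of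
  \<open>uep_coefficients\<close>, with the low-pass condition \<open>m 0 0 = 1\<close>. All masks
  are indexed by the common range \<open>{-N..N}\<close>.
\<close>
locale filter_bank =
  fixes N :: int and q :: nat and a :: "nat \<Rightarrow> int \<Rightarrow> complex"
  assumes N1: "N \<ge> 1"
    and supp: "\<And>r k. r \<le> q \<Longrightarrow> k \<notin> {-N..N} \<Longrightarrow> a r k = 0"
    and rec: "\<And>d p. 2 * (\<Sum>r\<le>q. \<Sum>n\<in>{n\<in>{-N..N}. even n = p}. a r n * cnj (a r (n + d))) = (if d = 0 then 1 else 0)"
    and low: "(\<Sum>k\<in>{-N..N}. a 0 k) = 1"
begin

text \<open>
  The sum over \<open>l\<close> only sees the coefficients whose index has the parity of
  \<open>m'\<close>, which is why the identity is needed for each parity separately.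
\<close>
lemma reconstruction_kernel:
  assumes L: "finite L" "\<And>l. m' - 2 * l \<in> {-N..N} \<Longrightarrow> l \<in> L"
  shows "2 * (\<Sum>r\<le>q. \<Sum>l\<in>L. a r (m' - 2 * l) * cnj (a r (m - 2 * l))) = (if m = m' then 1 else 0)"
proof -
  define g where "g r n = a r n * cnj (a r (n + (m - m')))" for r n
  have "(\<Sum>l\<in>L. a r (m' - 2 * l) * cnj (a r (m - 2 * l))) = (\<Sum>n\<in>{n\<in>{-N..N}. even n = even m'}. g r n)"
    if r: "r \<le> q" for r
  proof -
    have "(\<Sum>l\<in>L. a r (m' - 2 * l) * cnj (a r (m - 2 * l))) = (\<Sum>l\<in>L. g r (m' - 2 * l))"
      by (simp add: g_def algebra_simps)
    also have "\<dots> = (\<Sum>l\<in>{l\<in>L. m' - 2 * l \<in> {-N..N}}. g r (m' - 2 * l))"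
      by (rule sum.mono_neutral_right) (use L supp[OF r] in \<open>auto simp: g_def\<close>)
    also have "\<dots> = (\<Sum>n\<in>{n\<in>{-N..N}. even n = even m'}. g r n)"
    proof (rule sum.reindex_bij_witness[where j = "\<lambda>l. m' - 2 * l" and i = "\<lambda>n. (m' - n) div 2"])
      fix n assume n: "n \<in> {n\<in>{-N..N}. even n = even m'}"
      then have ev: "2 * ((m' - n) div 2) = m' - n" by (simp add: even_diff_iff)
      then show "m' - 2 * ((m' - n) div 2) = n" by simp
      show "(m' - n) div 2 \<in> {l\<in>L. m' - 2 * l \<in> {-N..N}}"
        using ev n L(2)[of "(m' - n) div 2"] by auto
    qed auto
    finally show ?thesis .
  qed
  then have "2 * (\<Sum>r\<le>q. \<Sum>l\<in>L. a r (m' - 2 * l) * cnj (a r (m - 2 * l)))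
      = 2 * (\<Sum>r\<le>q. \<Sum>n\<in>{n\<in>{-N..N}. even n = even m'}. g r n)" by simp
  also have "\<dots> = (if m = m' then 1 else 0)" unfolding g_def using rec[where d = "m - m'" and p = "even m'"] by (simp only: right_minus_eq)
  finally show ?thesis .
qed

text \<open>
  Perfect reconstruction: expanding the squares leaves the kernel of
  \<open>reconstruction_kernel\<close>, which is the identity.
\<close>
lemma analysis_isometry:
  assumes G: "finite G" and L: "finite L" "\<And>m l. m \<in> G \<Longrightarrow> m - 2 * l \<in> {-N..N} \<Longrightarrow> l \<in> L"
  shows "(\<Sum>r\<le>q. \<Sum>l\<in>L. 2 * (cmod (\<Sum>m\<in>G. cnj (a r (m - 2 * l)) * b m))\<^sup>2) = (\<Sum>m\<in>G. (cmod (b m))\<^sup>2)"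
proof -
  define A where "A r l m = cnj (a r (m - 2 * l))" for r l m
  have "complex_of_real (\<Sum>r\<le>q. \<Sum>l\<in>L. 2 * (cmod (\<Sum>m\<in>G. A r l m * b m))\<^sup>2)
      = (\<Sum>r\<le>q. \<Sum>l\<in>L. 2 * (\<Sum>m\<in>G. \<Sum>m'\<in>G. (b m * cnj (b m')) * (cnj (A r l m') * A r l m)))"
    unfolding of_real_sum of_real_mult complex_norm_square cnj_sum sum_product
    by (simp add: mult_ac)
  also have "\<dots> = (\<Sum>m\<in>G. \<Sum>m'\<in>G. (b m * cnj (b m')) * (2 * (\<Sum>r\<le>q. \<Sum>l\<in>L. cnj (A r l m') * A r l m)))"
  proof -
    have "(\<Sum>r\<le>q. \<Sum>l\<in>L. 2 * (\<Sum>m\<in>G. \<Sum>m'\<in>G. (b m * cnj (b m')) * (cnj (A r l m') * A r l m)))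
       = (\<Sum>r\<le>q. \<Sum>l\<in>L. \<Sum>m\<in>G. \<Sum>m'\<in>G. 2 * ((b m * cnj (b m')) * (cnj (A r l m') * A r l m)))"
      by (simp only: sum_distrib_left)
    also have "\<dots> = (\<Sum>m\<in>G. \<Sum>r\<le>q. \<Sum>l\<in>L. \<Sum>m'\<in>G. 2 * ((b m * cnj (b m')) * (cnj (A r l m') * A r l m)))"
      by (rule sum_swap3)
    also have "\<dots> = (\<Sum>m\<in>G. \<Sum>m'\<in>G. \<Sum>r\<le>q. \<Sum>l\<in>L. 2 * ((b m * cnj (b m')) * (cnj (A r l m') * A r l m)))"
      by (intro sum.cong refl sum_swap3)
    also have "\<dots> = (\<Sum>m\<in>G. \<Sum>m'\<in>G. (b m * cnj (b m')) * (2 * (\<Sum>r\<le>q. \<Sum>l\<in>L. cnj (A r l m') * A r l m)))"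
      unfolding sum_distrib_left by (intro sum.cong refl mult.left_commute)
    finally show ?thesis .
  qed
  also have "\<dots> = (\<Sum>m\<in>G. \<Sum>m'\<in>G. (b m * cnj (b m')) * (if m = m' then 1 else 0))"
  proof (intro sum.cong refl arg_cong2[where f = "(*)"])
    fix m m' assume "m' \<in> G"
    then show "2 * (\<Sum>r\<le>q. \<Sum>l\<in>L. cnj (A r l m') * A r l m) = (if m = m' then 1 else 0)"
      unfolding A_def complex_cnj_cnj by (intro reconstruction_kernel L)
  qed
  also have "\<dots> = (\<Sum>m\<in>G. b m * cnj (b m))"
    using G by (intro sum.cong refl) (simp add: if_distrib[of "(*) _"] cong: if_cong)
  also have "\<dots> = complex_of_real (\<Sum>m\<in>G. (cmod (b m))\<^sup>2)"
    unfolding of_real_sum complex_norm_square ..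
  finally show ?thesis unfolding A_def by (simp only: of_real_eq_iff)
qed

text \<open>
  Synthesis with one filter is the adjoint of one channel of the isometry
  \<open>analysis_isometry\<close>, hence a contraction. For finite sums this is the Cauchy-Schwarz
  inequality \<open>D\<^sup>2 \<le> C * (D / 2)\<close>.
\<close>
lemma synthesis_contraction:
  assumes F: "finite F" and G: "finite G"
  shows "(\<Sum>m\<in>G. 2 * (cmod (\<Sum>l\<in>F. a 0 (m - 2 * l) * c l))\<^sup>2) \<le> (\<Sum>l\<in>F. (cmod (c l))\<^sup>2)"
proof -
  define d where "d m = (\<Sum>l\<in>F. a 0 (m - 2 * l) * c l)" for m
  define S where "S l = (\<Sum>m\<in>G. cnj (a 0 (m - 2 * l)) * d m)" for l
  (* Any l with m - 2 * l in {-N..N} lies between -(\<bar>m\<bar> + N) and \<bar>m\<bar> + N. *)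
  define L where "L = F \<union> (\<Union>m\<in>G. {-(\<bar>m\<bar> + N)..\<bar>m\<bar> + N})"
  define D where "D = (\<Sum>m\<in>G. (cmod (d m))\<^sup>2)"
  define C where "C = (\<Sum>l\<in>F. (cmod (c l))\<^sup>2)"
  have D0: "D \<ge> 0" "C \<ge> 0" by (auto simp: D_def C_def sum_nonneg)
  have Lf: "finite L" using F G by (simp add: L_def)
  have Ll: "l \<in> L" if "m \<in> G" "m - 2 * l \<in> {-N..N}" for m l
    using that unfolding L_def by (intro UnI2 UN_I[OF that(1)]) auto
  have "(\<Sum>l\<in>F. 2 * (cmod (S l))\<^sup>2) \<le> (\<Sum>l\<in>L. 2 * (cmod (S l))\<^sup>2)"
    by (rule sum_mono2) (use Lf in \<open>auto simp: L_def\<close>)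
  also have "\<dots> \<le> (\<Sum>r\<le>q. \<Sum>l\<in>L. 2 * (cmod (\<Sum>m\<in>G. cnj (a r (m - 2 * l)) * d m))\<^sup>2)"
    unfolding S_def
    by (rule member_le_sum[of 0 "{..q}" "\<lambda>r. \<Sum>l\<in>L. 2 * (cmod (\<Sum>m\<in>G. cnj (a r (m - 2 * l)) * d m))\<^sup>2"])
       (auto intro!: sum_nonneg)
  also have "\<dots> = D" unfolding D_def by (rule analysis_isometry[OF G Lf Ll])
  finally have SD: "2 * (\<Sum>l\<in>F. (cmod (S l))\<^sup>2) \<le> D" by (simp add: sum_distrib_left)
  have "complex_of_real D = (\<Sum>m\<in>G. \<Sum>l\<in>F. (a 0 (m - 2 * l) * c l) * cnj (d m))"
    unfolding D_def of_real_sum complex_norm_square by (simp add: d_def sum_distrib_right)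
  also have "\<dots> = (\<Sum>l\<in>F. c l * cnj (S l))"
    unfolding S_def by (subst sum.swap) (simp add: sum_distrib_left mult_ac)
  finally have "D = cmod (\<Sum>l\<in>F. c l * cnj (S l))" using D0 by (metis norm_of_real abs_of_nonneg)
  also have "\<dots> \<le> (\<Sum>l\<in>F. cmod (c l) * cmod (S l))"
    by (rule order_trans[OF norm_sum]) (simp add: norm_mult)
  finally have "D\<^sup>2 \<le> (\<Sum>l\<in>F. cmod (c l) * cmod (S l))\<^sup>2" using D0 by (intro power_mono)
  also have "\<dots> \<le> C * (\<Sum>l\<in>F. (cmod (S l))\<^sup>2)" unfolding C_def by (rule Cauchy_Schwarz_ineq_sum)
  also have "\<dots> \<le> C * (D / 2)" using SD D0 by (intro mult_left_mono) auto
  finally have DD: "D * D \<le> C / 2 * D" by (simp add: power2_eq_square)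
  have "2 * D \<le> C"
  proof (cases "D = 0")
    case False
    then have "D \<le> C / 2" using DD D0 by (metis mult_le_cancel_right order_le_less)
    then show ?thesis by simp
  qed (use D0 in simp)
  then show ?thesis unfolding D_def C_def d_def by (simp add: sum_distrib_left)
qed

abbreviation "T \<equiv> refine N (a 0)"

lemma refine_reindex:
  assumes r: "r \<le> q" and G: "finite G" "{2 * l - N..2 * l + N} \<subseteq> G"
  shows "(\<Sum>k\<in>{-N..N}. a r k * g (2 * l + k)) = (\<Sum>m\<in>G. a r (m - 2 * l) * g m)"
proof -
  have "(\<Sum>k\<in>{-N..N}. a r k * g (2 * l + k)) = (\<Sum>m\<in>{2 * l - N..2 * l + N}. a r (m - 2 * l) * g m)"
    by (rule sum.reindex_bij_witness[where j = "\<lambda>k. 2 * l + k" and i = "\<lambda>m. m - 2 * l"]) auto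
  also have "\<dots> = (\<Sum>m\<in>G. a r (m - 2 * l) * g m)"
    by (rule sum.mono_neutral_left) (use G supp[OF r] in auto)
  finally show ?thesis .
qed

text \<open>
  A combination of shifts of \<open>T w\<close> is a dilated combination of shifts of
  \<open>w\<close>, whose coefficients arise from the given ones by synthesis.
\<close>
lemma shift_contractive_refine:
  assumes w: "w \<in> L2_real" and sc: "shift_contractive w"
  shows "shift_contractive (T w)"
  unfolding shift_contractive_def
proof (intro allI impI)
  fix F :: "int set" and c :: "int \<Rightarrow> complex" assume F: "finite F"
  define G where "G = (\<Union>l\<in>F. {2 * l - N..2 * l + N})"
  have G: "finite G" using F by (simp add: G_def)
  define d where "d m = 2 * (\<Sum>l\<in>F. a 0 (m - 2 * l) * c l)" for m
  define W where "W = (\<lambda>y. \<Sum>m\<in>G. d m * w (y + of_int m))"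
  have eq: "(\<Sum>l\<in>F. c l * T w (x + of_int l)) = W (2 * x + 0)" for x
  proof -
    have "T w (x + of_int l) = 2 * (\<Sum>m\<in>G. a 0 (m - 2 * l) * w (2 * x + of_int m))" if "l \<in> F" for l
      using refine_reindex[of 0 G l "\<lambda>m. w (2 * x + of_int m)"] that G
      by (auto simp: refine_def G_def algebra_simps)
    then have "(\<Sum>l\<in>F. c l * T w (x + of_int l)) = (\<Sum>l\<in>F. \<Sum>m\<in>G. 2 * (a 0 (m - 2 * l) * c l) * w (2 * x + of_int m))"
      by (simp add: sum_distrib_left mult_ac)
    also have "\<dots> = W (2 * x + 0)"
      unfolding W_def d_def by (subst sum.swap) (simp add: sum_distrib_left sum_distrib_right)
    finally show ?thesis .
  qed
  have "(L2_norm (\<lambda>x. \<Sum>l\<in>F. c l * T w (x + of_int l)))\<^sup>2 = (L2_norm W)\<^sup>2 / 2"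
    unfolding eq by (subst L2_norm_affine) simp_all
  also have "\<dots> \<le> (\<Sum>m\<in>G. (cmod (d m))\<^sup>2) / 2"
    using sc G unfolding shift_contractive_def W_def by (simp add: divide_right_mono)
  also have "\<dots> = (\<Sum>m\<in>G. 2 * (cmod (\<Sum>l\<in>F. a 0 (m - 2 * l) * c l))\<^sup>2)"
    by (simp add: d_def norm_mult power_mult_distrib sum_divide_distrib)
  also have "\<dots> \<le> (\<Sum>l\<in>F. (cmod (c l))\<^sup>2)" by (rule synthesis_contraction[OF F G])
  finally show "(L2_norm (\<lambda>x. \<Sum>k\<in>F. c k * T w (x + of_int k)))\<^sup>2 \<le> (\<Sum>k\<in>F. (cmod (c k))\<^sup>2)" .
qed

lemma refine_support:
  assumes "\<And>x. \<bar>x\<bar> > of_int N \<Longrightarrow> w x = 0" "\<bar>x\<bar> > of_int N"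
  shows "refine N b w x = 0"
proof -
  have "w (2 * x + of_int k) = 0" if "k \<in> {-N..N}" for k
  proof (rule assms(1))
    have "\<bar>real_of_int k\<bar> \<le> of_int N" using that by (auto simp: abs_le_iff simp flip: of_int_minus)
    then show "\<bar>2 * x + of_int k\<bar> > of_int N" using assms(2) by linarith
  qed
  then show ?thesis by (simp add: refine_def)
qed

text \<open>
  The low-pass condition compensates the dilation.
\<close>
lemma integral_refine:
  assumes "integrable lebesgue w"
  shows "(\<integral>x. T w x \<partial>lebesgue) = (\<integral>x. w x \<partial>lebesgue)"
proof -
  have i: "integrable lebesgue (\<lambda>x. w (2 * x + t))" for t
    using lebesgue_integrable_real_affine_iff[of 2 w t] assms by (simp add: add.commute)
  have h: "(\<integral>x. w (2 * x + t) \<partial>lebesgue) = (\<integral>x. w x \<partial>lebesgue) / 2" for t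
    using lebesgue_integral_real_affine[of 2 w t] by (simp add: add.commute scaleR_conv_of_real)
  have "(\<integral>x. T w x \<partial>lebesgue) = 2 * (\<Sum>k\<in>{-N..N}. a 0 k * (\<integral>x. w (2 * x + of_int k) \<partial>lebesgue))"
    unfolding refine_def
    by (subst integral_mult_right_zero, subst Bochner_Integration.integral_sum) (use i in auto)
  also have "\<dots> = (\<Sum>k\<in>{-N..N}. a 0 k) * (\<integral>x. w x \<partial>lebesgue)"
    unfolding h by (simp add: sum_distrib_left sum_distrib_right)
  finally show ?thesis using low by simp
qed

text \<open>
  The candidates among which a fixed point of \<open>T\<close> is sought. These sets are convex and
  decrease with \<open>\<delta>\<close>.
\<close>
definition approx_fixed :: "real \<Rightarrow> (real \<Rightarrow> complex) set" where
  "approx_fixed \<delta> = {w \<in> L2_real. (\<forall>x. \<bar>x\<bar> > of_int N \<longrightarrow> w x = 0) \<and> (\<integral>x. w x \<partial>lebesgue) = 1 \<and>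
     shift_contractive w \<and> L2_norm (\<lambda>x. T w x - w x) \<le> \<delta>}"

lemma cascade_iterates:
  shows "(T ^^ i) unit_box \<in> L2_real" "\<bar>x\<bar> > of_int N \<Longrightarrow> (T ^^ i) unit_box x = 0"
    "(\<integral>x. (T ^^ i) unit_box x \<partial>lebesgue) = 1" "shift_contractive ((T ^^ i) unit_box)"
proof -
  have L: "(T ^^ i) unit_box \<in> L2_real" for i by (induction i) (auto intro: unit_box_L2 L2_real_refine)
  have S: "\<bar>x\<bar> > of_int N \<longrightarrow> (T ^^ i) unit_box x = 0" for i x
  proof (induction i arbitrary: x)
    case 0
    have "1 \<le> real_of_int N" using N1 by simp
    then show ?case by (auto simp: unit_box_def indicator_def)
  qed (auto intro: refine_support)
  show "(T ^^ i) unit_box \<in> L2_real" "\<bar>x\<bar> > of_int N \<Longrightarrow> (T ^^ i) unit_box x = 0" using L S by auto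
  show "shift_contractive ((T ^^ i) unit_box)"
    by (induction i) (auto intro: unit_box_shift_contractive shift_contractive_refine L)
  show "(\<integral>x. (T ^^ i) unit_box x \<partial>lebesgue) = 1"
  proof (induction i)
    case 0
    then show ?case unfolding unit_box_def funpow_0 integral_complex_of_real integral_unit_box by simp
  next
    case (Suc i)
    have "integrable lebesgue ((T ^^ i) unit_box)"
      by (rule L2_compact_support_integrable[OF L]) (use S in blast)
    then show ?case using Suc by (simp add: integral_refine)
  qed
qed

lemma approx_fixed_convex:
  assumes I: "finite I" and p: "\<And>i. i \<in> I \<Longrightarrow> 0 \<le> p i" "(\<Sum>i\<in>I. p i) = 1"
    and w: "\<And>i. i \<in> I \<Longrightarrow> w i \<in> L2_real" "\<And>i x. i \<in> I \<Longrightarrow> \<bar>x\<bar> > of_int N \<Longrightarrow> w i x = 0"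
      "\<And>i. i \<in> I \<Longrightarrow> (\<integral>x. w i x \<partial>lebesgue) = 1" "\<And>i. i \<in> I \<Longrightarrow> shift_contractive (w i)"
    and T: "L2_norm (\<lambda>x. T (\<lambda>x. \<Sum>i\<in>I. of_real (p i) * w i x) x - (\<Sum>i\<in>I. of_real (p i) * w i x)) \<le> \<delta>"
  shows "(\<lambda>x. \<Sum>i\<in>I. of_real (p i) * w i x) \<in> approx_fixed \<delta>"
  unfolding approx_fixed_def
proof (intro CollectI conjI allI impI)
  show "(\<lambda>x. \<Sum>i\<in>I. of_real (p i) * w i x) \<in> L2_real" by (intro L2_real_sum L2_real_cmult w)
  show "(\<Sum>i\<in>I. of_real (p i) * w i x) = 0" if "\<bar>x\<bar> > of_int N" for x using w(2) that by simp
  show "shift_contractive (\<lambda>x. \<Sum>i\<in>I. of_real (p i) * w i x)"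
    by (rule shift_contractive_convex[OF I p w(1,4)])
  have int: "integrable lebesgue (w i)" if "i \<in> I" for i
    by (rule L2_compact_support_integrable[OF w(1)[OF that] w(2)[OF that]])
  have "(\<integral>x. (\<Sum>i\<in>I. of_real (p i) * w i x) \<partial>lebesgue) = (\<Sum>i\<in>I. of_real (p i) * (\<integral>x. w i x \<partial>lebesgue))"
    by (subst Bochner_Integration.integral_sum) (use int in auto)
  also have "\<dots> = of_real (\<Sum>i\<in>I. p i)" by (simp add: w(3))
  finally show "(\<integral>x. (\<Sum>i\<in>I. of_real (p i) * w i x) \<partial>lebesgue) = 1" by (simp add: p)
qed (rule T)

text \<open>
  The averages of the first \<open>M\<close> iterates, as in the mean ergodic theorem:
  \<open>T\<close> moves them by \<open>1 / M\<close> times the difference of two functions of norm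
  at most one.
\<close>
lemma approx_fixed_nonempty:
  assumes "\<delta> > 0" shows "approx_fixed \<delta> \<noteq> {}"
proof -
  obtain M :: nat where M: "2 / \<delta> < real M" using reals_Archimedean2 by blast
  have M0: "M > 0" using M assms by (metis divide_pos_pos gr0I less_asym of_nat_0 zero_less_numeral)
  define v where "v i = (T ^^ i) unit_box" for i
  define g where "g x = (\<Sum>i<M. of_real (1 / real M) * v i x)" for x
  have vL: "v i \<in> L2_real" for i unfolding v_def by (rule cascade_iterates)
  have "T g x - g x = of_real (1 / real M) * (v M x - v 0 x)" for x
  proof -
    have "T g x = (\<Sum>i<M. of_real (1 / real M) * v (Suc i) x)"
      unfolding g_def by (subst refine_sum) (simp_all add: v_def)
    then have "T g x - g x = of_real (1 / real M) * (\<Sum>i<M. v (Suc i) x - v i x)"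
      unfolding g_def by (simp only: sum_distrib_left[symmetric] right_diff_distrib[symmetric] sum_subtractf)
    then show ?thesis by (simp only: sum_lessThan_telescope[of "\<lambda>i. v i x"])
  qed
  then have "L2_norm (\<lambda>x. T g x - g x) = (1 / real M) * L2_norm (\<lambda>x. v M x - v 0 x)"
    by (simp only: L2_norm_cmult) (simp add: norm_divide)
  also have "\<dots> \<le> (1 / real M) * 2"
  proof (intro mult_left_mono)
    have "L2_norm (\<lambda>x. v M x - v 0 x) \<le> L2_norm (v M) + L2_norm (v 0)"
      using L2_norm_triangle[OF vL[of M] L2_real_cmult[OF vL[of 0], of "-1"]] L2_norm_cmult[of "-1" "v 0"] by simp
    also have "\<dots> \<le> 1 + 1"
      unfolding v_def by (intro add_mono shift_contractive_norm_le cascade_iterates)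
    finally show "L2_norm (\<lambda>x. v M x - v 0 x) \<le> 2" by simp
  qed simp
  also have "\<dots> \<le> \<delta>" using M M0 assms by (simp add: field_simps)
  finally have le: "L2_norm (\<lambda>x. T g x - g x) \<le> \<delta>" .
  have "g \<in> approx_fixed \<delta>"
    using le unfolding g_def[abs_def]
    by (intro approx_fixed_convex) (use M0 cascade_iterates in \<open>auto simp: v_def\<close>)
  then show ?thesis by blast
qed

lemma approx_fixed_midpoint:
  assumes "u \<in> approx_fixed \<delta>" "v \<in> approx_fixed \<delta>"
  shows "(\<lambda>x. (u x + v x) / 2) \<in> approx_fixed \<delta>"
proof -
  define w where "w b = (if b then u else v)" for b :: bool
  have eq: "(\<lambda>x. \<Sum>b\<in>UNIV. of_real ((1/2)::real) * w b x) = (\<lambda>x. (u x + v x) / 2)"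
    by (simp add: UNIV_bool w_def add_divide_distrib add.commute)
  have wA: "w b \<in> approx_fixed \<delta>" for b using assms by (simp add: w_def)
  have wL: "w b \<in> L2_real" for b using wA[of b] by (simp add: approx_fixed_def)
  have TL: "(\<lambda>x. T (w b) x - w b x) \<in> L2_real" for b by (intro L2_real_diff L2_real_refine wL)
  have "(\<lambda>x. T (\<lambda>x. \<Sum>b\<in>UNIV. of_real ((1/2)::real) * w b x) x - (\<Sum>b\<in>UNIV. of_real ((1/2)::real) * w b x))
     = (\<lambda>x. \<Sum>b\<in>UNIV. of_real ((1/2)::real) * (T (w b) x - w b x))"
    by (subst refine_sum) (simp_all only: finite_class.finite_UNIV sum_subtractf right_diff_distrib)
  then have "L2_norm (\<lambda>x. T (\<lambda>x. \<Sum>b\<in>UNIV. of_real ((1/2)::real) * w b x) x - (\<Sum>b\<in>UNIV. of_real ((1/2)::real) * w b x))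
     \<le> (\<Sum>b\<in>UNIV. L2_norm (\<lambda>x. of_real ((1/2)::real) * (T (w b) x - w b x)))"
    by (simp only:) (intro L2_norm_sum_le L2_real_cmult TL)
  also have "\<dots> \<le> (\<Sum>b\<in>(UNIV::bool set). (1/2) * \<delta>)"
    unfolding L2_norm_cmult using wA by (intro sum_mono) (simp add: approx_fixed_def)
  also have "\<dots> = \<delta>" by simp
  finally have "(\<lambda>x. \<Sum>b\<in>UNIV. of_real ((1/2)::real) * w b x) \<in> approx_fixed \<delta>"
    by (intro approx_fixed_convex) (use wA in \<open>auto simp: approx_fixed_def\<close>)
  then show ?thesis unfolding eq .
qed

lemma approx_fixed_mono: "\<delta> \<le> \<delta>' \<Longrightarrow> approx_fixed \<delta> \<subseteq> approx_fixed \<delta>'"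
  by (auto simp: approx_fixed_def)

text \<open>
  Let \<open>s n\<close> be the infimum of the squared norm over the \<open>n\<close>-th set of
  almost fixed points. It increases and is bounded. Two elements of nearly minimal norm have their
  midpoint in the larger of their sets, so its norm is not much smaller, and the parallelogram law
  bounds their distance by the increase of \<open>s\<close>. All properties of the elements are
  closed, so they pass to the limit.
\<close>
lemma refinable_function_exists:
  obtains \<phi> where "\<phi> \<in> L2_real" "\<And>x. \<bar>x\<bar> > of_int N \<Longrightarrow> \<phi> x = 0" "(\<integral>x. \<phi> x \<partial>lebesgue) = 1"
    "shift_contractive \<phi>" "L2_norm (\<lambda>x. T \<phi> x - \<phi> x) = 0"
proof -
  define A where "A n = approx_fixed (1 / real (Suc n))" for n
  have Amono: "A m \<subseteq> A n" if "n \<le> m" for n m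
    unfolding A_def using that by (intro approx_fixed_mono) (simp add: frac_le)
  define s where "s n = (INF w\<in>A n. (L2_norm w)\<^sup>2)" for n
  have ne: "A n \<noteq> {}" for n unfolding A_def by (rule approx_fixed_nonempty) simp
  have bdd: "bdd_below ((\<lambda>w. (L2_norm w)\<^sup>2) ` A n)" for n by (rule bdd_belowI2[of _ 0]) simp
  have s_le: "s n \<le> (L2_norm w)\<^sup>2" if "w \<in> A n" for w n
    unfolding s_def by (rule cINF_lower[OF bdd that])
  have norm1: "(L2_norm w)\<^sup>2 \<le> 1" if "w \<in> A n" for w n
    using that shift_contractive_norm_le[of w] L2_norm_nonneg[of w]
    by (simp add: A_def approx_fixed_def abs_square_le_1)
  have "\<exists>w\<in>A n. (L2_norm w)\<^sup>2 < s n + 1 / real (Suc n)" for n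
    using cINF_less_iff[OF ne bdd, of n "s n + 1 / real (Suc n)"] unfolding s_def by simp
  then obtain w where w: "\<And>n. w n \<in> A n" "\<And>n. (L2_norm (w n))\<^sup>2 < s n + 1 / real (Suc n)" by metis
  have s1: "s n \<le> 1" for n using s_le[OF w(1)] norm1[OF w(1)] order_trans by blast
  have s_inc: "s n \<le> s m" if "n \<le> m" for n m
    unfolding s_def by (rule cINF_superset_mono[OF ne bdd Amono[OF that]]) simp
  define S where "S = (SUP n. s n)"
  have bddS: "bdd_above (range s)" by (rule bdd_aboveI2[of _ _ 1]) (rule s1)
  have sS: "s n \<le> S" for n unfolding S_def by (rule cSUP_upper[OF _ bddS]) simp
  have slim: "s \<longlonglongrightarrow> S" unfolding S_def
    by (rule LIMSEQ_incseq_SUP[OF bddS]) (simp add: incseq_def s_inc)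
  have wL: "w n \<in> L2_real" for n using w(1)[of n] by (simp add: A_def approx_fixed_def)
  (* Parallelogram law; the norm of the midpoint is bounded below by s n, as both lie in A n. *)
  have half: "(L2_norm (\<lambda>x. w n x - w m x))\<^sup>2 \<le> 2 * (S - s n) + 4 / real (Suc n)" if "n \<le> m" for n m
  proof -
    have wm: "w m \<in> A n" using w(1) Amono[OF that] by blast
    have mid: "s n \<le> (L2_norm (\<lambda>x. (w n x + w m x) / 2))\<^sup>2"
      by (rule s_le) (use approx_fixed_midpoint w(1)[of n] wm in \<open>simp add: A_def\<close>)
    have inv: "1 / real (Suc m) \<le> 1 / real (Suc n)" using that by (simp add: frac_le)
    have arith: "2 * x + 2 * y - 4 * z \<le> 2 * (S - t) + 4 * d"
      if "t \<le> z" "d' \<le> d" "x < t + d" "y < t' + d'" "t' \<le> S" for x y z t t' d d' :: real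
    proof -
      have "x + y \<le> t + S + 2 * d" using that by simp
      moreover have "2 * (S - t) + 4 * d - (2 * x + 2 * y - 4 * z) = 2 * (t + S + 2 * d - (x + y)) + 4 * (z - t)"
        by (simp add: algebra_simps)
      ultimately show ?thesis using that(1) by simp
    qed
    have "2 * (L2_norm (w n))\<^sup>2 + 2 * (L2_norm (w m))\<^sup>2 - 4 * (L2_norm (\<lambda>x. (w n x + w m x) / 2))\<^sup>2
        \<le> 2 * (S - s n) + 4 * (1 / real (Suc n))"
      by (rule arith[OF mid inv w(2) w(2) sS])
    then show ?thesis unfolding L2_parallelogram[OF wL wL] by simp
  qed
  have lim0: "(\<lambda>n. 2 * (S - s n) + 4 / real (Suc n)) \<longlonglongrightarrow> 0"
  proof -
    have "(\<lambda>n. 2 * (S - s n) + 4 * inverse (real (Suc n))) \<longlonglongrightarrow> 2 * (S - S) + 4 * 0"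
      by (intro tendsto_intros slim LIMSEQ_inverse_real_of_nat)
    then show ?thesis by (simp add: divide_inverse)
  qed
  have Cauchy: "\<exists>M. \<forall>m\<ge>M. \<forall>n\<ge>M. L2_norm (\<lambda>x. w m x - w n x) \<le> e" if e: "e > 0" for e
  proof -
    have "e\<^sup>2 > 0" using e by simp
    from order_tendstoD(2)[OF lim0 this] obtain M where M: "\<And>n. n \<ge> M \<Longrightarrow> 2 * (S - s n) + 4 / real (Suc n) < e\<^sup>2"
      unfolding eventually_sequentially by blast
    have le: "L2_norm (\<lambda>x. w n x - w m x) \<le> e" if "n \<ge> M" "n \<le> m" for n m
    proof (rule power2_le_imp_le)
      show "(L2_norm (\<lambda>x. w n x - w m x))\<^sup>2 \<le> e\<^sup>2" using half[OF that(2)] M[OF that(1)] by linarith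
    qed (use e in simp)
    show ?thesis
    proof (intro exI allI impI)
      fix m n assume "m \<ge> M" "n \<ge> M"
      then show "L2_norm (\<lambda>x. w m x - w n x) \<le> e"
        using le[of n m] le[of m n] L2_norm_diff_commute[of "w m" "w n"] by (cases "n \<le> m") auto
    qed
  qed
  have wsupp: "w n x = 0" if "\<bar>x\<bar> > of_int N" for n x
    using w(1)[of n] that by (simp add: A_def approx_fixed_def)
  obtain u where u: "u \<in> L2_real" "(\<lambda>n. L2_norm (\<lambda>x. w n x - u x)) \<longlonglongrightarrow> 0"
    "\<And>x. x \<notin> {x. \<bar>x\<bar> \<le> of_int N} \<Longrightarrow> u x = 0"
    by (rule L2_complete[OF wL Cauchy, of "{x. \<bar>x\<bar> \<le> of_int N}"]) (use wsupp in auto)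
  have usupp: "u x = 0" if "\<bar>x\<bar> > of_int N" for x using u(3) that by auto
  have N0: "0 \<le> real_of_int N" using N1 by simp
  show ?thesis
  proof (rule that[OF u(1) usupp])
    show "shift_contractive u"
      by (rule shift_contractive_limit[OF wL _ u(1,2)]) (use w(1) in \<open>simp add: A_def approx_fixed_def\<close>)
    have wint: "integrable lebesgue (w n)" for n by (rule L2_compact_support_integrable[OF wL wsupp])
    have uint: "integrable lebesgue u" by (rule L2_compact_support_integrable[OF u(1) usupp])
    have dint: "cmod (1 - (\<integral>x. u x \<partial>lebesgue)) \<le> sqrt (2 * of_int N) * L2_norm (\<lambda>x. w n x - u x)" for n
    proof -
      have "1 - (\<integral>x. u x \<partial>lebesgue) = (\<integral>x. w n x - u x \<partial>lebesgue)"
        using w(1)[of n] by (subst Bochner_Integration.integral_diff[OF wint uint]) (simp add: A_def approx_fixed_def)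
      then show ?thesis
        using integral_norm_le_L2[OF L2_real_diff[OF wL[of n] u(1)] _ N0] wsupp usupp by simp
    qed
    have "cmod (1 - (\<integral>x. u x \<partial>lebesgue)) \<le> sqrt (2 * of_int N) * 0"
      by (rule LIMSEQ_le[OF tendsto_const tendsto_mult[OF tendsto_const u(2)]]) (use dint in blast)
    then show "(\<integral>x. u x \<partial>lebesgue) = 1" by simp
    define B where "B = 2 * (\<Sum>k\<in>{-N..N}. cmod (a 0 k))"
    have Tu: "L2_norm (\<lambda>x. T u x - u x) \<le> 1 / real (Suc n) + (B + 1) * L2_norm (\<lambda>x. w n x - u x)" for n
    proof -
      have L1: "(\<lambda>x. T u x - u x) \<in> L2_real" by (intro L2_real_diff L2_real_refine u)
      have L2: "(\<lambda>x. T (w n) x - w n x) \<in> L2_real" by (intro L2_real_diff L2_real_refine wL)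
      have L3: "(\<lambda>x. u x - w n x) \<in> L2_real" by (intro L2_real_diff wL u)
      have eq: "(T u x - u x) - (T (w n) x - w n x) = T (\<lambda>x. u x - w n x) x + (-1) * (u x - w n x)" for x
        by (simp add: refine_diff)
      have "L2_norm (\<lambda>x. (T u x - u x) - (T (w n) x - w n x)) \<le> L2_norm (T (\<lambda>x. u x - w n x)) + L2_norm (\<lambda>x. (-1) * (u x - w n x))"
        unfolding eq by (intro L2_norm_triangle L2_real_cmult L2_real_refine L3)
      also have "\<dots> \<le> B * L2_norm (\<lambda>x. u x - w n x) + L2_norm (\<lambda>x. u x - w n x)"
        unfolding B_def using L2_norm_refine_le[OF L3, of N "a 0"] L2_norm_cmult[of "-1" "\<lambda>x. u x - w n x"] by simp
      also have "\<dots> = (B + 1) * L2_norm (\<lambda>x. w n x - u x)"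
        unfolding L2_norm_diff_commute[of u] by (simp add: algebra_simps)
      finally have "L2_norm (\<lambda>x. (T u x - u x) - (T (w n) x - w n x)) \<le> (B + 1) * L2_norm (\<lambda>x. w n x - u x)" .
      moreover have "L2_norm (\<lambda>x. T (w n) x - w n x) \<le> 1 / real (Suc n)"
        using w(1)[of n] by (simp add: A_def approx_fixed_def)
      ultimately show ?thesis using L2_norm_triangle_diff[OF L1 L2] by linarith
    qed
    have lim: "(\<lambda>n. inverse (real (Suc n)) + (B + 1) * L2_norm (\<lambda>x. w n x - u x)) \<longlonglongrightarrow> 0 + (B + 1) * 0"
      by (intro tendsto_intros u LIMSEQ_inverse_real_of_nat)
    have "L2_norm (\<lambda>x. T u x - u x) \<le> 0 + (B + 1) * 0"
      by (rule LIMSEQ_le[OF tendsto_const lim]) (use Tu in \<open>auto simp: inverse_eq_divide\<close>)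
    then show "L2_norm (\<lambda>x. T u x - u x) = 0"
      using L2_norm_nonneg[of "\<lambda>x. T u x - u x"] by simp
  qed
qed

end

section \<open>The Parseval identity for the wavelet system\<close>

lemma dyadic_L2: "\<psi> \<in> L2_real \<Longrightarrow> dyadic \<psi> j k \<in> L2_real"
  unfolding dyadic_def[abs_def] by (intro L2_real_cmult L2_real_affine) simp_all

lemma powr_half_sq: "(2 powr (real_of_int j / 2))\<^sup>2 = 2 powi j"
proof -
  have "(2 powr (real_of_int j / 2))\<^sup>2 = 2 powr (real_of_int j)"
    unfolding power2_eq_square by (subst powr_add[symmetric]) simp
  then show ?thesis by (simp add: powr_real_of_int')
qed

lemma L2_norm_dyadic: "L2_norm (dyadic \<psi> j k) = L2_norm \<psi>"
proof -
  have "(L2_norm (dyadic \<psi> j k))\<^sup>2 = (L2_norm \<psi>)\<^sup>2"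
    unfolding dyadic_def[abs_def] L2_norm_cmult power_mult_distrib
    by (subst L2_norm_affine) (simp_all add: powr_half_sq)
  then show ?thesis by (simp add: L2_norm_nonneg)
qed

text \<open>
  The scaling relation between two levels; the factor \<open>sqrt 2\<close> is the normalization of
  the dilation.
\<close>
lemma dyadic_refine:
  "dyadic (refine N b \<phi>) j l x = of_real (sqrt 2) * (\<Sum>k\<in>{-N..N}. b k * dyadic \<phi> (j + 1) (2 * l + k) x)"
proof -
  have p: "(2::real) powi (j + 1) = 2 * 2 powi j" by (simp add: power_int_add)
  have "2 powr (real_of_int (j + 1) / 2) = 2 powr (real_of_int j / 2) * 2 powr (1/2)"
    unfolding powr_add[symmetric] by (simp add: add_divide_distrib)
  then have s: "2 powr (real_of_int (j + 1) / 2) = 2 powr (real_of_int j / 2) * sqrt 2"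
    by (simp add: powr_half_sqrt)
  have "complex_of_real (sqrt 2) * complex_of_real (sqrt 2) = 2" unfolding of_real_mult[symmetric] by simp
  then have ss: "complex_of_real (sqrt 2) * (z * complex_of_real (sqrt 2) * y) = z * (2 * y)" for z y
    by (metis mult.assoc mult.commute)
  have "of_real (sqrt 2) * (\<Sum>k\<in>{-N..N}. b k * dyadic \<phi> (j + 1) (2 * l + k) x)
     = (\<Sum>k\<in>{-N..N}. of_real (sqrt 2) * (of_real (2 powr (real_of_int j / 2)) * of_real (sqrt 2) *
          (b k * \<phi> (2 * (2 powi j * x + of_int l) + of_int k))))"
    unfolding dyadic_def p s sum_distrib_left by (simp add: algebra_simps)
  also have "\<dots> = dyadic (refine N b \<phi>) j l x"
    unfolding ss dyadic_def refine_def by (simp add: sum_distrib_left)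
  finally show ?thesis by simp
qed

text \<open>
  The dilation is moved from the analysing function to \<open>g\<close>.
\<close>
lemma L2_inner_dyadic:
  "L2_inner g (dyadic \<psi> j m) = of_real (2 powr (- real_of_int j / 2)) *
     (\<integral>y. g ((y - of_int m) / 2 powi j) * cnj (\<psi> y) \<partial>lebesgue)"
proof -
  define c :: real where "c = 2 powi j"
  have c: "c > 0" by (simp add: c_def)
  define A where "A = (\<integral>x. g x * cnj (\<psi> (c * x + of_int m)) \<partial>lebesgue)"
  have "(\<integral>y. g ((y - of_int m) / c) * cnj (\<psi> y) \<partial>lebesgue) = \<bar>c\<bar> *\<^sub>R (\<integral>x. g ((of_int m + c * x - of_int m) / c) * cnj (\<psi> (of_int m + c * x)) \<partial>lebesgue)"
    using lebesgue_integral_real_affine[of c "\<lambda>y. g ((y - of_int m) / c) * cnj (\<psi> y)" "of_int m"] c by simp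
  also have "(\<lambda>x. g ((of_int m + c * x - of_int m) / c) * cnj (\<psi> (of_int m + c * x))) = (\<lambda>x. g x * cnj (\<psi> (c * x + of_int m)))"
    using c by (simp add: add.commute)
  finally have 1: "(\<integral>y. g ((y - of_int m) / c) * cnj (\<psi> y) \<partial>lebesgue) = of_real c * A"
    using c by (simp add: A_def scaleR_conv_of_real)
  have "L2_inner g (dyadic \<psi> j m) = of_real (2 powr (real_of_int j / 2)) * A"
    unfolding dyadic_def[abs_def] L2_inner_cmult_right unfolding L2_inner_def A_def c_def by simp
  moreover have "2 powr (- real_of_int j / 2) * c = 2 powr (real_of_int j / 2)"
  proof -
    have "c = 2 powr (real_of_int j)" by (simp add: c_def powr_real_of_int')
    then show ?thesis by (simp add: powr_add[symmetric])
  qed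
  ultimately have "L2_inner g (dyadic \<psi> j m) = of_real (2 powr (- real_of_int j / 2)) * (of_real c * A)"
    by (metis mult.assoc of_real_mult)
  then show ?thesis using 1 unfolding c_def by simp
qed

lemma L2_inner_dyadic_zero:
  assumes \<psi>: "\<And>x. \<bar>x\<bar> > N \<Longrightarrow> \<psi> x = 0" and g: "\<And>x. \<bar>x\<bar> > R \<Longrightarrow> g x = 0"
    and m: "\<bar>of_int m\<bar> > N + 2 powi j * R"
  shows "L2_inner g (dyadic \<psi> j m) = 0"
proof -
  have "g x * cnj (dyadic \<psi> j m x) = 0" for x
  proof (cases "\<bar>x\<bar> > R")
    case False
    then have "\<bar>2 powi j * x\<bar> \<le> 2 powi j * R" by (simp add: abs_mult)
    then have "\<bar>2 powi j * x + of_int m\<bar> > N" using m by linarith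
    then show ?thesis using \<psi> by (simp add: dyadic_def)
  qed (use g in simp)
  then show ?thesis by (simp only: L2_inner_def Bochner_Integration.integral_zero)
qed

context filter_bank
begin

text \<open>
  One step of the wavelet transform: each channel at level \<open>j\<close> is obtained by filtering
  the coefficients of level \<open>j + 1\<close>, and the filter bank is an isometry.
\<close>
lemma level_identity:
  assumes \<phi>: "\<phi> \<in> L2_real" "\<And>x. \<bar>x\<bar> > of_int N \<Longrightarrow> \<phi> x = 0"
    and g: "g \<in> L2_real" "\<And>x. \<bar>x\<bar> > R \<Longrightarrow> g x = 0"
    and G: "finite G" "\<And>m. m \<notin> G \<Longrightarrow> L2_inner g (dyadic \<phi> (j + 1) m) = 0"
    and L: "finite L" "\<And>m l. m \<in> G \<Longrightarrow> m - 2 * l \<in> {-N..N} \<Longrightarrow> l \<in> L"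
  shows "(\<Sum>r\<le>q. \<Sum>l\<in>L. (cmod (L2_inner g (dyadic (refine N (a r) \<phi>) j l)))\<^sup>2)
       = (\<Sum>m\<in>G. (cmod (L2_inner g (dyadic \<phi> (j + 1) m)))\<^sup>2)"
proof -
  define b where "b m = L2_inner g (dyadic \<phi> (j + 1) m)" for m
  have dL: "dyadic \<phi> i m \<in> L2_real" for i m by (rule dyadic_L2[OF \<phi>(1)])
  have inner: "L2_inner g (dyadic (refine N (a r) \<phi>) j l) = of_real (sqrt 2) * (\<Sum>m\<in>G. cnj (a r (m - 2 * l)) * b m)"
    if r: "r \<le> q" for r l
  proof -
    define G' where "G' = G \<union> {2 * l - N..2 * l + N}"
    have "L2_inner g (dyadic (refine N (a r) \<phi>) j l)
       = L2_inner g (\<lambda>x. of_real (sqrt 2) * (\<Sum>k\<in>{-N..N}. a r k * dyadic \<phi> (j + 1) (2 * l + k) x))"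
      by (simp only: dyadic_refine[abs_def])
    also have "\<dots> = of_real (sqrt 2) * (\<Sum>k\<in>{-N..N}. cnj (a r k) * b (2 * l + k))"
      unfolding L2_inner_cmult_right b_def
      by (subst L2_inner_sum_right) (auto simp: L2_inner_cmult_right intro!: L2_real_cmult dL g)
    also have "(\<Sum>k\<in>{-N..N}. cnj (a r k) * b (2 * l + k)) = cnj (\<Sum>k\<in>{-N..N}. a r k * cnj (b (2 * l + k)))"
      by simp
    also have "(\<Sum>k\<in>{-N..N}. a r k * cnj (b (2 * l + k))) = (\<Sum>m\<in>G'. a r (m - 2 * l) * cnj (b m))"
      by (rule refine_reindex[OF r, where g = "\<lambda>m. cnj (b m)"]) (use G in \<open>auto simp: G'_def\<close>)
    also have "\<dots> = (\<Sum>m\<in>G. a r (m - 2 * l) * cnj (b m))"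
      by (rule sum.mono_neutral_right) (use G in \<open>auto simp: G'_def b_def\<close>)
    finally show ?thesis by simp
  qed
  have "(\<Sum>r\<le>q. \<Sum>l\<in>L. (cmod (L2_inner g (dyadic (refine N (a r) \<phi>) j l)))\<^sup>2)
     = (\<Sum>r\<le>q. \<Sum>l\<in>L. 2 * (cmod (\<Sum>m\<in>G. cnj (a r (m - 2 * l)) * b m))\<^sup>2)"
    by (intro sum.cong refl) (simp add: inner norm_mult power_mult_distrib)
  also have "\<dots> = (\<Sum>m\<in>G. (cmod (b m))\<^sup>2)" by (rule analysis_isometry[OF G(1) L])
  finally show ?thesis by (simp only: b_def)
qed

lemma L2_inner_dyadic_eq:
  assumes "u \<in> L2_real" "v \<in> L2_real" "g \<in> L2_real" "L2_norm (\<lambda>x. u x - v x) = 0"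
  shows "L2_inner g (dyadic u j k) = L2_inner g (dyadic v j k)"
proof -
  have d: "(\<lambda>x. dyadic u j k x + (-1) * dyadic v j k x) = dyadic (\<lambda>x. u x - v x) j k"
    by (rule ext) (simp add: dyadic_def right_diff_distrib)
  have "L2_inner g (\<lambda>x. dyadic u j k x + (-1) * dyadic v j k x) = L2_inner g (dyadic u j k) + cnj (-1) * L2_inner g (dyadic v j k)"
    unfolding L2_inner_add_right[OF dyadic_L2[OF assms(1)] L2_real_cmult[OF dyadic_L2[OF assms(2)]] assms(3)]
      L2_inner_cmult_right ..
  moreover have "cmod (L2_inner g (dyadic (\<lambda>x. u x - v x) j k)) \<le> L2_norm g * 0"
    using L2_Cauchy_Schwarz[OF assms(3) dyadic_L2[OF L2_real_diff[OF assms(1,2)]], of j k]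
    unfolding L2_norm_dyadic assms(4) .
  ultimately show ?thesis unfolding d by simp
qed

text \<open>
  On the support of \<open>g\<close> the dilated function only shows its values in an interval
  around an integer whose length tends to zero, and these carry little energy.
\<close>
lemma coarse_limit:
  assumes \<phi>: "\<phi> \<in> L2_real" and g: "g \<in> L2_real" "\<And>x. \<bar>x\<bar> > R \<Longrightarrow> g x = 0"
  shows "(\<lambda>n. L2_inner g (dyadic \<phi> (- int n) m)) \<longlonglongrightarrow> 0"
proof -
  define I where "I n = {y::real. \<bar>y - of_int m\<bar> \<le> R / 2 ^ n}" for n :: nat
  define d where "d n y = (if y \<in> I n then \<phi> y else 0)" for n y
  have Is: "I n \<in> sets lebesgue" for n
  proof -
    have "I n = {of_int m - R / 2 ^ n..of_int m + R / 2 ^ n}" by (auto simp: I_def abs_le_iff)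
    then show ?thesis by simp
  qed
  have dm: "d n \<in> borel_measurable lebesgue" for n
    unfolding d_def[abs_def] using L2_realD(1)[OF \<phi>] Is by (intro measurable_If_set) simp_all
  have dL: "d n \<in> L2_real" for n
    by (rule L2_real_bound[OF dm L2_realD(2)[OF \<phi>]]) (simp add: d_def)
  have dlim: "(\<lambda>n. L2_norm (d n)) \<longlonglongrightarrow> 0"
  proof -
    have "(\<lambda>n. L2_norm (\<lambda>x. d n x - 0)) \<longlonglongrightarrow> 0"
    proof (rule L2_norm_tendsto_dominated[OF dm _ _ L2_realD(2)[OF \<phi>]])
      have "AE x in lebesgue. x \<noteq> real_of_int m"
        using AE_not_in[OF negligible_sing[of "real_of_int m", unfolded negligible_iff_null_sets]] by simp
      then show "AE x in lebesgue. (\<lambda>n. d n x) \<longlonglongrightarrow> 0"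
      proof (rule AE_mp, intro AE_I2 impI)
        fix x assume x: "x \<noteq> real_of_int m"
        have "(\<lambda>n. R * (1/2) ^ n) \<longlonglongrightarrow> R * 0" by (intro tendsto_intros LIMSEQ_realpow_zero) auto
        then have "eventually (\<lambda>n. R * (1/2) ^ n < \<bar>x - of_int m\<bar>) sequentially"
          using x by (intro order_tendstoD(2)) auto
        then have "eventually (\<lambda>n. d n x = 0) sequentially"
          by eventually_elim (auto simp: d_def I_def power_divide)
        then show "(\<lambda>n. d n x) \<longlonglongrightarrow> 0" by (rule tendsto_eventually)
      qed
      show "(cmod (d n x - 0))\<^sup>2 \<le> (cmod (\<phi> x))\<^sup>2" for n x by (simp add: d_def)
    qed simp
    then show ?thesis by simp
  qed
  have bound: "cmod (L2_inner g (dyadic \<phi> (- int n) m)) \<le> L2_norm g * L2_norm (d n)" for n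
  proof -
    have "g x * cnj (dyadic \<phi> (- int n) m x) = g x * cnj (dyadic (d n) (- int n) m x)" for x
    proof (cases "\<bar>x\<bar> > R")
      case False
      then have "2 powi (- int n) * x + of_int m \<in> I n"
        by (simp add: I_def power_int_minus divide_inverse abs_mult)
      then show ?thesis by (simp add: dyadic_def d_def)
    qed (use g in simp)
    then have "L2_inner g (dyadic \<phi> (- int n) m) = L2_inner g (dyadic (d n) (- int n) m)"
      by (simp only: L2_inner_def)
    then show ?thesis using L2_Cauchy_Schwarz[OF g(1) dyadic_L2[OF dL[of n]], of "- int n" m]
      by (simp only: L2_norm_dyadic)
  qed
  have lim0: "(\<lambda>n. L2_norm g * L2_norm (d n)) \<longlonglongrightarrow> 0"
    using tendsto_mult[OF tendsto_const dlim, of "L2_norm g"] by simp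
  show ?thesis by (rule Lim_null_comparison[OF always_eventually[OF allI[OF bound]] lim0])
qed

text \<open>
  Up to normalization the coefficients are the averages \<open>c n m\<close> of \<open>g\<close>
  against the unit mass \<open>\<phi>\<close> near the point \<open>- m / 2\<^sup>n\<close>. The
  step function \<open>S n\<close> with these values has norm equal to the root of the sum of
  squares, and it converges to \<open>g\<close> boundedly with bounded support.
\<close>
lemma fine_limit:
  assumes \<phi>: "\<phi> \<in> L2_real" "\<And>x. \<bar>x\<bar> > of_int N \<Longrightarrow> \<phi> x = 0" "(\<integral>x. \<phi> x \<partial>lebesgue) = 1"
    and g: "continuous_on UNIV g" "\<And>x. \<bar>x\<bar> > R \<Longrightarrow> g x = 0" and R: "R \<ge> 0"
    and G: "\<And>n::nat. finite (G n)" "\<And>n m. m \<notin> G n \<Longrightarrow> L2_inner g (dyadic \<phi> (int n) m) = 0"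
  shows "(\<lambda>n. \<Sum>m\<in>G n. (cmod (L2_inner g (dyadic \<phi> (int n) m)))\<^sup>2) \<longlonglongrightarrow> (L2_norm g)\<^sup>2"
proof -
  have gL: "g \<in> L2_real" by (rule continuous_compact_support_L2[OF g])
  have \<phi>i: "integrable lebesgue \<phi>" by (rule L2_compact_support_integrable[OF \<phi>(1,2)])
  define c where "c n m = (\<integral>y. g ((y - of_int m) / 2 ^ n) * cnj (\<phi> y) \<partial>lebesgue)" for n :: nat and m :: int
  define s where "s n = 2 powr (- real n / 2)" for n :: nat
  have b: "L2_inner g (dyadic \<phi> (int n) m) = of_real (s n) * c n m" for n m
    unfolding L2_inner_dyadic c_def s_def by simp
  have s0: "s n > 0" for n by (simp add: s_def)
  have ssq: "(s n)\<^sup>2 = 1 / 2 ^ n" for n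
  proof -
    have "(s n)\<^sup>2 = 2 powr (- real n)" unfolding s_def power2_eq_square by (subst powr_add[symmetric]) simp
    then show ?thesis by (simp add: powr_minus powr_realpow divide_inverse)
  qed
  have c0: "c n m = 0" if "m \<notin> G n" for n m using G(2)[OF that] b[of n m] s0[of n] by simp
  define S where "S n x = (\<Sum>m\<in>G n. c n m * unit_box (2 ^ n * x + of_int m))" for n x
  have SL: "S n \<in> L2_real" for n
    unfolding S_def[abs_def] by (intro L2_real_sum L2_real_cmult L2_real_affine unit_box_L2) simp
  have Sn: "(L2_norm (S n))\<^sup>2 = (\<Sum>m\<in>G n. (cmod (L2_inner g (dyadic \<phi> (int n) m)))\<^sup>2)" for n
  proof -
    have "(L2_norm (S n))\<^sup>2 = (L2_norm (\<lambda>y. \<Sum>m\<in>G n. c n m * unit_box (y + of_int m)))\<^sup>2 / \<bar>2 ^ n\<bar>"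
      using L2_norm_affine[of "2 ^ n" "\<lambda>y. \<Sum>m\<in>G n. c n m * unit_box (y + of_int m)" 0] by (simp add: S_def[abs_def])
    also have "\<dots> = (\<Sum>m\<in>G n. (s n)\<^sup>2 * (cmod (c n m))\<^sup>2)"
      unfolding unit_box_shift_sum_norm[OF G(1)] ssq by (simp add: sum_divide_distrib)
    finally show ?thesis unfolding b using s0 by (simp add: norm_mult power_mult_distrib abs_of_pos)
  qed
  define mm where "mm n x = - \<lfloor>2 ^ n * x\<rfloor>" for n :: nat and x :: real
  have Sc: "S n x = c n (mm n x)" for n x
  proof -
    have ub: "unit_box (2 ^ n * x + of_int m) = (if m = mm n x then 1 else 0)" for m
    proof -
      have "(m = mm n x) = (\<lfloor>2 ^ n * x\<rfloor> = - m)" unfolding mm_def by auto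
      then have "(0 \<le> 2 ^ n * x + of_int m \<and> 2 ^ n * x + of_int m < 1) = (m = mm n x)"
        unfolding floor_eq_iff by auto
      then show ?thesis by (auto simp: unit_box_def indicator_def)
    qed
    have "S n x = (\<Sum>m\<in>G n. if m = mm n x then c n (mm n x) else 0)"
      unfolding S_def ub by (intro sum.cong) auto
    also have "\<dots> = c n (mm n x)" using c0 G(1) by (simp add: sum.delta)
    finally show ?thesis .
  qed
  have mmb: "0 \<le> 2 ^ n * x + of_int (mm n x)" "2 ^ n * x + of_int (mm n x) < 1" for n x
    unfolding mm_def by (simp_all, linarith)
  obtain B where B: "\<And>x. cmod (g x) \<le> B" "B \<ge> 0"
  proof -
    have "bounded (g ` {-R..R})"
      by (intro compact_imp_bounded compact_continuous_image continuous_on_subset[OF g(1)]) auto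
    then obtain B where "\<forall>y\<in>g ` {-R..R}. cmod y \<le> B" unfolding bounded_iff by blast
    then have B: "x \<in> {-R..R} \<Longrightarrow> cmod (g x) \<le> B" for x by blast
    have "0 \<le> cmod (g 0)" by simp
    also have "\<dots> \<le> B" using B[of 0] R by simp
    finally have "B \<ge> 0" .
    moreover have "cmod (g x) \<le> B" for x
      using B[of x] g(2)[of x] \<open>B \<ge> 0\<close> by (cases "x \<in> {-R..R}") auto
    ultimately show ?thesis using that by blast
  qed
  have gm: "g \<in> borel_measurable lebesgue" by (rule continuous_borel_measurable_lebesgue[OF g(1)])
  have cint: "integrable lebesgue (\<lambda>y. g ((y - of_int m) / 2 ^ n) * cnj (\<phi> y))" for n m
  proof (rule Bochner_Integration.integrable_bound)
    show "integrable lebesgue (\<lambda>y. B * cmod (\<phi> y))" using \<phi>i by simp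
    have "continuous_on UNIV (\<lambda>y. g ((y - of_int m) / 2 ^ n))"
      by (intro continuous_on_compose2[OF g(1)] continuous_intros) auto
    moreover have "(\<lambda>y. cnj (\<phi> y)) \<in> borel_measurable lebesgue"
      by (rule borel_measurable_continuous_on[OF continuous_on_cnj[OF continuous_on_id] L2_realD(1)[OF \<phi>(1)]])
    ultimately show "(\<lambda>y. g ((y - of_int m) / 2 ^ n) * cnj (\<phi> y)) \<in> borel_measurable lebesgue"
      using continuous_borel_measurable_lebesgue by (intro borel_measurable_times) blast+
    show "AE y in lebesgue. norm (g ((y - of_int m) / 2 ^ n) * cnj (\<phi> y)) \<le> norm (B * cmod (\<phi> y))"
      using B by (intro AE_I2) (simp add: norm_mult mult_right_mono)
  qed
  define C where "C = (\<integral>y. cmod (\<phi> y) \<partial>lebesgue)"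
  have C0: "C \<ge> 0" by (simp add: C_def)
  have cB: "cmod (c n m) \<le> B * C" for n m
  proof -
    have "cmod (c n m) \<le> (\<integral>y. norm (g ((y - of_int m) / 2 ^ n) * cnj (\<phi> y)) \<partial>lebesgue)"
      unfolding c_def by (rule integral_norm_bound)
    also have "\<dots> \<le> (\<integral>y. B * cmod (\<phi> y) \<partial>lebesgue)"
      by (rule integral_mono[OF integrable_norm[OF cint]]) (use \<phi>i B in \<open>auto simp: norm_mult mult_right_mono\<close>)
    finally show ?thesis by (simp add: C_def)
  qed
  have near: "\<bar>(y - of_int (mm n x)) / 2 ^ n - x\<bar> \<le> (of_int N + 1) / 2 ^ n" if "\<bar>y\<bar> \<le> of_int N" for n x y
  proof -
    have "(y - of_int (mm n x)) / 2 ^ n - x = (y - (2 ^ n * x + of_int (mm n x))) / 2 ^ n" by (simp add: field_simps)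
    moreover have "\<bar>y - (2 ^ n * x + of_int (mm n x))\<bar> \<le> of_int N + 1" using mmb[of n x] that by linarith
    ultimately show ?thesis by (simp add: divide_right_mono)
  qed
  have cdiff: "cmod (c n (mm n x) - g x) \<le> e * C"
    if e: "\<And>u. \<bar>u - x\<bar> \<le> (of_int N + 1) / 2 ^ n \<Longrightarrow> cmod (g u - g x) \<le> e" for n x e
  proof -
    have ci: "integrable lebesgue (\<lambda>y. cnj (\<phi> y))" using \<phi>i by simp
    have "g x = (\<integral>y. g x * cnj (\<phi> y) \<partial>lebesgue)" using \<phi>(3) by simp
    then have diff: "c n (mm n x) - g x = (\<integral>y. g ((y - of_int (mm n x)) / 2 ^ n) * cnj (\<phi> y) - g x * cnj (\<phi> y) \<partial>lebesgue)"
      unfolding c_def by (subst Bochner_Integration.integral_diff[OF cint]) (use ci in auto)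
    have "cmod (c n (mm n x) - g x) \<le> (\<integral>y. norm (g ((y - of_int (mm n x)) / 2 ^ n) * cnj (\<phi> y) - g x * cnj (\<phi> y)) \<partial>lebesgue)"
      unfolding diff by (rule integral_norm_bound)
    also have "\<dots> \<le> (\<integral>y. e * cmod (\<phi> y) \<partial>lebesgue)"
    proof (rule integral_mono)
      show "integrable lebesgue (\<lambda>y. norm (g ((y - of_int (mm n x)) / 2 ^ n) * cnj (\<phi> y) - g x * cnj (\<phi> y)))"
        using cint ci by (intro integrable_norm Bochner_Integration.integrable_diff integrable_mult_right)
      show "integrable lebesgue (\<lambda>y. e * cmod (\<phi> y))" using \<phi>i by simp
      fix y
      show "norm (g ((y - of_int (mm n x)) / 2 ^ n) * cnj (\<phi> y) - g x * cnj (\<phi> y)) \<le> e * cmod (\<phi> y)"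
      proof (cases "\<bar>y\<bar> \<le> of_int N")
        case True
        have "cmod (g ((y - of_int (mm n x)) / 2 ^ n) - g x) \<le> e" by (rule e[OF near[OF True]])
        then show ?thesis unfolding left_diff_distrib[symmetric] norm_mult by (simp add: mult_right_mono)
      next
        case False then show ?thesis using \<phi>(2) by simp
      qed
    qed
    finally show ?thesis by (simp add: C_def)
  qed
  have lim: "(\<lambda>n. S n x) \<longlonglongrightarrow> g x" for x
  proof (rule LIMSEQ_I)
    fix r :: real assume r: "r > 0"
    have "isCont g x" using g(1) by (simp add: continuous_on_eq_continuous_at)
    then have "\<exists>d>0. \<forall>u. dist u x < d \<longrightarrow> dist (g u) (g x) < r / (C + 1)"
      unfolding continuous_at_eps_delta using r C0 by (simp add: dist_commute)
    then obtain d where d: "d > 0" "\<And>u. \<bar>u - x\<bar> < d \<Longrightarrow> cmod (g u - g x) < r / (C + 1)"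
      by (auto simp: dist_norm)
    have "(\<lambda>n. (of_int N + 1) * (1/2) ^ n :: real) \<longlonglongrightarrow> (of_int N + 1) * 0"
      by (intro tendsto_intros LIMSEQ_realpow_zero) auto
    then have "eventually (\<lambda>n. (of_int N + 1) * (1/2) ^ n < d) sequentially"
      using d(1) by (intro order_tendstoD(2)) auto
    then obtain n0 where n0: "\<And>n. n \<ge> n0 \<Longrightarrow> (of_int N + 1) * (1/2) ^ n < d"
      unfolding eventually_sequentially by blast
    show "\<exists>no. \<forall>n\<ge>no. norm (S n x - g x) < r"
    proof (intro exI allI impI)
      fix n assume "n \<ge> n0"
      then have "(of_int N + 1) / 2 ^ n < d" using n0[of n] by (simp add: power_divide)
      then have "cmod (c n (mm n x) - g x) \<le> r / (C + 1) * C"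
        by (intro cdiff less_imp_le[OF d(2)]) linarith
      also have "\<dots> < r" using r C0 by (simp add: field_simps)
      finally show "norm (S n x - g x) < r" unfolding Sc .
    qed
  qed
  have Ssupp: "S n x = 0" if x: "\<bar>x\<bar> > R + of_int N + 1" for n x
  proof -
    have "g ((y - of_int (mm n x)) / 2 ^ n) * cnj (\<phi> y) = 0" for y
    proof (cases "\<bar>y\<bar> \<le> of_int N")
      case True
      have le: "(real_of_int N + 1) / 2 ^ n \<le> (of_int N + 1) / 1" using N1 by (intro divide_left_mono) auto
      define A where "A = (y - of_int (mm n x)) / 2 ^ n"
      have tri: "\<bar>x\<bar> \<le> \<bar>A\<bar> + \<bar>A - x\<bar>" using abs_triangle_ineq4[of A "A - x"] by simp
      have arith: "R < p" if "t \<le> p + d" "d \<le> e" "e \<le> K / 1" "R + K < t" for p t d e K :: real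
        using that by simp
      have "\<bar>A\<bar> > R"
        by (rule arith[OF tri near[OF True, of n x, folded A_def] le]) (use x in \<open>simp add: add.assoc\<close>)
      then have "\<bar>(y - of_int (mm n x)) / 2 ^ n\<bar> > R" unfolding A_def .
      then show ?thesis using g(2) by simp
    next
      case False then show ?thesis using \<phi>(2) by simp
    qed
    then show ?thesis unfolding Sc c_def by (simp only: Bochner_Integration.integral_zero)
  qed
  define R' where "R' = R + of_int N + 1"
  have lim0: "(\<lambda>n. L2_norm (\<lambda>x. S n x - g x)) \<longlonglongrightarrow> 0"
  proof (rule L2_norm_tendsto_dominated[OF L2_realD(1)[OF SL] gm AE_I2[OF lim]])
    show "integrable lebesgue (\<lambda>x. (B * C + B)\<^sup>2 * indicator {-R'..R'} x)"
      by (intro integrable_mult_right integrable_indicator_Icc)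
    show "(cmod (S n x - g x))\<^sup>2 \<le> (B * C + B)\<^sup>2 * indicator {-R'..R'} x" for n x
    proof (cases "x \<in> {-R'..R'}")
      case True
      have "cmod (S n x - g x) \<le> B * C + B"
        using norm_triangle_ineq4[of "S n x" "g x"] cB[of n "mm n x"] B(1)[of x] unfolding Sc by linarith
      then show ?thesis using True by (simp add: power_mono)
    next
      case False
      then have x: "\<bar>x\<bar> > R'" by auto
      then have "\<bar>x\<bar> > R" using N1 by (simp add: R'_def)
      then show ?thesis using g(2) Ssupp x False by (simp add: R'_def)
    qed
  qed
  have bound: "norm (L2_norm (S n) - L2_norm g) \<le> L2_norm (\<lambda>x. S n x - g x)" for n
    using L2_norm_triangle_diff[OF SL[of n] gL] L2_norm_triangle_diff[OF gL SL[of n]]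
    unfolding L2_norm_diff_commute[of g "S n"] real_norm_def abs_le_iff by linarith
  have "(\<lambda>n. L2_norm (S n) - L2_norm g) \<longlonglongrightarrow> 0"
    by (rule Lim_null_comparison[OF always_eventually[OF allI[OF bound]] lim0])
  then have "(\<lambda>n. L2_norm (S n)) \<longlonglongrightarrow> L2_norm g" by (simp only: LIM_zero_iff)
  then have "(\<lambda>n. (L2_norm (S n))\<^sup>2) \<longlonglongrightarrow> (L2_norm g)\<^sup>2" by (intro tendsto_intros)
  then show ?thesis unfolding Sn .
qed

text \<open>
  The sums \<open>Q j\<close> of the squared coefficients at level \<open>j\<close> satisfy \<open>Q
  (j + 1) = Q j +\<close> the wavelet energy at level \<open>j\<close>, so the energies of finitely
  many levels telescope. All these sums are finite because \<open>g\<close> is taken from the dense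
  set of continuous functions with compact support.
\<close>
theorem wavelet_parseval:
  assumes \<phi>: "\<phi> \<in> L2_real" "\<And>x. \<bar>x\<bar> > of_int N \<Longrightarrow> \<phi> x = 0" "(\<integral>x. \<phi> x \<partial>lebesgue) = 1"
      "L2_norm (\<lambda>x. T \<phi> x - \<phi> x) = 0"
  shows "parseval_system q (\<lambda>r. refine N (a r) \<phi>)"
  unfolding parseval_system_def
proof
  define \<psi> where "\<psi> r = refine N (a r) \<phi>" for r
  define I where "I = {1..q} \<times> (UNIV :: int set) \<times> (UNIV :: int set)"
  define e where "e = (\<lambda>(r, j, k). dyadic (\<psi> r) j k)"
  define D where "D = {d :: real \<Rightarrow> complex. continuous_on UNIV d \<and> (\<exists>R. \<forall>x. \<bar>x\<bar> > R \<longrightarrow> d x = (0::complex))}"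
  have \<psi>L: "\<psi> r \<in> L2_real" for r unfolding \<psi>_def by (rule L2_real_refine[OF \<phi>(1)])
  fix g :: "real \<Rightarrow> complex" assume gL: "g \<in> L2_real"
  have "((\<lambda>i. (cmod (L2_inner g (e i)))\<^sup>2) has_sum (L2_norm g)\<^sup>2) I"
  proof (rule Parseval_extend[OF _ _ _ _ gL])
    show "e i \<in> L2_real" for i by (auto simp: e_def case_prod_beta intro!: dyadic_L2 \<psi>L)
    show "\<exists>d\<in>D. L2_norm (\<lambda>x. f x - d x) < \<epsilon>" if f: "f \<in> L2_real" "\<epsilon> > 0" for f \<epsilon>
    proof -
      obtain R d where "continuous_on UNIV d" "\<And>x. \<bar>x\<bar> > R \<Longrightarrow> d x = 0" "L2_norm (\<lambda>x. f x - d x) < \<epsilon>"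
        by (rule L2_dense_continuous[OF f]) blast
      then show ?thesis unfolding D_def by blast
    qed
    show "d \<in> L2_real" if "d \<in> D" for d
    proof -
      obtain R where "continuous_on UNIV d" "\<And>x. \<bar>x\<bar> > R \<Longrightarrow> d x = 0" using \<open>d \<in> D\<close> unfolding D_def by blast
      then show ?thesis by (rule continuous_compact_support_L2)
    qed
    fix d assume "d \<in> D"
    then obtain R0 where dc: "continuous_on UNIV d" and R0: "\<And>x. \<bar>x\<bar> > R0 \<Longrightarrow> d x = 0" unfolding D_def by blast
    define R where "R = max R0 0"
    have R: "R \<ge> 0" "\<And>x. \<bar>x\<bar> > R \<Longrightarrow> d x = 0" using R0 by (auto simp: R_def)
    have dL: "d \<in> L2_real" by (rule continuous_compact_support_L2[OF dc R(2)])
    (* For \<bar>m\<bar> > M j the supports of d and of the dyadic function with shift m are disjoint. *)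
    define M where "M j = \<lceil>of_int N + 2 powi j * R\<rceil>" for j :: int
    define G where "G j = {- M j..M j}" for j
    have Gf: "finite (G j)" for j by (simp add: G_def)
    have G0: "L2_inner d (dyadic \<phi> j m) = 0" if "m \<notin> G j" for j m
    proof (rule L2_inner_dyadic_zero[OF \<phi>(2) R(2)])
      have "\<bar>m\<bar> > M j" using that by (auto simp: G_def)
      then have "of_int \<bar>m\<bar> > real_of_int (M j)" by simp
      moreover have "of_int N + 2 powi j * R \<le> real_of_int (M j)" unfolding M_def by (rule le_of_int_ceiling)
      ultimately show "\<bar>of_int m\<bar> > of_int N + 2 powi j * R" by simp
    qed
    define Q where "Q j = (\<Sum>m\<in>G j. (cmod (L2_inner d (dyadic \<phi> j m)))\<^sup>2)" for j
    (* L0 j contains the shifts that matter at level j: those of G j, and those reached from G (j + 1) by a filter. *)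
    define L0 where "L0 j = G j \<union> (\<Union>m\<in>G (j + 1). {-(\<bar>m\<bar> + N)..\<bar>m\<bar> + N})" for j
    have L0f: "finite (L0 j)" for j by (simp add: L0_def Gf)
    have step: "(\<Sum>r\<in>{1..q}. \<Sum>l\<in>L. (cmod (L2_inner d (dyadic (\<psi> r) j l)))\<^sup>2) = Q (j + 1) - Q j"
      if L: "finite L" "L0 j \<subseteq> L" for j L
    proof -
      have Ll: "l \<in> L" if "m \<in> G (j + 1)" "m - 2 * l \<in> {-N..N}" for m l
      proof -
        have "l \<in> {-(\<bar>m\<bar> + N)..\<bar>m\<bar> + N}" using that(2) by auto
        then show ?thesis using that(1) L(2) unfolding L0_def by blast
      qed
      have "(\<Sum>r\<le>q. \<Sum>l\<in>L. (cmod (L2_inner d (dyadic (\<psi> r) j l)))\<^sup>2) = Q (j + 1)"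
        unfolding Q_def \<psi>_def by (rule level_identity[OF \<phi>(1,2) dL R(2) Gf G0 L(1) Ll])
      moreover have "{..q} = insert 0 {1..q}" by auto
      ultimately have "(\<Sum>l\<in>L. (cmod (L2_inner d (dyadic (\<psi> 0) j l)))\<^sup>2)
         + (\<Sum>r\<in>{1..q}. \<Sum>l\<in>L. (cmod (L2_inner d (dyadic (\<psi> r) j l)))\<^sup>2) = Q (j + 1)" by simp
      moreover have "L2_inner d (dyadic (\<psi> 0) j l) = L2_inner d (dyadic \<phi> j l)" for l
        by (rule L2_inner_dyadic_eq[OF \<psi>L \<phi>(1) dL]) (use \<phi>(4) in \<open>simp add: \<psi>_def\<close>)
      moreover have "(\<Sum>l\<in>L. (cmod (L2_inner d (dyadic \<phi> j l)))\<^sup>2) = Q j"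
        unfolding Q_def by (rule sum.mono_neutral_right) (use L G0 in \<open>auto simp: L0_def\<close>)
      ultimately show ?thesis by simp
    qed
    have Qmono1: "Q j \<le> Q (j + 1)" for j
    proof -
      have "0 \<le> (\<Sum>r\<in>{1..q}. \<Sum>l\<in>L0 j. (cmod (L2_inner d (dyadic (\<psi> r) j l)))\<^sup>2)" by (intro sum_nonneg) auto
      then show ?thesis using step[OF L0f, of j] by simp
    qed
    have total: "(\<Sum>(r, j, k)\<in>{1..q} \<times> {- int n..<int n} \<times> L. (cmod (L2_inner d (dyadic (\<psi> r) j k)))\<^sup>2) = Q (int n) - Q (- int n)"
      if L: "finite L" "\<And>j. j \<in> {- int n..<int n} \<Longrightarrow> L0 j \<subseteq> L" for n :: nat and L
    proof -
      have "(\<Sum>(r, j, k)\<in>{1..q} \<times> {- int n..<int n} \<times> L. (cmod (L2_inner d (dyadic (\<psi> r) j k)))\<^sup>2)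
         = (\<Sum>r\<in>{1..q}. \<Sum>j\<in>{- int n..<int n}. \<Sum>k\<in>L. (cmod (L2_inner d (dyadic (\<psi> r) j k)))\<^sup>2)"
        by (simp only: sum.cartesian_product)
      also have "\<dots> = (\<Sum>j\<in>{- int n..<int n}. \<Sum>r\<in>{1..q}. \<Sum>k\<in>L. (cmod (L2_inner d (dyadic (\<psi> r) j k)))\<^sup>2)"
        by (rule sum.swap)
      also have "\<dots> = (\<Sum>j\<in>{- int n..<int n}. Q (j + 1) - Q j)"
        by (intro sum.cong refl step L)
      also have "\<dots> = Q (int n) - Q (- int n)"
      proof (induction n)
        case (Suc n)
        have "{- int (Suc n)..<int (Suc n)} = insert (- int (Suc n)) (insert (int n) {- int n..<int n})" by auto
        then have "(\<Sum>j\<in>{- int (Suc n)..<int (Suc n)}. Q (j + 1) - Q j)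
           = (Q (- int (Suc n) + 1) - Q (- int (Suc n))) + ((Q (int n + 1) - Q (int n)) + (\<Sum>j\<in>{- int n..<int n}. Q (j + 1) - Q j))"
          by simp
        moreover have "- int (Suc n) + 1 = - int n" "int n + 1 = int (Suc n)" by simp_all
        ultimately show ?case using Suc by (simp only:)
      qed simp
      finally show ?thesis .
    qed
    have Qup: "(\<lambda>n. Q (int n)) \<longlonglongrightarrow> (L2_norm d)\<^sup>2"
      unfolding Q_def by (rule fine_limit[OF \<phi>(1-3) dc R(2) R(1) Gf G0])
    have Qle: "Q (int n) \<le> (L2_norm d)\<^sup>2" for n
    proof (rule incseq_le[OF _ Qup])
      show "incseq (\<lambda>n. Q (int n))"
      proof (rule incseq_SucI)
        show "Q (int n) \<le> Q (int (Suc n))" for n using Qmono1[of "int n"] by (simp add: add.commute)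
      qed
    qed
    have Q0: "Q j \<ge> 0" for j unfolding Q_def by (intro sum_nonneg) auto
    have Qdown: "(\<lambda>n. Q (- int n)) \<longlonglongrightarrow> 0"
    proof -
      define G1 where "G1 = {- \<lceil>of_int N + R\<rceil>..\<lceil>of_int N + R\<rceil>}"
      have sub: "G (- int n) \<subseteq> G1" for n
      proof -
        have "(2::real) powi (- int n) \<le> 1" by (simp add: power_int_minus inverse_le_1_iff one_le_power)
        then have "2 powi (- int n) * R \<le> R" using R(1) mult_right_mono[of _ 1 R] by simp
        then have "M (- int n) \<le> \<lceil>of_int N + R\<rceil>" unfolding M_def by (intro ceiling_mono) simp
        then show ?thesis by (auto simp: G_def G1_def)
      qed
      have "Q (- int n) = (\<Sum>m\<in>G1. (cmod (L2_inner d (dyadic \<phi> (- int n) m)))\<^sup>2)" for n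
        unfolding Q_def by (rule sum.mono_neutral_left) (use sub G0 in \<open>auto simp: G1_def\<close>)
      moreover have "(\<lambda>n. \<Sum>m\<in>G1. (cmod (L2_inner d (dyadic \<phi> (- int n) m)))\<^sup>2) \<longlonglongrightarrow> (\<Sum>m\<in>G1. (cmod 0)\<^sup>2)"
        by (intro tendsto_intros coarse_limit[OF \<phi>(1) dL R(2)])
      ultimately show ?thesis by simp
    qed
    show "((\<lambda>i. (cmod (L2_inner d (e i)))\<^sup>2) has_sum (L2_norm d)\<^sup>2) I"
    proof (rule has_sum_nonnegI)
      fix F assume F: "finite F" "F \<subseteq> I"
      define js where "js = (\<lambda>(r, j, k). j) ` F"
      define ks where "ks = (\<lambda>(r, j, k). k) ` F"
      have fin: "finite js" "finite ks" using F by (auto simp: js_def ks_def)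
      define n where "n = nat (Max (insert 0 (abs ` js))) + 1"
      have jn: "j \<in> {- int n..<int n}" if "j \<in> js" for j
      proof -
        have "\<bar>j\<bar> \<le> Max (insert 0 (abs ` js))" using that fin by (intro Max_ge) auto
        then show ?thesis unfolding n_def by auto
      qed
      define L where "L = ks \<union> (\<Union>j\<in>{- int n..<int n}. L0 j)"
      have Lf: "finite L" using fin L0f by (simp add: L_def)
      have "F \<subseteq> {1..q} \<times> {- int n..<int n} \<times> L"
      proof
        fix i assume i: "i \<in> F"
        obtain r j k where ijk: "i = (r, j, k)" by (cases i) auto
        have "r \<in> {1..q}" using i F ijk by (auto simp: I_def)
        moreover have "j \<in> js" unfolding js_def by (rule rev_image_eqI[OF i]) (simp add: ijk)
        moreover have "k \<in> ks" unfolding ks_def by (rule rev_image_eqI[OF i]) (simp add: ijk)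
        ultimately show "i \<in> {1..q} \<times> {- int n..<int n} \<times> L" using jn ijk by (auto simp: L_def)
      qed
      then have "(\<Sum>i\<in>F. (cmod (L2_inner d (e i)))\<^sup>2) \<le> (\<Sum>i\<in>{1..q} \<times> {- int n..<int n} \<times> L. (cmod (L2_inner d (e i)))\<^sup>2)"
        using Lf by (intro sum_mono2) auto
      also have "\<dots> = (\<Sum>(r, j, k)\<in>{1..q} \<times> {- int n..<int n} \<times> L. (cmod (L2_inner d (dyadic (\<psi> r) j k)))\<^sup>2)"
        by (simp add: e_def case_prod_beta)
      also have "\<dots> = Q (int n) - Q (- int n)" by (rule total[OF Lf]) (auto simp: L_def)
      also have "\<dots> \<le> (L2_norm d)\<^sup>2" using Qle[of n] Q0[of "- int n"] by linarith
      finally show "(\<Sum>i\<in>F. (cmod (L2_inner d (e i)))\<^sup>2) \<le> (L2_norm d)\<^sup>2" .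
    next
      fix \<epsilon> :: real assume \<epsilon>: "\<epsilon> > 0"
      have "(\<lambda>n. Q (int n) - Q (- int n)) \<longlonglongrightarrow> (L2_norm d)\<^sup>2 - 0" by (intro tendsto_intros Qup Qdown)
      then have "eventually (\<lambda>n. (L2_norm d)\<^sup>2 - \<epsilon> < Q (int n) - Q (- int n)) sequentially"
        using \<epsilon> by (intro order_tendstoD(1)) auto
      then obtain n where n: "(L2_norm d)\<^sup>2 - \<epsilon> < Q (int n) - Q (- int n)" unfolding eventually_sequentially by blast
      define L where "L = (\<Union>j\<in>{- int n..<int n}. L0 j)"
      have Lf: "finite L" using L0f by (simp add: L_def)
      have "(\<Sum>i\<in>{1..q} \<times> {- int n..<int n} \<times> L. (cmod (L2_inner d (e i)))\<^sup>2)
         = (\<Sum>(r, j, k)\<in>{1..q} \<times> {- int n..<int n} \<times> L. (cmod (L2_inner d (dyadic (\<psi> r) j k)))\<^sup>2)"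
        by (simp add: e_def case_prod_beta)
      also have "\<dots> = Q (int n) - Q (- int n)" by (rule total[OF Lf]) (auto simp: L_def)
      finally have "(L2_norm d)\<^sup>2 - \<epsilon> \<le> (\<Sum>i\<in>{1..q} \<times> {- int n..<int n} \<times> L. (cmod (L2_inner d (e i)))\<^sup>2)"
        using n by simp
      then show "\<exists>F. finite F \<and> F \<subseteq> I \<and> (L2_norm d)\<^sup>2 - \<epsilon> \<le> (\<Sum>i\<in>F. (cmod (L2_inner d (e i)))\<^sup>2)"
        using Lf by (intro exI[of _ "{1..q} \<times> {- int n..<int n} \<times> L"]) (auto simp: I_def)
    qed simp
  qed
  moreover have "(\<lambda>i. (cmod (L2_inner g (e i)))\<^sup>2)
      = (\<lambda>(r, j, k). (cmod (L2_inner g (dyadic (refine N (a r) \<phi>) j k)))\<^sup>2)"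
    by (auto simp: e_def \<psi>_def fun_eq_iff)
  ultimately show "((\<lambda>(r, j, k). (cmod (L2_inner g (dyadic (refine N (a r) \<phi>) j k)))\<^sup>2) has_sum (L2_norm g)\<^sup>2)
      ({1..q} \<times> UNIV \<times> UNIV)"
    unfolding I_def by (simp only:)
qed

end

section \<open>Fourier transforms of functions with compact support\<close>

lemma fourier_L1_cis: "fourier_L1 g \<xi> = (\<integral>x. g x * cis (- (x * \<xi>)) \<partial>lebesgue)"
proof -
  have "exp (- (\<i> * of_real x * of_real \<xi>)) = cis (- (x * \<xi>))" for x
    unfolding cis_conv_exp by (simp add: mult.assoc)
  then show ?thesis by (simp only: fourier_L1_def)
qed

lemma integrable_mult_cis:
  assumes "integrable lebesgue g"
  shows "integrable lebesgue (\<lambda>x. g x * cis (s * x + t))"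
proof (rule Bochner_Integration.integrable_bound[OF assms])
  have [measurable]: "g \<in> borel_measurable lebesgue" using assms by simp
  have [measurable]: "(\<lambda>x. cis (s * x + t)) \<in> borel_measurable lebesgue"
    by (intro continuous_borel_measurable_lebesgue continuous_intros)
  show "(\<lambda>x. g x * cis (s * x + t)) \<in> borel_measurable lebesgue" by simp
qed (simp add: norm_mult)

lemma integrable_fourier: "integrable lebesgue g \<Longrightarrow> integrable lebesgue (\<lambda>x. g x * cis (- (x * \<xi>)))"
  using integrable_mult_cis[of g "- \<xi>" 0] by (simp add: mult.commute)

lemma fourier_L1_affine:
  assumes c: "c > 0"
  shows "fourier_L1 (\<lambda>x. g (c * x + t)) (c * \<xi>) = of_real (1 / c) * cis (t * \<xi>) * fourier_L1 g \<xi>"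
proof -
  have "(\<integral>y. g y * cis (- ((y - t) * \<xi>)) \<partial>lebesgue)
     = \<bar>c\<bar> *\<^sub>R (\<integral>x. g (t + c * x) * cis (- ((t + c * x - t) * \<xi>)) \<partial>lebesgue)"
    using lebesgue_integral_real_affine[of c "\<lambda>y. g y * cis (- ((y - t) * \<xi>))" t] c by simp
  also have "(\<integral>x. g (t + c * x) * cis (- ((t + c * x - t) * \<xi>)) \<partial>lebesgue) = fourier_L1 (\<lambda>x. g (c * x + t)) (c * \<xi>)"
    unfolding fourier_L1_cis by (simp add: mult_ac add.commute)
  also have "(\<integral>y. g y * cis (- ((y - t) * \<xi>)) \<partial>lebesgue) = (\<integral>y. cis (t * \<xi>) * (g y * cis (- (y * \<xi>))) \<partial>lebesgue)"
  proof (rule Bochner_Integration.integral_cong[OF refl])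
    fix y
    have "cis (- ((y - t) * \<xi>)) = cis (t * \<xi>) * cis (- (y * \<xi>))" by (simp add: cis_mult algebra_simps)
    then show "g y * cis (- ((y - t) * \<xi>)) = cis (t * \<xi>) * (g y * cis (- (y * \<xi>)))" by simp
  qed
  also have "\<dots> = cis (t * \<xi>) * fourier_L1 g \<xi>" unfolding fourier_L1_cis by (rule integral_mult_right_zero)
  finally show ?thesis using c by (simp add: scaleR_conv_of_real field_simps)
qed

lemma fourier_L1_shift:
  "fourier_L1 (\<lambda>x. g (x + t)) \<xi> = cis (t * \<xi>) * fourier_L1 g \<xi>"
  using fourier_L1_affine[of 1 g t \<xi>] by simp

lemma fourier_L1_sum:
  assumes "\<And>k. k \<in> F \<Longrightarrow> integrable lebesgue (g k)"
  shows "fourier_L1 (\<lambda>x. \<Sum>k\<in>F. c k * g k x) \<xi> = (\<Sum>k\<in>F. c k * fourier_L1 (g k) \<xi>)"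
proof -
  have "fourier_L1 (\<lambda>x. \<Sum>k\<in>F. c k * g k x) \<xi> = (\<integral>x. (\<Sum>k\<in>F. c k * (g k x * cis (- (x * \<xi>)))) \<partial>lebesgue)"
    unfolding fourier_L1_cis by (simp add: sum_distrib_right mult.assoc)
  also have "\<dots> = (\<Sum>k\<in>F. (\<integral>x. c k * (g k x * cis (- (x * \<xi>))) \<partial>lebesgue))"
    by (rule Bochner_Integration.integral_sum) (intro integrable_mult_right integrable_fourier assms)
  finally show ?thesis unfolding fourier_L1_cis by simp
qed

lemma integrable_affine:
  fixes g :: "real \<Rightarrow> complex"
  assumes "integrable lebesgue g" "c \<noteq> 0" shows "integrable lebesgue (\<lambda>x. g (c * x + t))"
  using lebesgue_integrable_real_affine_iff[OF assms(2), of g t] assms(1) by (simp only: add.commute[of t])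

lemma fourier_L1_refine:
  assumes g: "integrable lebesgue g"
  shows "fourier_L1 (refine N b g) (2 * \<xi>) = (\<Sum>k\<in>{-N..N}. b k * cis (of_int k * \<xi>)) * fourier_L1 g \<xi>"
proof -
  have "fourier_L1 (refine N b g) (2 * \<xi>) = fourier_L1 (\<lambda>x. \<Sum>k\<in>{-N..N}. (2 * b k) * g (2 * x + of_int k)) (2 * \<xi>)"
    unfolding refine_def[abs_def] sum_distrib_left by (simp add: mult.assoc)
  also have "\<dots> = (\<Sum>k\<in>{-N..N}. (2 * b k) * fourier_L1 (\<lambda>x. g (2 * x + of_int k)) (2 * \<xi>))"
    by (rule fourier_L1_sum) (intro integrable_affine g, simp)
  also have "\<dots> = (\<Sum>k\<in>{-N..N}. (b k * cis (of_int k * \<xi>)) * fourier_L1 g \<xi>)"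
    by (intro sum.cong refl, subst fourier_L1_affine) simp_all
  finally show ?thesis by (simp add: sum_distrib_right)
qed

lemma continuous_fourier_L1:
  assumes g: "integrable lebesgue g" shows "continuous_on UNIV (fourier_L1 g)"
  unfolding continuous_on_eq_continuous_at[OF open_UNIV]
proof (intro ballI)
  fix \<xi>
  have gm: "g \<in> borel_measurable lebesgue" using g by simp
  show "isCont (fourier_L1 g) \<xi>"
    unfolding continuous_at_sequentially
  proof (intro allI impI)
    fix u :: "nat \<Rightarrow> real" assume u: "u \<longlonglongrightarrow> \<xi>"
    have "(\<lambda>n. \<integral>x. g x * cis (- (x * u n)) \<partial>lebesgue) \<longlonglongrightarrow> (\<integral>x. g x * cis (- (x * \<xi>)) \<partial>lebesgue)"
    proof (rule Bochner_Integration.integral_dominated_convergence[where w = "\<lambda>x. norm (g x)"])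
      show "(\<lambda>x. g x * cis (- (x * \<xi>))) \<in> borel_measurable lebesgue"
        "\<And>n. (\<lambda>x. g x * cis (- (x * u n))) \<in> borel_measurable lebesgue"
        by (intro borel_measurable_integrable integrable_fourier g)+
      show "AE x in lebesgue. (\<lambda>n. g x * cis (- (x * u n))) \<longlonglongrightarrow> g x * cis (- (x * \<xi>))"
        by (intro AE_I2 tendsto_intros u)
    qed (use g in \<open>auto simp: norm_mult\<close>)
    then show "(fourier_L1 g \<circ> u) \<longlonglongrightarrow> fourier_L1 g \<xi>" by (simp add: fourier_L1_cis o_def)
  qed
qed

lemma lebesgue_integral_indicator_continuous:
  fixes f :: "real \<Rightarrow> 'a :: euclidean_space"
  assumes "continuous_on {a..b} f"
  shows "integrable lebesgue (\<lambda>x. indicator {a..b} x *\<^sub>R f x)"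
    "(\<integral>x. indicator {a..b} x *\<^sub>R f x \<partial>lebesgue) = integral {a..b} f"
proof -
  have s: "set_integrable lebesgue {a..b} f" by (rule absolutely_integrable_continuous_real[OF assms])
  then show "integrable lebesgue (\<lambda>x. indicator {a..b} x *\<^sub>R f x)" by (simp only: set_integrable_def)
  show "(\<integral>x. indicator {a..b} x *\<^sub>R f x \<partial>lebesgue) = integral {a..b} f"
    using set_lebesgue_integral_eq_integral(2)[OF s] by (simp only: set_lebesgue_integral_def)
qed

text \<open>
  The exponentials of one period with frequencies \<open>k + t\<close>. For fixed \<open>t\<close>
  they are orthonormal, and the coefficients of a function supported in the period are samples of
  its Fourier transform.
\<close>
definition box_exp :: "real \<Rightarrow> int \<Rightarrow> real \<Rightarrow> complex" where
  "box_exp t k x = of_real (indicator {-pi..pi} x) * (cis ((of_int k + t) * x) / of_real (sqrt (2 * pi)))"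

lemma box_exp_orthonormal: "L2_inner (box_exp t k) (box_exp t l) = (if k = l then 1 else 0)"
proof -
  have eq: "box_exp t k x * cnj (box_exp t l x) = indicator {-pi..pi} x *\<^sub>R (cis (of_int (k - l) * x) / of_real (2 * pi))" for x
  proof -
    have "cis ((of_int k + t) * x) * cnj (cis ((of_int l + t) * x)) = cis (of_int (k - l) * x)"
      by (simp add: cis_cnj cis_mult algebra_simps)
    moreover have "complex_of_real (sqrt (2 * pi)) * complex_of_real (sqrt (2 * pi)) = of_real (2 * pi)"
      unfolding of_real_mult[symmetric] by simp
    ultimately show ?thesis
      by (cases "x \<in> {-pi..pi}") (simp_all add: box_exp_def)
  qed
  have "L2_inner (box_exp t k) (box_exp t l) = integral {-pi..pi} (\<lambda>x. cis (of_int (k - l) * x) / of_real (2 * pi))"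
    unfolding L2_inner_def eq
    by (rule lebesgue_integral_indicator_continuous(2)) (intro continuous_intros, simp)
  also have "\<dots> = (if k = l then 1 else 0)"
    unfolding integral_divide integral_cis_int by simp
  finally show ?thesis .
qed

lemma box_exp_L2: "box_exp t k \<in> L2_real"
proof (rule L2_real_bound)
  have "integrable lebesgue (\<lambda>x. indicator {-pi..pi} x *\<^sub>R (cis ((of_int k + t) * x) / of_real (sqrt (2 * pi))))"
    by (rule lebesgue_integral_indicator_continuous(1)) (intro continuous_intros, simp)
  then have "(\<lambda>x. indicator {-pi..pi} x *\<^sub>R (cis ((of_int k + t) * x) / of_real (sqrt (2 * pi)))) \<in> borel_measurable lebesgue"
    by (rule borel_measurable_integrable)
  then show "box_exp t k \<in> borel_measurable lebesgue"
    unfolding box_exp_def[abs_def] scaleR_conv_of_real .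
  show "integrable lebesgue (indicator {-pi..pi} :: real \<Rightarrow> real)" by (rule integrable_indicator_Icc)
  fix x
  have "1 \<le> sqrt (2 * pi)" using pi_gt3 by simp
  then have "cmod (cis ((of_int k + t) * x) / of_real (sqrt (2 * pi))) \<le> 1"
    by (simp add: norm_divide)
  then have "(cmod (cis ((of_int k + t) * x) / of_real (sqrt (2 * pi))))\<^sup>2 \<le> 1"
    by (intro power_le_one) auto
  then show "(cmod (box_exp t k x))\<^sup>2 \<le> indicator {-pi..pi} x"
    by (cases "x \<in> {-pi..pi}") (simp_all add: box_exp_def)
qed

lemma fourier_samples_Bessel:
  assumes v: "v \<in> L2_real" and s: "\<And>x. \<bar>x\<bar> > pi \<Longrightarrow> v x = 0" and F: "finite F"
  shows "(\<Sum>k\<in>F. (cmod (fourier_L1 v (of_int k + t)))\<^sup>2) \<le> 2 * pi * (L2_norm v)\<^sup>2"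
proof -
  have eq: "L2_inner v (box_exp t k) = fourier_L1 v (of_int k + t) / of_real (sqrt (2 * pi))" for k
  proof -
    have "v x * cnj (box_exp t k x) = v x * cis (- (x * (of_int k + t))) / of_real (sqrt (2 * pi))" for x
      using s[of x] by (cases "x \<in> {-pi..pi}") (auto simp: box_exp_def cis_cnj mult.commute)
    then show ?thesis unfolding L2_inner_def fourier_L1_cis by simp
  qed
  have "(\<Sum>k\<in>F. (cmod (L2_inner v (box_exp t k)))\<^sup>2) \<le> (L2_norm v)\<^sup>2"
    by (rule L2_Bessel[OF F box_exp_L2 box_exp_orthonormal v])
  then have "(\<Sum>k\<in>F. (cmod (fourier_L1 v (of_int k + t)))\<^sup>2 / (2 * pi)) \<le> (L2_norm v)\<^sup>2"
    unfolding eq by (simp add: norm_divide power_divide)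
  then show ?thesis unfolding sum_divide_distrib[symmetric] by (simp add: divide_le_eq mult.commute)
qed

text \<open>
  An integral over \<open>2 * n\<close> unit intervals is the integral over one of them of the sum
  of the translates; this turns bounds for samples into bounds for integrals.
\<close>
lemma integral_periodization:
  fixes H :: "real \<Rightarrow> real"
  assumes H: "continuous_on UNIV H"
  shows "integral {- real n..real n} H = integral {0..1} (\<lambda>t. \<Sum>k\<in>{- int n..<int n}. H (of_int k + t))"
proof (induction n)
  case 0 then show ?case by simp
next
  case (Suc n)
  have i: "H integrable_on {a..b}" for a b
    by (intro integrable_continuous_real continuous_on_subset[OF H]) simp
  have sh: "integral {0..1} (\<lambda>t. H (c + t)) = integral {c..1 + c} H" for c
    using integral_shift[of 0 c 1 H] continuous_on_subset[OF H] by (simp add: o_def add.commute)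
  have ih: "(\<lambda>t. H (c + t)) integrable_on {0..1}" for c
    by (intro integrable_continuous_real continuous_on_compose2[OF H] continuous_intros) simp
  note comb = Henstock_Kurzweil_Integration.integral_combine[OF _ _ i]
  have isum: "(\<lambda>t. \<Sum>k\<in>{- int n..<int n}. H (of_int k + t)) integrable_on {0..1}"
    by (intro integrable_sum finite_atLeastLessThan_int ih)
  have "integral {- real (Suc n)..real (Suc n)} H
     = integral {- real (Suc n)..- real n} H + (integral {- real n..real n} H + integral {real n..real (Suc n)} H)"
    using comb[of "- real (Suc n)" "- real n" "real (Suc n)"] comb[of "- real n" "real n" "real (Suc n)"] by simp
  moreover have "{- int (Suc n)..<int (Suc n)} = insert (- int (Suc n)) (insert (int n) {- int n..<int n})" by auto
  then have "(\<lambda>t. \<Sum>k\<in>{- int (Suc n)..<int (Suc n)}. H (of_int k + t))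
     = (\<lambda>t. H (- real (Suc n) + t) + (H (real n + t) + (\<Sum>k\<in>{- int n..<int n}. H (of_int k + t))))"
    by (simp add: add.assoc)
  then have "integral {0..1} (\<lambda>t. \<Sum>k\<in>{- int (Suc n)..<int (Suc n)}. H (of_int k + t))
     = integral {0..1} (\<lambda>t. H (- real (Suc n) + t)) + (integral {0..1} (\<lambda>t. H (real n + t))
        + integral {0..1} (\<lambda>t. \<Sum>k\<in>{- int n..<int n}. H (of_int k + t)))"
    by (simp only: Henstock_Kurzweil_Integration.integral_add[OF ih Henstock_Kurzweil_Integration.integrable_add[OF ih isum]]
        Henstock_Kurzweil_Integration.integral_add[OF ih isum])
  ultimately show ?case unfolding sh Suc by simp
qed

text \<open>
  Bessel's inequality bounds the samples at distance one, uniformly in the offset, and integration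
  over the offset gives the integral over the line.
\<close>
lemma fourier_L2_bound_pi:
  assumes v: "v \<in> L2_real" and s: "\<And>x. \<bar>x\<bar> > pi \<Longrightarrow> v x = 0"
  shows "fourier_L1 v \<in> L2_real \<and> (L2_norm (fourier_L1 v))\<^sup>2 \<le> 2 * pi * (L2_norm v)\<^sup>2"
proof -
  define H where "H \<xi> = (cmod (fourier_L1 v \<xi>))\<^sup>2" for \<xi>
  define C where "C = 2 * pi * (L2_norm v)\<^sup>2"
  have C: "C \<ge> 0" by (simp add: C_def)
  have vi: "integrable lebesgue v" by (rule L2_compact_support_integrable[OF v s])
  have fc: "continuous_on UNIV (fourier_L1 v)" by (rule continuous_fourier_L1[OF vi])
  have Hc: "continuous_on A H" for A
    unfolding H_def by (intro continuous_intros continuous_on_subset[OF fc]) simp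
  have H0: "H x \<ge> 0" for x by (simp add: H_def)
  have le: "integral {- real n..real n} H \<le> C" for n
  proof -
    have cs: "(\<lambda>t. \<Sum>k\<in>{- int n..<int n}. H (of_int k + t)) integrable_on {0..1}"
      by (intro integrable_continuous_real continuous_intros continuous_on_compose2[OF Hc[of UNIV]]) auto
    have "integral {0..1} (\<lambda>t. \<Sum>k\<in>{- int n..<int n}. H (of_int k + t)) \<le> integral {0..1} (\<lambda>t::real. C)"
      unfolding H_def C_def
      by (intro integral_le cs[unfolded H_def] integrable_const_ivl fourier_samples_Bessel[OF v s]) simp_all
    then show ?thesis unfolding integral_periodization[OF Hc] by simp
  qed
  have "(\<integral>\<^sup>+x. ennreal (H x) \<partial>lebesgue) = (\<integral>\<^sup>+x. (SUP n::nat. ennreal (indicator {- real n..real n} x *\<^sub>R H x)) \<partial>lebesgue)"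
  proof (rule nn_integral_cong)
    fix x
    obtain n0 :: nat where n0: "\<bar>x\<bar> \<le> real n0" using real_arch_simple by blast
    show "ennreal (H x) = (SUP n::nat. ennreal (indicator {- real n..real n} x *\<^sub>R H x))"
    proof (rule antisym)
      have "ennreal (H x) = ennreal (indicator {- real n0..real n0} x *\<^sub>R H x)" using n0 by (auto simp: abs_le_iff)
      also have "\<dots> \<le> (SUP n::nat. ennreal (indicator {- real n..real n} x *\<^sub>R H x))" by (rule SUP_upper) simp
      finally show "ennreal (H x) \<le> (SUP n::nat. ennreal (indicator {- real n..real n} x *\<^sub>R H x))" .
      show "(SUP n::nat. ennreal (indicator {- real n..real n} x *\<^sub>R H x)) \<le> ennreal (H x)"
        by (rule SUP_least) (auto simp: indicator_def H0 intro!: ennreal_leI)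
    qed
  qed
  also have "\<dots> = (SUP n::nat. \<integral>\<^sup>+x. ennreal (indicator {- real n..real n} x *\<^sub>R H x) \<partial>lebesgue)"
  proof (rule nn_integral_monotone_convergence_SUP)
    show "incseq (\<lambda>n x. ennreal (indicator {- real n..real n} x *\<^sub>R H x))"
      by (rule incseq_SucI, rule le_funI, rule ennreal_leI) (auto simp: indicator_def H0)
    show "(\<lambda>x. ennreal (indicator {- real n..real n} x *\<^sub>R H x)) \<in> borel_measurable lebesgue" for n
      using borel_measurable_integrable[OF lebesgue_integral_indicator_continuous(1)[OF Hc, of "- real n" "real n"]]
      by (intro measurable_compose[OF _ measurable_ennreal])
  qed
  also have "\<dots> \<le> ennreal C"
  proof (rule SUP_least)
    fix n :: nat
    have "(\<integral>\<^sup>+x. ennreal (indicator {- real n..real n} x *\<^sub>R H x) \<partial>lebesgue) = ennreal (integral {- real n..real n} H)"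
      unfolding lebesgue_integral_indicator_continuous(2)[OF Hc, symmetric]
      by (rule nn_integral_eq_integral[OF lebesgue_integral_indicator_continuous(1)[OF Hc]]) (simp add: H0)
    then show "(\<integral>\<^sup>+x. ennreal (indicator {- real n..real n} x *\<^sub>R H x) \<partial>lebesgue) \<le> ennreal C"
      using le[of n] by (simp only:) (rule ennreal_leI)
  qed
  finally have fin: "(\<integral>\<^sup>+x. ennreal ((cmod (fourier_L1 v x))\<^sup>2) \<partial>lebesgue) \<le> ennreal C" unfolding H_def .
  show ?thesis
    using L2_real_nn_integral[OF continuous_borel_measurable_lebesgue[OF fc] fin C] by (simp add: C_def)
qed

text \<open>
  A dilation moves the support into one period.
\<close>
lemma fourier_L2_bound:
  assumes w: "w \<in> L2_real" and s: "\<And>x. \<bar>x\<bar> > R \<Longrightarrow> w x = 0"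
  shows "fourier_L1 w \<in> L2_real" "(L2_norm (fourier_L1 w))\<^sup>2 \<le> 2 * pi * (L2_norm w)\<^sup>2"
proof -
  define M where "M = \<bar>R\<bar> + 1"
  have M: "M > 0" by (simp add: M_def)
  define v where "v x = w (M * x + 0)" for x
  have vL: "v \<in> L2_real" unfolding v_def by (rule L2_real_affine[OF w]) (use M in simp)
  have vn: "(L2_norm v)\<^sup>2 = (L2_norm w)\<^sup>2 / M" unfolding v_def using L2_norm_affine[of M w 0] M by simp
  have vs: "v x = 0" if x: "\<bar>x\<bar> > pi" for x
  proof -
    have "1 * \<bar>x\<bar> \<ge> 1 * 1" using x pi_gt3 by simp
    then have "M * 1 \<le> M * \<bar>x\<bar>" using M by (intro mult_left_mono) auto
    moreover have "\<bar>M * x\<bar> = M * \<bar>x\<bar>" using M by (simp add: abs_mult)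
    moreover have "R < M * 1" unfolding M_def using abs_ge_self[of R] by simp
    ultimately have "\<bar>M * x\<bar> > R" by linarith
    then show ?thesis using s[of "M * x"] by (simp add: v_def)
  qed
  note vb = fourier_L2_bound_pi[OF vL vs]
  have fw: "fourier_L1 w = (\<lambda>\<xi>. of_real M * fourier_L1 v (M * \<xi> + 0))"
  proof
    fix \<xi>
    show "fourier_L1 w \<xi> = of_real M * fourier_L1 v (M * \<xi> + 0)"
      using fourier_L1_affine[OF M, of w 0 \<xi>] M unfolding v_def[abs_def] by simp
  qed
  show "fourier_L1 w \<in> L2_real" unfolding fw by (intro L2_real_cmult L2_real_affine) (use vb M in auto)
  have "(L2_norm (fourier_L1 w))\<^sup>2 = M\<^sup>2 * ((L2_norm (fourier_L1 v))\<^sup>2 / M)"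
    unfolding fw L2_norm_cmult power_mult_distrib using L2_norm_affine[of M "fourier_L1 v" 0] M by simp
  also have "\<dots> \<le> M\<^sup>2 * ((2 * pi * (L2_norm v)\<^sup>2) / M)"
    using vb M by (intro mult_left_mono divide_right_mono) auto
  also have "\<dots> = 2 * pi * (L2_norm w)\<^sup>2" unfolding vn using M by (simp add: power2_eq_square)
  finally show "(L2_norm (fourier_L1 w))\<^sup>2 \<le> 2 * pi * (L2_norm w)\<^sup>2" .
qed

text \<open>
  The function is itself integrable, so the constant sequence witnesses the extension by continuity.
\<close>
lemma has_fourier_L2_compact_support:
  assumes w: "w \<in> L2_real" and s: "\<And>x. \<bar>x\<bar> > R \<Longrightarrow> w x = 0"
  shows "has_fourier_L2 w (fourier_L1 w)"
  unfolding has_fourier_L2_def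
proof (intro exI[of _ "\<lambda>_. w"] conjI allI)
  show "w \<in> L1_real" using L2_compact_support_integrable[OF w s] by (simp add: L1_real_def)
  show "L2_converges (\<lambda>n. w) w" using w by (simp add: L2_converges_def L2_norm_def)
  show "L2_converges (\<lambda>n. fourier_L1 w) (fourier_L1 w)"
    using fourier_L2_bound(1)[OF w s] by (simp add: L2_converges_def L2_norm_def)
qed

text \<open>
  The transform of the sum is a trigonometric polynomial times the transform of \<open>w\<close>.
  Its norm over \<open>[-pi, pi]\<close> is at least \<open>c0\<close> times that of the polynomial,
  and its norm over the line is bounded by \<open>fourier_L2_bound\<close>.
\<close>
lemma shift_sum_lower_bound:
  assumes w: "w \<in> L2_real" and s: "\<And>x. \<bar>x\<bar> > R \<Longrightarrow> w x = 0"
    and c0: "c0 \<ge> 0" "\<And>\<xi>. \<xi> \<in> {-pi..pi} \<Longrightarrow> c0 \<le> cmod (fourier_L1 w \<xi>)"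
    and F: "finite F"
  shows "c0\<^sup>2 * (\<Sum>k\<in>F. (cmod (c k))\<^sup>2) \<le> (L2_norm (\<lambda>x. \<Sum>k\<in>F. c k * w (x + of_int k)))\<^sup>2"
proof -
  define W where "W = (\<lambda>x. \<Sum>k\<in>F. c k * w (x + of_int k))"
  define P where "P \<xi> = (\<Sum>k\<in>F. c k * cis (of_int k * \<xi>))" for \<xi>
  have wi: "integrable lebesgue w" by (rule L2_compact_support_integrable[OF w s])
  have WL: "W \<in> L2_real" unfolding W_def by (intro L2_real_sum L2_real_cmult L2_real_shift w)
  define R' where "R' = R + of_int (\<Sum>k\<in>F. \<bar>k\<bar>)"
  have Ws: "W x = 0" if x: "\<bar>x\<bar> > R'" for x
  proof -
    have "w (x + of_int k) = 0" if k: "k \<in> F" for k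
    proof (rule s)
      have "\<bar>k\<bar> \<le> (\<Sum>k\<in>F. \<bar>k\<bar>)" using F k by (intro member_le_sum) auto
      then have "\<bar>real_of_int k\<bar> \<le> of_int (\<Sum>k\<in>F. \<bar>k\<bar>)" by (metis of_int_abs of_int_le_iff)
      then show "\<bar>x + of_int k\<bar> > R" using x unfolding R'_def by linarith
    qed
    then show ?thesis by (simp add: W_def)
  qed
  have fW: "fourier_L1 W \<xi> = P \<xi> * fourier_L1 w \<xi>" for \<xi>
  proof -
    have "fourier_L1 W \<xi> = (\<Sum>k\<in>F. c k * fourier_L1 (\<lambda>x. w (x + of_int k)) \<xi>)"
      unfolding W_def using integrable_affine[OF wi, of 1] by (intro fourier_L1_sum) simp
    then show ?thesis unfolding P_def fourier_L1_shift by (simp add: sum_distrib_right mult.assoc)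
  qed
  have Wi: "integrable lebesgue W" by (rule L2_compact_support_integrable[OF WL Ws])
  have Pc: "continuous_on {-pi..pi} (\<lambda>\<xi>. c0\<^sup>2 * (cmod (P \<xi>))\<^sup>2)"
    unfolding P_def by (intro continuous_intros)
  have FL: "fourier_L1 W \<in> L2_real" by (rule fourier_L2_bound(1)[OF WL Ws])
  have "c0\<^sup>2 * (2 * pi * (\<Sum>k\<in>F. (cmod (c k))\<^sup>2)) = integral {-pi..pi} (\<lambda>\<xi>. c0\<^sup>2 * (cmod (P \<xi>))\<^sup>2)"
    unfolding P_def integral_mult_right integral_norm_trig_poly[OF F] ..
  also have "\<dots> = (\<integral>\<xi>. indicator {-pi..pi} \<xi> *\<^sub>R (c0\<^sup>2 * (cmod (P \<xi>))\<^sup>2) \<partial>lebesgue)"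
    by (rule lebesgue_integral_indicator_continuous(2)[OF Pc, symmetric])
  also have "\<dots> \<le> (\<integral>\<xi>. (cmod (fourier_L1 W \<xi>))\<^sup>2 \<partial>lebesgue)"
  proof (rule integral_mono[OF lebesgue_integral_indicator_continuous(1)[OF Pc] L2_realD(2)[OF FL]])
    fix \<xi>
    show "indicator {-pi..pi} \<xi> *\<^sub>R (c0\<^sup>2 * (cmod (P \<xi>))\<^sup>2) \<le> (cmod (fourier_L1 W \<xi>))\<^sup>2"
    proof (cases "\<xi> \<in> {-pi..pi}")
      case True
      have "c0\<^sup>2 \<le> (cmod (fourier_L1 w \<xi>))\<^sup>2" by (rule power_mono[OF c0(2)[OF True] c0(1)])
      from mult_right_mono[OF this, of "(cmod (P \<xi>))\<^sup>2"]
      have "c0\<^sup>2 * (cmod (P \<xi>))\<^sup>2 \<le> (cmod (fourier_L1 W \<xi>))\<^sup>2"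
        unfolding fW norm_mult power_mult_distrib by (simp add: mult.commute)
      then show ?thesis using True by simp
    qed simp
  qed
  also have "\<dots> \<le> 2 * pi * (L2_norm W)\<^sup>2"
    unfolding L2_norm_sq[symmetric] by (rule fourier_L2_bound(2)[OF WL Ws])
  finally have "2 * pi * (c0\<^sup>2 * (\<Sum>k\<in>F. (cmod (c k))\<^sup>2)) \<le> 2 * pi * (L2_norm W)\<^sup>2" by (simp add: mult_ac)
  then show ?thesis unfolding W_def by simp
qed

section \<open>Wavelet frames from trigonometric masks\<close>

lemma continuous_zero_free_bound:
  fixes h :: "real \<Rightarrow> complex"
  assumes "continuous_on UNIV h" "\<And>x. x \<in> {-pi..pi} \<Longrightarrow> h x \<noteq> 0"
  obtains c where "c > 0" "\<And>x. x \<in> {-pi..pi} \<Longrightarrow> c \<le> cmod (h x)"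
proof -
  have "continuous_on {-pi..pi} (\<lambda>x. cmod (h x))"
    by (intro continuous_intros continuous_on_subset[OF assms(1)]) simp
  moreover have "{-pi..pi} \<noteq> {}" using pi_ge_zero by simp
  ultimately obtain y where y: "y \<in> {-pi..pi}" "\<And>x. x \<in> {-pi..pi} \<Longrightarrow> cmod (h y) \<le> cmod (h x)"
    using continuous_attains_inf[of "{-pi..pi}" "\<lambda>x. cmod (h x)"] by auto
  show ?thesis by (rule that[of "cmod (h y)"]) (use assms(2)[OF y(1)] y(2) in auto)
qed

text \<open>
  If \<open>h\<close> vanishes at a point of \<open>[-pi, pi]\<close>, then it vanishes at half of
  it, because the mask does not vanish there. Repeated halving contradicts continuity at the origin.
\<close>
lemma refinable_transform_nonzero:
  fixes h :: "real \<Rightarrow> complex"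
  assumes cont: "continuous_on UNIV h" and h0: "h 0 = 1"
    and ref: "\<And>\<xi>. h (2 * \<xi>) = m0 \<xi> * h \<xi>"
    and nz: "\<And>x. x \<in> {-pi/2..pi/2} \<Longrightarrow> m0 x \<noteq> 0"
    and x: "x \<in> {-pi..pi}"
  shows "h x \<noteq> 0"
proof
  assume hx: "h x = 0"
  have small: "x / 2 ^ n \<in> {-pi..pi}" for n :: nat
  proof -
    have "\<bar>x\<bar> / 2 ^ n \<le> \<bar>x\<bar> / 1" by (intro divide_left_mono) auto
    also have "\<dots> \<le> pi" using x by (simp add: abs_le_iff)
    finally have "\<bar>x / 2 ^ n\<bar> \<le> pi" by simp
    then show ?thesis unfolding abs_le_iff by simp
  qed
  have z: "h (x / 2 ^ n) = 0" for n :: nat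
  proof (induction n)
    case (Suc n)
    have "2 * (x / 2 ^ Suc n) = x / 2 ^ n" by simp
    then have "m0 (x / 2 ^ Suc n) * h (x / 2 ^ Suc n) = 0" using Suc ref[of "x / 2 ^ Suc n"] by (simp only:)
    moreover have "m0 (x / 2 ^ Suc n) \<noteq> 0"
    proof (rule nz)
      have "x / 2 ^ Suc n = (x / 2 ^ n) / 2" by simp
      then show "x / 2 ^ Suc n \<in> {-pi/2..pi/2}" using small[of n] by simp
    qed
    ultimately show ?case by (simp only: mult_eq_0_iff) simp
  qed (simp add: hx)
  have "(\<lambda>n. x * (1/2) ^ n) \<longlonglongrightarrow> x * 0" by (intro tendsto_intros LIMSEQ_realpow_zero) auto
  then have "(\<lambda>n. x / 2 ^ n) \<longlonglongrightarrow> 0" by (simp add: power_divide)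
  moreover have "isCont h 0" using cont by (simp add: continuous_on_eq_continuous_at)
  ultimately have "(\<lambda>n. h (x / 2 ^ n)) \<longlonglongrightarrow> h 0" by (rule isCont_tendsto_compose[rotated])
  then have "(\<lambda>n. 0) \<longlonglongrightarrow> h 0" unfolding z .
  then show False using h0 LIMSEQ_unique[OF tendsto_const, of 0 "h 0"] by simp
qed

lemma trig_poly_L2_2pi:
  assumes "trig_poly f" shows "f \<in> L2_2pi"
  unfolding L2_2pi_def set_integrable_def
proof (intro CollectI conjI allI)
  show "f \<in> borel_measurable lebesgue"
    by (rule continuous_borel_measurable_lebesgue[OF trig_poly_continuous[OF assms]])
  show "f (x + 2 * pi) = f x" for x by (rule trig_poly_periodic[OF assms])
  have c: "continuous_on {-pi..pi} (\<lambda>x. (cmod (f x))\<^sup>2)"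
    by (intro continuous_intros trig_poly_continuous[OF assms])
  have "set_integrable lebesgue {-pi..pi} (\<lambda>x. (cmod (f x))\<^sup>2)"
    by (rule absolutely_integrable_continuous_real[OF c])
  then have "set_integrable lebesgue {-pi..<pi} (\<lambda>x. (cmod (f x))\<^sup>2)"
    by (rule set_integrable_subset) auto
  then show "integrable lebesgue (\<lambda>x. indicat_real {-pi..<pi} x *\<^sub>R (cmod (f x))\<^sup>2)"
    by (simp only: set_integrable_def)
qed

lemma trig_polys_common_degree:
  fixes m :: "nat \<Rightarrow> real \<Rightarrow> complex"
  assumes "\<And>r. r \<le> q \<Longrightarrow> trig_poly (m r)"
  obtains N :: int and a where "N \<ge> 1" "\<And>r k. r \<le> q \<Longrightarrow> k \<notin> {-N..N} \<Longrightarrow> a r k = 0"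
    "\<And>r x. r \<le> q \<Longrightarrow> m r x = (\<Sum>k\<in>{-N..N}. a r k * cis (of_int k * x))"
proof -
  have "\<exists>N0 b. (\<forall>k. \<bar>k\<bar> > N0 \<longrightarrow> b k = 0) \<and> (\<forall>N x. N \<ge> N0 \<longrightarrow> m r x = (\<Sum>k\<in>{-N..N}. b k * cis (of_int k * x)))"
    if "r \<le> q" for r
    by (rule trig_poly_coeffs[OF assms[OF that]]) blast
  then obtain N0 :: "nat \<Rightarrow> int" and a where
    a: "\<And>r k. r \<le> q \<Longrightarrow> \<bar>k\<bar> > N0 r \<Longrightarrow> a r k = 0"
       "\<And>r N x. r \<le> q \<Longrightarrow> N \<ge> N0 r \<Longrightarrow> m r x = (\<Sum>k\<in>{-N..N}. a r k * cis (of_int k * x))"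
    by metis
  define N where "N = Max (insert 1 (N0 ` {..q}))"
  have N: "N0 r \<le> N" if "r \<le> q" for r unfolding N_def using that by (intro Max_ge) auto
  have N1: "N \<ge> 1" unfolding N_def by (intro Max_ge) auto
  show ?thesis
  proof (rule that[OF N1])
    fix r k assume r: "r \<le> q" and "k \<notin> {-N..N}"
    then have "\<bar>k\<bar> > N0 r" using N[OF r] by auto
    then show "a r k = 0" by (rule a(1)[OF r])
  next
    fix r x assume r: "r \<le> q"
    show "m r x = (\<Sum>k\<in>{-N..N}. a r k * cis (of_int k * x))" by (rule a(2)[OF r N[OF r]])
  qed
qed

text \<open>
  All conclusions hold for the refinable function of \<open>refinable_function_exists\<close> and
  its refinements by the wavelet masks. As it is a fixed point of its own refinement operator up to
  a null set, its transform satisfies the refinement equation everywhere.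
\<close>
theorem trig_mask_wavelet_frame:
  assumes tm: "\<And>r. r \<le> q \<Longrightarrow> trig_poly (m r)" and q: "q \<ge> 1" and m00: "m 0 0 = 1"
    and u1: "\<And>x. (\<Sum>r\<le>q. m r x * cnj (m r x)) = 1"
    and u2: "\<And>x. (\<Sum>r\<le>q. m r x * cnj (m r (x + pi))) = 0"
    and nz: "\<And>x. x \<in> {-pi/2..pi/2} \<Longrightarrow> m 0 x \<noteq> 0"
  shows "\<exists>\<phi> \<psi>. parseval_wavelet_frame q m \<phi> \<psi> \<and> (\<forall>r\<in>{1..q}. compactly_supported (\<psi> r)) \<and>
    stable_integer_shifts \<phi>"
proof -
  obtain N :: int and a where N1: "N \<ge> 1"
    and supp: "\<And>r k. r \<le> q \<Longrightarrow> k \<notin> {-N..N} \<Longrightarrow> a r k = 0"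
    and ma: "\<And>r x. r \<le> q \<Longrightarrow> m r x = (\<Sum>k\<in>{-N..N}. a r k * cis (of_int k * x))"
    by (rule trig_polys_common_degree[of q m], rule tm, assumption) (rule that; assumption)
  interpret filter_bank N q a
  proof
    show "N \<ge> 1" by (rule N1)
    show "a r k = 0" if "r \<le> q" "k \<notin> {-N..N}" for r k by (rule supp[OF that])
    show "(\<Sum>k\<in>{-N..N}. a 0 k) = 1" using ma[of 0 0] m00 by simp
    show "2 * (\<Sum>r\<le>q. \<Sum>n\<in>{n\<in>{-N..N}. even n = p}. a r n * cnj (a r (n + d))) = (if d = 0 then 1 else 0)" for d p
    proof (rule uep_coefficients)
      show "a r k = 0" if "r \<le> q" "k \<notin> {-N..N}" for r k by (rule supp[OF that])
      have s1: "(\<Sum>r\<le>q. (\<Sum>k\<in>{-N..N}. a r k * cis (of_int k * x)) * cnj (\<Sum>k\<in>{-N..N}. a r k * cis (of_int k * y)))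
         = (\<Sum>r\<le>q. m r x * cnj (m r y))" for x y
        by (intro sum.cong refl) (simp only: atMost_iff ma)
      show "(\<Sum>r\<le>q. (\<Sum>k\<in>{-N..N}. a r k * cis (of_int k * x)) * cnj (\<Sum>k\<in>{-N..N}. a r k * cis (of_int k * x))) = 1" for x
        unfolding s1 by (rule u1)
      show "(\<Sum>r\<le>q. (\<Sum>k\<in>{-N..N}. a r k * cis (of_int k * x)) * cnj (\<Sum>k\<in>{-N..N}. a r k * cis (of_int k * (x + pi)))) = 0" for x
        unfolding s1 by (rule u2)
    qed
  qed
  obtain \<phi> where \<phi>: "\<phi> \<in> L2_real" "\<And>x. \<bar>x\<bar> > of_int N \<Longrightarrow> \<phi> x = 0" "(\<integral>x. \<phi> x \<partial>lebesgue) = 1"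
    "shift_contractive \<phi>" "L2_norm (\<lambda>x. T \<phi> x - \<phi> x) = 0"
    by (rule refinable_function_exists) (rule that; assumption)
  define \<psi> where "\<psi> r = refine N (a r) \<phi>" for r
  define h where "h = fourier_L1 \<phi>"
  have \<phi>i: "integrable lebesgue \<phi>" by (rule L2_compact_support_integrable[OF \<phi>(1,2)])
  have \<psi>L: "\<psi> r \<in> L2_real" for r unfolding \<psi>_def by (rule L2_real_refine[OF \<phi>(1)])
  have \<psi>s: "\<psi> r x = 0" if "\<bar>x\<bar> > of_int N" for r x
    unfolding \<psi>_def by (rule refine_support[OF \<phi>(2) that])
  have f\<psi>: "fourier_L1 (\<psi> r) (2 * \<xi>) = m r \<xi> * h \<xi>" if "r \<le> q" for r \<xi>
    unfolding \<psi>_def fourier_L1_refine[OF \<phi>i] ma[OF that] h_def ..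
  have h2: "h (2 * \<xi>) = m 0 \<xi> * h \<xi>" for \<xi>
  proof -
    have "AE x in lebesgue. T \<phi> x - \<phi> x = 0"
      by (rule L2_norm_zero_AE[OF L2_real_diff[OF L2_real_refine[OF \<phi>(1)] \<phi>(1)] \<phi>(5)])
    then have ae: "AE x in lebesgue. \<psi> 0 x = \<phi> x" unfolding \<psi>_def by simp
    have "fourier_L1 (\<psi> 0) \<eta> = fourier_L1 \<phi> \<eta>" for \<eta>
      unfolding fourier_L1_cis
    proof (rule integral_cong_AE)
      show "(\<lambda>x. \<psi> 0 x * cis (- (x * \<eta>))) \<in> borel_measurable lebesgue"
        using L2_compact_support_integrable[OF \<psi>L \<psi>s] by (intro borel_measurable_integrable integrable_fourier)
      show "(\<lambda>x. \<phi> x * cis (- (x * \<eta>))) \<in> borel_measurable lebesgue"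
        by (intro borel_measurable_integrable integrable_fourier \<phi>i)
      show "AE x in lebesgue. \<psi> 0 x * cis (- (x * \<eta>)) = \<phi> x * cis (- (x * \<eta>))"
        by (rule AE_mp[OF ae]) simp
    qed
    then show ?thesis using f\<psi>[of 0 \<xi>] by (simp add: h_def)
  qed
  have hc: "continuous_on UNIV h" unfolding h_def by (rule continuous_fourier_L1[OF \<phi>i])
  have h0: "h 0 = 1" unfolding h_def fourier_L1_cis using \<phi>(3) by simp
  have hlim: "(h \<longlongrightarrow> 1) (at 0)"
    using hc h0 by (simp add: continuous_on_eq_continuous_at isCont_def) (metis)
  obtain c0 where c0: "c0 > 0" "\<And>x. x \<in> {-pi..pi} \<Longrightarrow> c0 \<le> cmod (h x)"
    by (rule continuous_zero_free_bound[OF hc refinable_transform_nonzero[OF hc h0 h2 nz]]) blast+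
  have stable: "stable_integer_shifts \<phi>"
    unfolding stable_integer_shifts_def
  proof (intro exI conjI allI impI)
    show "0 < min 1 (c0\<^sup>2)" using c0 by simp
    show "min 1 (c0\<^sup>2) \<le> 1" by simp
    fix c :: "int \<Rightarrow> complex" assume fin: "finite {k. c k \<noteq> 0}"
    have "min 1 (c0\<^sup>2) * (\<Sum>k | c k \<noteq> 0. (cmod (c k))\<^sup>2) \<le> c0\<^sup>2 * (\<Sum>k | c k \<noteq> 0. (cmod (c k))\<^sup>2)"
      by (intro mult_right_mono sum_nonneg) auto
    also have "\<dots> \<le> (L2_norm (\<lambda>x. \<Sum>k | c k \<noteq> 0. c k * \<phi> (x + of_int k)))\<^sup>2"
      by (rule shift_sum_lower_bound[OF \<phi>(1,2) less_imp_le[OF c0(1)] c0(2)[unfolded h_def] fin])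
    finally show "min 1 (c0\<^sup>2) * (\<Sum>k | c k \<noteq> 0. (cmod (c k))\<^sup>2)
      \<le> (L2_norm (\<lambda>x. \<Sum>k | c k \<noteq> 0. c k * \<phi> (x + of_int k)))\<^sup>2" .
    show "(L2_norm (\<lambda>x. \<Sum>k | c k \<noteq> 0. c k * \<phi> (x + of_int k)))\<^sup>2 \<le> 1 * (\<Sum>k | c k \<noteq> 0. (cmod (c k))\<^sup>2)"
      using \<phi>(4) fin unfolding shift_contractive_def by simp
  qed
  have frame: "parseval_wavelet_frame q m \<phi> \<psi>"
    unfolding parseval_wavelet_frame_def
  proof (intro conjI ballI)
    show "1 \<le> q" by (rule q)
    show "\<phi> \<in> L2_real" by (rule \<phi>(1))
    show "m r \<in> L2_2pi" if "r \<in> {0..q}" for r using that by (intro trig_poly_L2_2pi tm) simp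
    show "\<psi> r \<in> L2_real" for r by (rule \<psi>L)
    have "(\<Sum>r=0..q. (cmod (m r \<xi>))\<^sup>2) = 1 \<and> (\<Sum>r=0..q. m r \<xi> * cnj (m r (\<xi> + pi))) = 0" for \<xi>
    proof
      have "complex_of_real (\<Sum>r=0..q. (cmod (m r \<xi>))\<^sup>2) = 1"
        unfolding of_real_sum complex_norm_square using u1[of \<xi>] by (simp only: atMost_atLeast0)
      then show "(\<Sum>r=0..q. (cmod (m r \<xi>))\<^sup>2) = 1" by (simp only: of_real_eq_1_iff)
      show "(\<Sum>r=0..q. m r \<xi> * cnj (m r (\<xi> + pi))) = 0" using u2[of \<xi>] by (simp only: atMost_atLeast0)
    qed
    then show "AE \<xi> in lebesgue. \<xi> \<in> {-pi..<pi} \<longrightarrow>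
        (\<Sum>r=0..q. (cmod (m r \<xi>))\<^sup>2) = 1 \<and> (\<Sum>r=0..q. m r \<xi> * cnj (m r (\<xi> + pi))) = 0"
      by (intro AE_I2 impI)
    show "\<exists>\<phi>h. has_fourier_L2 \<phi> \<phi>h \<and> (AE \<xi> in lebesgue. \<phi>h (2 * \<xi>) = m 0 \<xi> * \<phi>h \<xi>) \<and> (\<phi>h \<longlongrightarrow> 1) (at 0) \<and>
        (\<forall>r\<in>{1..q}. \<exists>\<psi>h. has_fourier_L2 (\<psi> r) \<psi>h \<and> (AE \<xi> in lebesgue. \<psi>h (2 * \<xi>) = m r \<xi> * \<phi>h \<xi>))"
    proof (rule exI[of _ h], intro conjI ballI)
      show "has_fourier_L2 \<phi> h" unfolding h_def by (rule has_fourier_L2_compact_support[OF \<phi>(1,2)])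
      show "AE \<xi> in lebesgue. h (2 * \<xi>) = m 0 \<xi> * h \<xi>" by (intro AE_I2 h2)
      show "(h \<longlongrightarrow> 1) (at 0)" by (rule hlim)
      fix r assume r: "r \<in> {1..q}"
      show "\<exists>\<psi>h. has_fourier_L2 (\<psi> r) \<psi>h \<and> (AE \<xi> in lebesgue. \<psi>h (2 * \<xi>) = m r \<xi> * h \<xi>)"
      proof (intro exI[of _ "fourier_L1 (\<psi> r)"] conjI)
        show "has_fourier_L2 (\<psi> r) (fourier_L1 (\<psi> r))" by (rule has_fourier_L2_compact_support[OF \<psi>L \<psi>s])
        show "AE \<xi> in lebesgue. fourier_L1 (\<psi> r) (2 * \<xi>) = m r \<xi> * h \<xi>"
          using r by (intro AE_I2 f\<psi>) simp
      qed
    qed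
    show "parseval_system q \<psi>"
      using wavelet_parseval[OF \<phi>(1,2,3,5)] unfolding \<psi>_def[abs_def] .
  qed
  have "compactly_supported (\<psi> r)" for r
    unfolding compactly_supported_def
  proof (intro exI[of _ "{- real_of_int N..real_of_int N}"] conjI AE_I2 impI)
    fix x assume "x \<notin> {- real_of_int N..real_of_int N}"
    then have "\<bar>x\<bar> > of_int N" by auto
    then show "\<psi> r x = 0" by (rule \<psi>s)
  qed simp
  then show ?thesis using frame stable by blast
qed

theorem theorem1:
  fixes f :: "real \<Rightarrow> complex" and \<epsilon> :: real
  assumes "f \<in> C_2pi"
    and "f 0 = 1"
    and "\<forall>x. (cmod (f x))\<^sup>2 + (cmod (f (x + pi)))\<^sup>2 \<le> 1"
    and "\<epsilon> > 0"
  shows "\<exists>q m \<phi> \<psi>. parseval_wavelet_frame q m \<phi> \<psi> \<and>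
           (\<forall>r\<in>{1..q}. compactly_supported (\<psi> r)) \<and>
           m 0 \<in> C_2pi \<and> (SUP x. cmod (f x - m 0 x)) < \<epsilon> \<and>
           stable_integer_shifts \<phi>"
proof -
  obtain m0 where m0: "trig_poly m0" "m0 0 = 1"
    "\<And>x. (cmod (m0 x))\<^sup>2 + (cmod (m0 (x + pi)))\<^sup>2 \<le> 1"
    "\<And>x. x \<in> {-pi/2..pi/2} \<Longrightarrow> m0 x \<noteq> 0"
    "\<And>x. cmod (f x - m0 x) \<le> \<epsilon> / 2"
    by (rule mask_approximation[OF assms(1,2) assms(3)[rule_format] assms(4)]) (rule that; assumption)
  obtain m :: "nat \<Rightarrow> real \<Rightarrow> complex" where m: "m 0 = m0" "\<And>r. r \<le> 3 \<Longrightarrow> trig_poly (m r)"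
    "\<And>x. (\<Sum>r\<le>3. m r x * cnj (m r x)) = 1"
    "\<And>x. (\<Sum>r\<le>3. m r x * cnj (m r (x + pi))) = 0"
    by (rule uep_masks_exist[OF m0(1,3)]) (rule that; assumption)
  have "\<exists>\<phi> \<psi>. parseval_wavelet_frame 3 m \<phi> \<psi> \<and> (\<forall>r\<in>{1..3}. compactly_supported (\<psi> r)) \<and>
    stable_integer_shifts \<phi>"
    by (rule trig_mask_wavelet_frame) (use m m0 in auto)
  moreover have "m 0 \<in> C_2pi" unfolding m(1) by (rule trig_poly_C_2pi[OF m0(1)])
  moreover have "(SUP x. cmod (f x - m 0 x)) < \<epsilon>"
  proof -
    have "(SUP x. cmod (f x - m 0 x)) \<le> \<epsilon> / 2"
      unfolding m(1) by (intro cSUP_least m0(5)) simp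
    then show ?thesis using assms(4) by linarith
  qed
  ultimately show ?thesis by blast
qed

end
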